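(* Given $(u_0,v_0)\in\mathcal I\times\mathcal I$, there exists a unique solution $(u,v)\in C(\mathbb R,\mathcal I\times\mathcal I)$ of the massive Thirring model $$i(u_t+u_x)+v+|v|^2u=0,\qquad i(v_t-v_x)+u+|u|^2v=0,\qquad (x,t)\in\mathbb R\times\mathbb R,$$ with initial data $(u(\cdot,0),v(\cdot,0))=(u_0,v_0)$.
   Context: $\|f\|_{L^{2,1}}=\|(1+|x|)f\|_{L^2(\mathbb R)}$; $\mathcal I=\{f:\mathbb R\to\mathbb C:\ f,f',f''\in L^{2,1}(\mathbb R)\}$, with norm $\|f\|_{\mathcal I}=\|f\|_{L^{2,1}}+\|f'\|_{L^{2,1}}+\|f''\|_{L^{2,1}}$. $C(\mathbb R,X)$ denotes continuous functions of time $t\in\mathbb R$ with values in $X$. *)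

theory Defs
  imports "HOL-Analysis.Analysis"
begin

definition locally_integrable :: "(real \<Rightarrow> complex) \<Rightarrow> bool" where
  "locally_integrable f \<longleftrightarrow> (\<forall>a b. set_integrable lebesgue {a..b} f)"

text \<open>Real-valued test functions of class $C^1$ with compact support; for locally integrable
  functions these give the same weak derivative as $C^\infty$ (complex) test functions.\<close>

definition test_function :: "(real \<Rightarrow> real) \<Rightarrow> bool" where
  "test_function \<phi> \<longleftrightarrow> \<phi> C1_differentiable_on UNIV \<and> (\<exists>R. \<forall>x. \<bar>x\<bar> > R \<longrightarrow> \<phi> x = 0)"

definition has_weak_deriv :: "(real \<Rightarrow> complex) \<Rightarrow> (real \<Rightarrow> complex) \<Rightarrow> bool" where
  "has_weak_deriv f g \<longleftrightarrow> locally_integrable f \<and> locally_integrable g \<and>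
     (\<forall>\<phi>. test_function \<phi> \<longrightarrow>
       (LINT x|lebesgue. deriv \<phi> x *\<^sub>R f x) = - (LINT x|lebesgue. \<phi> x *\<^sub>R g x))"

text \<open>A weak derivative is determined only almost everywhere; \<open>weak_deriv\<close> selects a version.
  Membership in $L^{2,1}$ and the $L^{2,1}$ norm do not depend on the version.\<close>

definition weak_deriv :: "(real \<Rightarrow> complex) \<Rightarrow> (real \<Rightarrow> complex)" where
  "weak_deriv f = (SOME g. has_weak_deriv f g)"

definition L21 :: "(real \<Rightarrow> complex) set" where
  "L21 = {f. f \<in> borel_measurable lebesgue \<and>
             integrable lebesgue (\<lambda>x. ((1 + \<bar>x\<bar>) * cmod (f x))\<^sup>2)}"

definition norm_L21 :: "(real \<Rightarrow> complex) \<Rightarrow> real" where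
  "norm_L21 f = sqrt (LINT x|lebesgue. ((1 + \<bar>x\<bar>) * cmod (f x))\<^sup>2)"

definition space_I :: "(real \<Rightarrow> complex) set" where
  "space_I = {f. f \<in> L21 \<and>
     (\<exists>f'. has_weak_deriv f f' \<and> f' \<in> L21 \<and>
       (\<exists>f''. has_weak_deriv f' f'' \<and> f'' \<in> L21))}"

definition norm_I :: "(real \<Rightarrow> complex) \<Rightarrow> real" where
  "norm_I f = norm_L21 f + norm_L21 (weak_deriv f) + norm_L21 (weak_deriv (weak_deriv f))"

text \<open>The space $C(\mathbb R,\mathcal I)$, a function $u$ of $(x,t)$ being written as
  \<open>t \<mapsto> u t\<close>.  Elements of $\mathcal I$ are classes of functions modulo equality almost
  everywhere; each class has exactly one continuous representative (which is $C^1$), and each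
  value \<open>u t\<close> is taken to be that representative, so that the equations make
  sense pointwise and equality in $\mathcal I$ is equality of functions.\<close>

definition C_time_I :: "(real \<Rightarrow> real \<Rightarrow> complex) set" where
  "C_time_I = {u. (\<forall>t. u t \<in> space_I \<and> continuous_on UNIV (u t)) \<and>
                  (\<forall>t. ((\<lambda>s. norm_I (\<lambda>x. u s x - u t x)) \<longlongrightarrow> 0) (at t))}"

definition massive_Thirring ::
  "(real \<Rightarrow> real \<Rightarrow> complex) \<Rightarrow> (real \<Rightarrow> real \<Rightarrow> complex) \<Rightarrow> bool" where
  "massive_Thirring u v \<longleftrightarrow>
     (\<forall>x t. (\<lambda>s. u s x) differentiable (at t) \<and> u t differentiable (at x) \<and>
            (\<lambda>s. v s x) differentiable (at t) \<and> v t differentiable (at x) \<and>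
            \<i> * (vector_derivative (\<lambda>s. u s x) (at t) + vector_derivative (u t) (at x))
              + v t x + of_real ((cmod (v t x))\<^sup>2) * u t x = 0 \<and>
            \<i> * (vector_derivative (\<lambda>s. v s x) (at t) - vector_derivative (v t) (at x))
              + u t x + of_real ((cmod (u t x))\<^sup>2) * v t x = 0)"

end

theory Submission
  imports Defs
begin

text \<open>The unknowns are indexed by a truth value: \<open>U True\<close> and \<open>U False\<close> are the components
transported with speed \<open>1\<close> and \<open>-1\<close>, and the system is symmetric under exchange, so every
statement is made for an arbitrary index \<open>b\<close>, the other component having index \<open>\<not> b\<close>.
Along its own characteristic each component obeys an ordinary differential equation,
so that a solution satisfies the integral equation
\<open>U b t x = u\<^sub>0 b (x \<mp> t) + \<integral>\<^sub>0\<^sup>t i (V + \<bar>V\<bar>\<^sup>2 U) ds\<close>, integrated along the characteristic,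
with \<open>V = U (\<not> b)\<close>.

Global existence rests on one observation. In the equation for \<open>U\<close> the cubic term is a
real multiple of \<open>i U\<close>, so it does not change \<open>\<bar>U\<bar>\<close>, and only the linear term \<open>V\<close> can.
Hence the supremum of the solution grows at most exponentially, and the bound survives if the
cubic term is truncated (\<open>clipped_tm0_Re\<close>). The truncated problem is Lipschitz, uniformly
on bounded time intervals, and solvable by Picard iteration; by the bound, its solution never meets the truncation
(\<open>bounded_solution_exists\<close>).

The first and second spatial derivatives satisfy linear systems whose coefficients are already
bounded. The data of the second one, \<open>u\<^sub>0''\<close>, are merely square integrable.
The iteration (locale \<open>transport_system\<close>) is therefore done in a pointwise
majorant: each iterate is bounded by a constant times \<open>\<phi> (x \<mp> t) + k x\<close>, where \<open>\<phi>\<close> dominates the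
data and \<open>k\<close> is an average of \<open>\<phi>\<close> against a kernel that decays like the inverse fourth power of the distance. The rough
profile travels unchanged along the component's own characteristics, while a profile that
crosses in the other direction is integrated and hence absorbed by \<open>k\<close>
(\<open>seg_integral_crossing\<close>, \<open>majorant_contraction\<close>). Since \<open>\<phi>\<close> and \<open>k\<close> are square integrable with
the weight, so is everything that they dominate.

That the functions so constructed really are the derivatives of the solution is a uniqueness statement
(\<open>antiderivative_propagates\<close>): the antiderivative of the constructed derivative satisfies the
equation of the original function up to an error controlled by the difference of the two, so
the difference vanishes by a Gronwall argument. Continuity in time with values in \<open>\<I>\<close>
follows from dominated convergence along characteristics and the continuity of translations in
\<open>L\<^sup>2\<close>. It also gives, through the embedding of \<open>L\<^sup>2\<^sup>,\<^sup>1\<close> in \<open>L\<^sup>1\<close>, that \<open>u\<close> and its spatial derivative are jointly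
continuous in space and time. For such functions the differential equations
are equivalent to the integral equations (\<open>massive_Thirring_iff\<close>), and uniqueness is again Gronwall.

Elements of \<open>\<I>\<close> are handled through their second derivative \<open>w\<close>: up to a null set they are
\<open>prim (prim w)\<close>, where \<open>prim\<close> integrates from minus infinity (\<open>space_I_density\<close>). This needs
the lemma of du Bois-Reymond for weak derivatives, proved in \<open>has_weak_deriv_imp_prim\<close>.\<close>

section \<open>Weighted square-integrable functions\<close>

lemma integrable_inverse_weight_sq: "integrable lborel (\<lambda>x::real. 1 / (1 + \<bar>x\<bar>)\<^sup>2)"
proof -
  define g where "g = (\<lambda>x::real. 1 / (1 + \<bar>x\<bar>)\<^sup>2)"
  have gm[measurable]: "g \<in> borel_measurable borel" unfolding g_def by measurable
  have half: "(\<integral>\<^sup>+x. ennreal (1 / (1 + x)\<^sup>2) * indicator {0..} x \<partial>lborel) = ennreal (0 - (- 1 / (1 + 0::real)))"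
  proof (rule nn_integral_FTC_atLeast)
    show "((\<lambda>x::real. - 1 / (1 + x)) \<longlongrightarrow> 0) at_top"
      by (intro tendsto_divide_0[OF tendsto_const] filterlim_at_top_imp_at_infinity
            filterlim_tendsto_add_at_top[OF tendsto_const] filterlim_ident)
  qed (auto intro!: derivative_eq_intros simp: power2_eq_square field_simps)
  have l: "(\<integral>\<^sup>+x. ennreal (g x) * indicator {0..} x \<partial>lborel) = ennreal 1"
  proof -
    have "(\<lambda>x. ennreal (g x) * indicator {0..} x) = (\<lambda>x. ennreal (1 / (1 + x)\<^sup>2) * indicator {0..} x)"
      by (auto simp: fun_eq_iff g_def indicator_def)
    then show ?thesis using half by simp
  qed
  have r: "(\<integral>\<^sup>+x. ennreal (g x) * indicator {..0} x \<partial>lborel) = ennreal 1"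
  proof -
    have "(\<lambda>x. ennreal (g (0 + -1 * x)) * indicator {..0} (0 + -1 * x)) = (\<lambda>x. ennreal (g x) * indicator {0..} x)"
      by (auto simp: fun_eq_iff g_def indicator_def)
    then show ?thesis
      using l by (subst nn_integral_real_affine[where c="-1" and t=0]) simp_all
  qed
  have "(\<integral>\<^sup>+x. ennreal (g x) \<partial>lborel) \<le> (\<integral>\<^sup>+x. (ennreal (g x) * indicator {0..} x + ennreal (g x) * indicator {..0} x) \<partial>lborel)"
    by (intro nn_integral_mono) (auto simp: indicator_def)
  also have "\<dots> = ennreal 1 + ennreal 1" by (subst nn_integral_add) (auto simp: l r)
  also have "\<dots> < \<infinity>" by simp
  finally show ?thesis unfolding g_def[symmetric]
    by (intro integrableI_nonneg) (auto simp: g_def)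
qed

definition weighted_L2 :: "(real \<Rightarrow> 'a::euclidean_space) \<Rightarrow> bool" where
  "weighted_L2 f \<longleftrightarrow> f \<in> borel_measurable borel \<and> integrable lborel (\<lambda>x. ((1 + \<bar>x\<bar>) * norm (f x))\<^sup>2)"

definition weighted_sq :: "(real \<Rightarrow> 'a::euclidean_space) \<Rightarrow> real" where
  "weighted_sq f = (LINT x|lborel. ((1 + \<bar>x\<bar>) * norm (f x))\<^sup>2)"

lemma weighted_L2D:
  assumes "weighted_L2 f"
  shows "f \<in> borel_measurable borel" "integrable lborel (\<lambda>x. ((1 + \<bar>x\<bar>) * norm (f x))\<^sup>2)"
  using assms by (auto simp: weighted_L2_def)

lemma weighted_sq_nonneg: "weighted_sq f \<ge> 0"
  unfolding weighted_sq_def by (intro integral_nonneg_AE) auto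

lemma weighted_L2_dominated:
  fixes f :: "real \<Rightarrow> 'a::euclidean_space" and g :: "real \<Rightarrow> 'b::euclidean_space"
  assumes g: "weighted_L2 g" and f: "f \<in> borel_measurable borel"
    and le: "\<And>x. norm (f x) \<le> C * norm (g x)"
  shows "weighted_L2 f" "weighted_sq f \<le> C\<^sup>2 * weighted_sq g"
proof -
  have p: "((1 + \<bar>x\<bar>) * norm (f x))\<^sup>2 \<le> C\<^sup>2 * ((1 + \<bar>x\<bar>) * norm (g x))\<^sup>2" for x
  proof -
    have "(1 + \<bar>x\<bar>) * norm (f x) \<le> (1 + \<bar>x\<bar>) * (C * norm (g x))"
      by (intro mult_left_mono le) auto
    then have "((1 + \<bar>x\<bar>) * norm (f x))\<^sup>2 \<le> ((1 + \<bar>x\<bar>) * (C * norm (g x)))\<^sup>2"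
      by (intro power_mono) auto
    then show ?thesis by (simp add: power_mult_distrib mult_ac)
  qed
  have i: "integrable lborel (\<lambda>x. C\<^sup>2 * ((1 + \<bar>x\<bar>) * norm (g x))\<^sup>2)"
    using weighted_L2D(2)[OF g] by simp
  have j: "integrable lborel (\<lambda>x. ((1 + \<bar>x\<bar>) * norm (f x))\<^sup>2)"
    by (rule Bochner_Integration.integrable_bound[OF i]) (use f p in auto)
  show "weighted_L2 f" using f j by (simp add: weighted_L2_def)
  have "weighted_sq f \<le> (LINT x|lborel. C\<^sup>2 * ((1 + \<bar>x\<bar>) * norm (g x))\<^sup>2)"
    unfolding weighted_sq_def using i j p by (intro integral_mono) auto
  then show "weighted_sq f \<le> C\<^sup>2 * weighted_sq g" by (simp add: weighted_sq_def)
qed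

lemma weighted_L2_add:
  fixes f g :: "real \<Rightarrow> 'a::euclidean_space"
  assumes f: "weighted_L2 f" and g: "weighted_L2 g"
  shows "weighted_L2 (\<lambda>x. f x + g x)" "weighted_sq (\<lambda>x. f x + g x) \<le> 2 * weighted_sq f + 2 * weighted_sq g"
proof -
  have [measurable]: "f \<in> borel_measurable borel" "g \<in> borel_measurable borel"
    using f g by (auto simp: weighted_L2_def)
  have p: "((1 + \<bar>x\<bar>) * norm (f x + g x))\<^sup>2 \<le> 2 * ((1 + \<bar>x\<bar>) * norm (f x))\<^sup>2 + 2 * ((1 + \<bar>x\<bar>) * norm (g x))\<^sup>2" for x
  proof -
    have "(1 + \<bar>x\<bar>) * norm (f x + g x) \<le> (1 + \<bar>x\<bar>) * (norm (f x) + norm (g x))"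
      by (intro mult_left_mono norm_triangle_ineq) auto
    then have "((1 + \<bar>x\<bar>) * norm (f x + g x))\<^sup>2 \<le> ((1 + \<bar>x\<bar>) * norm (f x) + (1 + \<bar>x\<bar>) * norm (g x))\<^sup>2"
      by (intro power_mono) (auto simp: algebra_simps)
    also have "\<dots> \<le> 2 * ((1 + \<bar>x\<bar>) * norm (f x))\<^sup>2 + 2 * ((1 + \<bar>x\<bar>) * norm (g x))\<^sup>2"
      using sum_squares_bound[of "(1 + \<bar>x\<bar>) * norm (f x)" "(1 + \<bar>x\<bar>) * norm (g x)"]
      unfolding power2_sum by linarith
    finally show ?thesis .
  qed
  have i: "integrable lborel (\<lambda>x. 2 * ((1 + \<bar>x\<bar>) * norm (f x))\<^sup>2 + 2 * ((1 + \<bar>x\<bar>) * norm (g x))\<^sup>2)"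
    using weighted_L2D(2)[OF f] weighted_L2D(2)[OF g] by simp
  have j: "integrable lborel (\<lambda>x. ((1 + \<bar>x\<bar>) * norm (f x + g x))\<^sup>2)"
    by (rule Bochner_Integration.integrable_bound[OF i]) (use p in auto)
  show "weighted_L2 (\<lambda>x. f x + g x)" using j by (simp add: weighted_L2_def)
  have "weighted_sq (\<lambda>x. f x + g x) \<le> (LINT x|lborel. 2 * ((1 + \<bar>x\<bar>) * norm (f x))\<^sup>2 + 2 * ((1 + \<bar>x\<bar>) * norm (g x))\<^sup>2)"
    unfolding weighted_sq_def using i j p by (intro integral_mono) auto
  then show "weighted_sq (\<lambda>x. f x + g x) \<le> 2 * weighted_sq f + 2 * weighted_sq g"
    using weighted_L2D(2)[OF f] weighted_L2D(2)[OF g] by (simp add: weighted_sq_def)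
qed

text \<open>The weight makes square-integrable functions integrable, since its inverse square is
  integrable. The free parameter \<open>a\<close> replaces an optimised Cauchy-Schwarz inequality: it is chosen
  later so that smallness of \<open>weighted_sq\<close> becomes smallness of the \<open>L\<^sup>1\<close> norm.\<close>

lemma weighted_L2_integrable:
  fixes f :: "real \<Rightarrow> 'a::euclidean_space"
  assumes f: "weighted_L2 f"
  shows "integrable lborel f"
    "a > 0 \<Longrightarrow> (LINT x|lborel. norm (f x)) \<le> a * weighted_sq f + (LINT x|lborel. 1 / (1 + \<bar>x::real\<bar>)\<^sup>2) / a"
proof -
  have [measurable]: "f \<in> borel_measurable borel" using f by (auto simp: weighted_L2_def)
  have p: "norm (f x) \<le> a * ((1 + \<bar>x\<bar>) * norm (f x))\<^sup>2 + (1 / (1 + \<bar>x\<bar>)\<^sup>2) / a" if "a > 0" for a x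
  proof -
    define w where "w = 1 + \<bar>x\<bar>"
    define n where "n = norm (f x)"
    have w: "w > 0" by (simp add: w_def)
    have n: "n \<ge> 0" by (simp add: n_def)
    (* the arithmetic-geometric mean inequality for the two summands on the right *)
    have "0 \<le> (a * w * (w * n) - 1)\<^sup>2" by simp
    then have "2 * (a * w\<^sup>2 * n) \<le> a\<^sup>2 * w^4 * n\<^sup>2 + 1" by (simp add: power2_eq_square power4_eq_xxxx algebra_simps)
    moreover have "0 \<le> a * w\<^sup>2 * n" using w n that by simp
    ultimately have "a * w\<^sup>2 * n \<le> a\<^sup>2 * w^4 * n\<^sup>2 + 1" by linarith
    then have "n \<le> a * (w * n)\<^sup>2 + (1 / w\<^sup>2) / a"
      using w that by (simp add: divide_simps power2_eq_square power4_eq_xxxx algebra_simps)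
    then show ?thesis by (simp add: w_def n_def)
  qed
  have i: "integrable lborel (\<lambda>x. a * ((1 + \<bar>x\<bar>) * norm (f x))\<^sup>2 + (1 / (1 + \<bar>x\<bar>)\<^sup>2) / a)" for a
    using weighted_L2D(2)[OF f] integrable_inverse_weight_sq
    by (intro Bochner_Integration.integrable_add integrable_mult_right integrable_divide_zero) (auto simp del: divide_divide_eq_left)
  show j: "integrable lborel f"
    by (rule Bochner_Integration.integrable_bound[OF i[of 1]]) (use p[of 1] in auto)
  assume a: "a > 0"
  have "(LINT x|lborel. norm (f x)) \<le> (LINT x|lborel. a * ((1 + \<bar>x\<bar>) * norm (f x))\<^sup>2 + (1 / (1 + \<bar>x\<bar>)\<^sup>2) / a)"
    by (rule integral_mono) (use i j p a in auto)
  also have "\<dots> = a * weighted_sq f + (LINT x|lborel. 1 / (1 + \<bar>x::real\<bar>)\<^sup>2) / a"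
    using weighted_L2D(2)[OF f] integrable_inverse_weight_sq
    by (subst Bochner_Integration.integral_add) (auto simp: weighted_sq_def simp del: divide_divide_eq_left)
  finally show "(LINT x|lborel. norm (f x)) \<le> a * weighted_sq f + (LINT x|lborel. 1 / (1 + \<bar>x::real\<bar>)\<^sup>2) / a" .
qed

lemma weighted_L2_L1_tendsto_0:
  fixes f :: "'i \<Rightarrow> real \<Rightarrow> 'a::euclidean_space"
  assumes f: "\<And>i. weighted_L2 (f i)" and lim: "((\<lambda>i. weighted_sq (f i)) \<longlongrightarrow> 0) F"
  shows "((\<lambda>i. LINT x|lborel. norm (f i x)) \<longlongrightarrow> 0) F"
proof (rule tendstoI)
  fix e :: real assume e: "e > 0"
  define J where "J = (LINT x|lborel. 1 / (1 + \<bar>x::real\<bar>)\<^sup>2)"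
  have J: "J \<ge> 0" unfolding J_def by (intro integral_nonneg_AE) auto
  define a where "a = 2 * (J + 1) / e"
  have a: "a > 0" using e J by (simp add: a_def)
  have "J / a < e / 2" using J e by (simp add: a_def field_simps)
  have "eventually (\<lambda>i. weighted_sq (f i) < e / (2 * a)) F"
    using lim a e by (intro order_tendstoD) auto
  then show "eventually (\<lambda>i. dist (LINT x|lborel. norm (f i x)) 0 < e) F"
  proof eventually_elim
    case (elim i)
    have "(LINT x|lborel. norm (f i x)) \<le> a * weighted_sq (f i) + J / a"
      using weighted_L2_integrable(2)[OF f a] by (simp add: J_def)
    also have "a * weighted_sq (f i) < e / 2" using elim a by (simp add: field_simps)
    finally have "(LINT x|lborel. norm (f i x)) < e" using \<open>J / a < e / 2\<close> by linarith
    moreover have "(LINT x|lborel. norm (f i x)) \<ge> 0" by (intro integral_nonneg_AE) auto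
    ultimately show ?case by simp
  qed
qed

section \<open>Functions recovered from an integrable derivative\<close>

text \<open>Integration starts at minus infinity, which fixes the constant of integration for
  functions that decay.\<close>

definition prim :: "(real \<Rightarrow> complex) \<Rightarrow> real \<Rightarrow> complex" where
  "prim g x = (LINT y|lborel. indicator {..x} y *\<^sub>R g y)"

lemma integrable_indicator_times:
  fixes g :: "real \<Rightarrow> 'a::{banach, second_countable_topology}"
  assumes "integrable lborel g" "A \<in> sets borel"
  shows "integrable lborel (\<lambda>y. indicator A y *\<^sub>R g y)"
  using assms integrable_mult_indicator[of A lborel g] by simp

lemma prim_add:
  assumes "integrable lborel f" "integrable lborel g"
  shows "prim (\<lambda>x. f x + g x) x = prim f x + prim g x"
  unfolding prim_def scaleR_add_right
  by (intro Bochner_Integration.integral_add integrable_indicator_times assms) auto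

lemma prim_diff:
  assumes "integrable lborel f" "integrable lborel g"
  shows "prim (\<lambda>x. f x - g x) x = prim f x - prim g x"
  unfolding prim_def scaleR_diff_right
  by (intro Bochner_Integration.integral_diff integrable_indicator_times assms) auto

lemma prim_cmult: "prim (\<lambda>x. c * f x) x = c * prim f x"
  unfolding prim_def by (simp flip: mult_scaleR_right)

lemma prim_cnj: "prim (\<lambda>x. cnj (f x)) x = cnj (prim f x)"
  unfolding prim_def by (simp flip: complex_cnj_scaleR integral_cnj)

lemma norm_prim_le:
  assumes "integrable lborel g"
  shows "norm (prim g x) \<le> (LINT y|lborel. norm (g y))"
proof -
  have "norm (prim g x) \<le> (LINT y|lborel. norm (indicator {..x} y *\<^sub>R g y))"
    unfolding prim_def by (rule integral_norm_bound)
  also have "\<dots> \<le> (LINT y|lborel. norm (g y))"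
    using assms by (intro integral_mono integrable_norm integrable_indicator_times) (auto simp: indicator_def)
  finally show ?thesis .
qed

lemma prim_increment:
  assumes g: "integrable lborel g" and "x \<le> y"
  shows "prim g y - prim g x = (LINT s|lborel. indicator {x<..y} s *\<^sub>R g s)"
proof -
  have "prim g y - prim g x = (LINT s|lborel. indicator {..y} s *\<^sub>R g s - indicator {..x} s *\<^sub>R g s)"
    unfolding prim_def
    by (intro Bochner_Integration.integral_diff[symmetric] integrable_indicator_times g) auto
  also have "\<dots> = (LINT s|lborel. indicator {x<..y} s *\<^sub>R g s)"
    using \<open>x \<le> y\<close> by (intro Bochner_Integration.integral_cong) (auto simp: indicator_def)
  finally show ?thesis .
qed

lemma continuous_prim:
  assumes g: "integrable lborel g"
  shows "continuous_on A (prim g)"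
proof -
  have "isCont (prim g) x" for x
    unfolding continuous_at_sequentially
  proof safe
    fix X :: "nat \<Rightarrow> real" assume X: "X \<longlonglongrightarrow> x"
    have "(\<lambda>n. LINT y|lborel. indicator {..X n} y *\<^sub>R g y) \<longlonglongrightarrow> (LINT y|lborel. indicator {..x} y *\<^sub>R g y)"
    proof (rule integral_dominated_convergence[where w="\<lambda>y. norm (g y)"])
      show "AE y in lborel. (\<lambda>n. indicator {..X n} y *\<^sub>R g y) \<longlonglongrightarrow> indicator {..x} y *\<^sub>R g y"
        using AE_lborel_singleton[of x]
      proof eventually_elim
        case (elim y)
        have "eventually (\<lambda>n. indicator {..X n} y *\<^sub>R g y = indicator {..x} y *\<^sub>R g y) sequentially"
        proof (cases "y < x")
          case True
          then have "eventually (\<lambda>n. y < X n) sequentially" using X by (intro order_tendstoD) auto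
          then show ?thesis by eventually_elim (use True in auto)
        next
          case False
          then have "eventually (\<lambda>n. X n < y) sequentially" using X elim by (intro order_tendstoD) auto
          then show ?thesis by eventually_elim (use False elim in auto)
        qed
        then show ?case by (rule tendsto_eventually)
      qed
    qed (use g in \<open>auto simp: indicator_def\<close>)
    then show "((prim g) \<circ> X) \<longlonglongrightarrow> prim g x" by (simp add: prim_def o_def)
  qed
  then show ?thesis by (simp add: continuous_at_imp_continuous_on)
qed

lemma prim_at_minus_infinity:
  assumes g: "integrable lborel g"
  shows "(\<lambda>n. prim g (- real n)) \<longlonglongrightarrow> 0"
proof -
  have "(\<lambda>n. LINT y|lborel. indicator {..- real n} y *\<^sub>R g y) \<longlonglongrightarrow> (LINT y|(lborel::real measure). 0)"
  proof (rule integral_dominated_convergence[where w="\<lambda>y. norm (g y)"])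
    have "(\<lambda>n. indicator {..- real n} y *\<^sub>R g y) \<longlonglongrightarrow> 0" for y
    proof (rule tendsto_eventually)
      obtain N :: nat where "- y < real N" using reals_Archimedean2 by blast
      then have "\<forall>n\<ge>N. - real n < y" by (auto intro: less_le_trans)
      then show "eventually (\<lambda>n. indicator {..- real n} y *\<^sub>R g y = 0) sequentially"
        unfolding eventually_sequentially by (intro exI[of _ N]) auto
    qed
    then show "AE y in lborel. (\<lambda>n. indicator {..- real n} y *\<^sub>R g y) \<longlonglongrightarrow> 0" by simp
  qed (use g in \<open>auto simp: indicator_def\<close>)
  then show ?thesis by (simp add: prim_def)
qed

lemma integrable_lborel_product:
  fixes f g :: "real \<Rightarrow> complex"
  assumes f: "integrable lborel f" and g: "integrable lborel g"
  shows "integrable (lborel \<Otimes>\<^sub>M lborel) (\<lambda>(x, y). f x * g y)"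
proof -
  have [measurable]: "f \<in> borel_measurable borel" "g \<in> borel_measurable borel" using f g by auto
  show ?thesis
    by (rule lborel_pair.Fubini_integrable)
       (use f g in \<open>auto simp: norm_mult intro!: Bochner_Integration.integrable_mult_left\<close>)
qed

lemma integrable_mult_prim:
  assumes f: "integrable lborel f" and g: "integrable lborel g"
  shows "integrable lborel (\<lambda>y. f y * prim g y)" "integrable lborel (\<lambda>y. prim g y * f y)"
proof -
  have [measurable]: "prim g \<in> borel_measurable borel"
    by (intro borel_measurable_continuous_onI continuous_prim g)
  have "integrable lborel (\<lambda>y. (LINT z|lborel. norm (g z)) * norm (f y))" using f by simp
  then show 1: "integrable lborel (\<lambda>y. f y * prim g y)"
    by (rule Bochner_Integration.integrable_bound)
       (use f in \<open>auto simp: norm_mult mult.commute intro!: mult_left_mono norm_prim_le[OF g]\<close>)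
  show "integrable lborel (\<lambda>y. prim g y * f y)" using 1 by (simp add: mult.commute)
qed

text \<open>The product rule for absolutely continuous functions. The product of the two
  integrals is an integral over a quadrant, which Fubini's theorem splits along the diagonal.\<close>

lemma prim_mult:
  assumes f: "integrable lborel f" and g: "integrable lborel g"
  shows "prim f x * prim g x = prim (\<lambda>y. f y * prim g y + prim f y * g y) x"
proof -
  have [measurable]: "f \<in> borel_measurable borel" "g \<in> borel_measurable borel" using f g by auto
  define F where "F = (\<lambda>y. indicator {..x} y *\<^sub>R f y)"
  define G where "G = (\<lambda>y. indicator {..x} y *\<^sub>R g y)"
  have F: "integrable lborel F" and G: "integrable lborel G"
    unfolding F_def G_def by (intro integrable_indicator_times f g; simp)+
  have [measurable]: "F \<in> borel_measurable borel" "G \<in> borel_measurable borel" using F G by auto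
  note FG = integrable_lborel_product[OF F G]
  define A where "A = {p::real \<times> real. snd p \<le> fst p}"
  have "{p \<in> space (lborel \<Otimes>\<^sub>M (lborel :: real measure)). snd p \<le> (fst p :: real)} \<in> sets (lborel \<Otimes>\<^sub>M lborel)"
    by measurable
  then have Am[measurable]: "A \<in> sets (lborel \<Otimes>\<^sub>M lborel)" by (simp add: A_def space_pair_measure)
  have i1: "integrable (lborel \<Otimes>\<^sub>M lborel) (\<lambda>(y, z). indicator A (y, z) *\<^sub>R (F y * G z))"
    using integrable_mult_indicator[OF Am FG] by (simp add: case_prod_unfold)
  have Am'[measurable]: "-A \<in> sets (lborel \<Otimes>\<^sub>M lborel)"
    using sets.compl_sets[OF Am] by (simp add: space_pair_measure Compl_eq_Diff_UNIV)
  have i2: "integrable (lborel \<Otimes>\<^sub>M lborel) (\<lambda>(y, z). indicator (-A) (y, z) *\<^sub>R (F y * G z))"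
    using integrable_mult_indicator[OF Am' FG] by (simp add: case_prod_unfold)
  have "prim f x * prim g x = (LINT y|lborel. LINT z|lborel. F y * G z)"
  proof -
    have "prim f x = integral\<^sup>L lborel F" "prim g x = integral\<^sup>L lborel G"
      by (simp_all add: prim_def F_def G_def)
    then show ?thesis by simp
  qed
  also have "\<dots> = integral\<^sup>L (lborel \<Otimes>\<^sub>M lborel) (\<lambda>(y, z). F y * G z)"
    by (rule lborel_pair.integral_fst[OF FG])
  also have "\<dots> = integral\<^sup>L (lborel \<Otimes>\<^sub>M lborel) (\<lambda>(y, z). indicator A (y, z) *\<^sub>R (F y * G z) + indicator (-A) (y, z) *\<^sub>R (F y * G z))"
    by (intro Bochner_Integration.integral_cong) (auto simp: indicator_def)
  also have "\<dots> = integral\<^sup>L (lborel \<Otimes>\<^sub>M lborel) (\<lambda>(y, z). indicator A (y, z) *\<^sub>R (F y * G z)) +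
                  integral\<^sup>L (lborel \<Otimes>\<^sub>M lborel) (\<lambda>(y, z). indicator (-A) (y, z) *\<^sub>R (F y * G z))"
    using Bochner_Integration.integral_add[OF i1 i2] by (simp add: case_prod_unfold)
  also have "integral\<^sup>L (lborel \<Otimes>\<^sub>M lborel) (\<lambda>(y, z). indicator A (y, z) *\<^sub>R (F y * G z)) =
             (LINT y|lborel. LINT z|lborel. indicator A (y, z) *\<^sub>R (F y * G z))"
    using lborel_pair.integral_fst[OF i1] by simp
  also have "\<dots> = (LINT y|lborel. indicator {..x} y *\<^sub>R (f y * prim g y))"
  proof (intro Bochner_Integration.integral_cong refl)
    fix y
    have "(LINT z|lborel. indicator A (y, z) *\<^sub>R (F y * G z)) = (LINT z|lborel. F y * (indicator {..y} z *\<^sub>R g z))"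
      by (intro Bochner_Integration.integral_cong) (auto simp: A_def F_def G_def indicator_def)
    also have "\<dots> = F y * prim g y" by (simp only: prim_def integral_mult_right_zero)
    finally show "(LINT z|lborel. indicator A (y, z) *\<^sub>R (F y * G z)) = indicator {..x} y *\<^sub>R (f y * prim g y)"
      by (simp add: F_def)
  qed
  also have "integral\<^sup>L (lborel \<Otimes>\<^sub>M lborel) (\<lambda>(y, z). indicator (-A) (y, z) *\<^sub>R (F y * G z)) =
             (LINT z|lborel. LINT y|lborel. indicator (-A) (y, z) *\<^sub>R (F y * G z))"
    using lborel_pair.integral_snd[OF i2] by simp
  also have "\<dots> = (LINT z|lborel. indicator {..x} z *\<^sub>R (prim f z * g z))"
  proof (intro Bochner_Integration.integral_cong refl)
    fix z
    have "(LINT y|lborel. indicator (-A) (y, z) *\<^sub>R (F y * G z)) = (LINT y|lborel. (indicator {..z} y *\<^sub>R f y) * G z)"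
      by (rule integral_cong_AE; measurable?)
         (use AE_lborel_singleton[of z] in \<open>auto simp: A_def F_def G_def indicator_def elim!: eventually_mono\<close>)
    also have "\<dots> = prim f z * G z" by (simp only: prim_def integral_mult_left_zero)
    finally show "(LINT y|lborel. indicator (-A) (y, z) *\<^sub>R (F y * G z)) = indicator {..x} z *\<^sub>R (prim f z * g z)"
      by (simp add: G_def)
  qed
  also have "(LINT y|lborel. indicator {..x} y *\<^sub>R (f y * prim g y)) + (LINT z|lborel. indicator {..x} z *\<^sub>R (prim f z * g z))
     = prim (\<lambda>y. f y * prim g y + prim f y * g y) x"
    unfolding prim_def[of "\<lambda>y. f y * prim g y + prim f y * g y"] scaleR_add_right
    by (intro Bochner_Integration.integral_add[symmetric] integrable_indicator_times integrable_mult_prim f g) auto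
  finally show ?thesis .
qed

lemma prim_eq_integral:
  assumes "integrable lborel g" "x \<le> y"
  shows "prim g y = prim g x + integral {x..y} g"
proof -
  have s: "set_integrable lborel {x..y} g"
    unfolding set_integrable_def by (intro integrable_indicator_times assms) auto
  have "prim g y - prim g x = (LINT s|lborel. indicator {x..y} s *\<^sub>R g s)"
    unfolding prim_increment[OF assms]
    by (rule integral_cong_AE) (use assms(1) AE_lborel_singleton[of x] in \<open>auto simp: indicator_def elim!: eventually_mono\<close>)
  also have "\<dots> = integral {x..y} g"
    using set_borel_integral_eq_integral(2)[OF s] by (simp add: set_lebesgue_integral_def)
  finally show ?thesis by (simp add: algebra_simps)
qed

lemma prim_has_vector_derivative:
  assumes g: "integrable lborel g" and c: "continuous_on UNIV g"
  shows "(prim g has_vector_derivative g x) (at x)"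
proof -
  have "((\<lambda>u. integral {x - 1..u} g) has_vector_derivative g x) (at x within {x - 1..x + 1})"
    by (rule integral_has_vector_derivative[OF continuous_on_subset[OF c]]) auto
  then have "((\<lambda>u. prim g (x - 1) + integral {x - 1..u} g) has_vector_derivative 0 + g x) (at x within {x - 1..x + 1})"
    by (intro has_vector_derivative_add has_vector_derivative_const)
  then have "(prim g has_vector_derivative 0 + g x) (at x within {x - 1..x + 1})"
    by (rule has_vector_derivative_transform[rotated 2]) (auto simp: prim_eq_integral[OF g])
  moreover have "at x within {x - 1..x + 1} = at x"
    by (rule at_within_interior) auto
  ultimately show ?thesis by simp
qed

section \<open>Test functions and weak derivatives\<close>

lemma test_functionE:
  assumes "test_function \<zeta>"
  obtains D R where "\<And>x. (\<zeta> has_real_derivative D x) (at x)" "continuous_on UNIV D" "deriv \<zeta> = D"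
    "R > 0" "\<And>x. \<bar>x\<bar> > R \<Longrightarrow> \<zeta> x = 0" "\<And>x. \<bar>x\<bar> > R \<Longrightarrow> D x = 0"
proof -
  obtain D where D: "\<And>x. (\<zeta> has_real_derivative D x) (at x)" "continuous_on UNIV D"
    using assms unfolding test_function_def C1_differentiable_on_def has_real_derivative_iff_has_vector_derivative
    by auto
  obtain R0 where R0: "\<And>x. \<bar>x\<bar> > R0 \<Longrightarrow> \<zeta> x = 0" using assms unfolding test_function_def by auto
  define R where "R = max R0 1"
  have R: "R > 0" "\<And>x. \<bar>x\<bar> > R \<Longrightarrow> \<zeta> x = 0" using R0 by (auto simp: R_def)
  have D0: "D x = 0" if "\<bar>x\<bar> > R" for x
  proof -
    have "open {y::real. \<bar>y\<bar> > R}" by (intro open_Collect_less continuous_intros)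
    then have "((\<lambda>_. 0) has_real_derivative D x) (at x)"
      using that R(2) by (intro has_field_derivative_transform_within_open[OF D(1), of "{y. \<bar>y\<bar> > R}"]) auto
    then show ?thesis using DERIV_unique[OF _ DERIV_const] by blast
  qed
  have "deriv \<zeta> = D" using D(1) by (auto simp: fun_eq_iff intro: DERIV_imp_deriv)
  with D R D0 show ?thesis using that by blast
qed

lemma test_functionI:
  assumes "\<And>x. (\<zeta> has_real_derivative D x) (at x)" "continuous_on UNIV D" "\<And>x. \<bar>x\<bar> > R \<Longrightarrow> \<zeta> x = 0"
  shows "test_function \<zeta>"
  unfolding test_function_def C1_differentiable_on_def
  using assms by (auto simp: has_real_derivative_iff_has_vector_derivative)

lemma locally_integrable_mult_compact_support:
  fixes g :: "real \<Rightarrow> complex" and \<zeta> :: "real \<Rightarrow> real"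
  assumes g: "g \<in> borel_measurable borel" "\<And>a b. set_integrable lborel {a..b} g"
    and c: "continuous_on UNIV \<zeta>" and s: "\<And>x. \<bar>x\<bar> > R \<Longrightarrow> \<zeta> x = 0"
  shows "integrable lborel (\<lambda>x. \<zeta> x *\<^sub>R g x)"
proof -
  have "compact (\<zeta> ` {-R..R})" by (intro compact_continuous_image continuous_on_subset[OF c]) auto
  then obtain B where B: "\<And>x. x \<in> {-R..R} \<Longrightarrow> \<bar>\<zeta> x\<bar> \<le> B"
    by (force dest!: compact_imp_bounded simp: bounded_iff)
  have i: "integrable lborel (\<lambda>x. B *\<^sub>R norm (indicator {-R..R} x *\<^sub>R g x))"
    using g(2)[of "-R" R] unfolding set_integrable_def by (intro integrable_scaleR_right integrable_norm) auto
  have [measurable]: "\<zeta> \<in> borel_measurable borel" by (intro borel_measurable_continuous_onI c)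
  have p: "norm (\<zeta> x *\<^sub>R g x) \<le> norm (B *\<^sub>R norm (indicator {-R..R} x *\<^sub>R g x))" for x
  proof (cases "\<bar>x\<bar> > R")
    case True
    then show ?thesis using s by simp
  next
    case False
    then have "x \<in> {-R..R}" by auto
    then have "\<bar>\<zeta> x\<bar> \<le> \<bar>B\<bar>" "x \<in> {-R..R}" using B[of x] by auto
    then show ?thesis by (simp add: abs_mult mult_right_mono)
  qed
  show ?thesis
    by (rule Bochner_Integration.integrable_bound[OF i]) (use g(1) p in auto)
qed

lemma integrable_imp_set_integrable:
  fixes g :: "real \<Rightarrow> complex"
  assumes "integrable lborel g" shows "set_integrable lborel {a..b::real} g"
  unfolding set_integrable_def using integrable_indicator_times[OF assms] by simp

lemma continuous_imp_set_integrable: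
  fixes g :: "real \<Rightarrow> 'a::euclidean_space"
  assumes "continuous_on UNIV g" shows "set_integrable lborel {a..b::real} g"
  unfolding set_integrable_def using borel_integrable_compact[of "{a..b}" g] continuous_on_subset[OF assms]
  by (auto simp: )

lemma test_function_eq_prim:
  assumes D: "\<And>x. (\<zeta> has_real_derivative D x) (at x)" "continuous_on UNIV D"
    and R: "\<And>x. \<bar>x\<bar> > R \<Longrightarrow> \<zeta> x = 0" "\<And>x. \<bar>x\<bar> > R \<Longrightarrow> D x = 0"
  shows "integrable lborel (\<lambda>x. complex_of_real (D x))" "prim (\<lambda>x. of_real (D x)) x = of_real (\<zeta> x)"
proof -
  show i: "integrable lborel (\<lambda>x. complex_of_real (D x))"
    using locally_integrable_mult_compact_support[of "\<lambda>_. 1" D R] D(2) R(2)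
      continuous_imp_set_integrable[of "\<lambda>_. 1::complex"]
    by (simp add: scaleR_conv_of_real)
  define a where "a = min x (-\<bar>R\<bar> - 1)"
  have a: "a \<le> x" "\<And>y. y \<le> a \<Longrightarrow> \<bar>y\<bar> > R" by (auto simp: a_def)
  have "prim (\<lambda>x. of_real (D x)) a = (LINT y|(lborel::real measure). (0::complex))"
    unfolding prim_def by (intro Bochner_Integration.integral_cong) (use a R(2) in \<open>auto simp: indicator_def\<close>)
  moreover have "((\<lambda>x. complex_of_real (D x)) has_integral (of_real (\<zeta> x) - of_real (\<zeta> a))) {a..x}"
    using a D(1) by (intro fundamental_theorem_of_calculus has_vector_derivative_of_real)
      (auto intro: has_field_derivative_at_within)
  moreover have "\<zeta> a = 0" using a R(1)[of a] by auto
  ultimately show "prim (\<lambda>x. of_real (D x)) x = of_real (\<zeta> x)"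
    using prim_eq_integral[OF i a(1)] by (simp add: integral_unique)
qed

lemma locally_integrable_borel:
  assumes "g \<in> borel_measurable borel"
  shows "locally_integrable g \<longleftrightarrow> (\<forall>a b. set_integrable lborel {a..b} g)"
  unfolding locally_integrable_def set_integrable_def using assms by (simp add: integrable_completion)

lemma has_weak_deriv_borel:
  assumes [measurable]: "f \<in> borel_measurable borel" "g \<in> borel_measurable borel"
  shows "has_weak_deriv f g \<longleftrightarrow> (\<forall>a b. set_integrable lborel {a..b} f) \<and> (\<forall>a b. set_integrable lborel {a..b} g) \<and>
     (\<forall>\<phi>. test_function \<phi> \<longrightarrow>
       (LINT x|lborel. deriv \<phi> x *\<^sub>R f x) = - (LINT x|lborel. \<phi> x *\<^sub>R g x))"
proof -
  have "(LINT x|lebesgue. deriv \<phi> x *\<^sub>R f x) = (LINT x|lborel. deriv \<phi> x *\<^sub>R f x)"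
    "(LINT x|lebesgue. \<phi> x *\<^sub>R g x) = (LINT x|lborel. \<phi> x *\<^sub>R g x)" if t: "test_function \<phi>" for \<phi>
  proof -
    obtain D R where D: "\<And>x. (\<phi> has_real_derivative D x) (at x)" "continuous_on UNIV D" "deriv \<phi> = D"
      using test_functionE[OF t] by metis
    have [measurable]: "D \<in> borel_measurable borel" by (intro borel_measurable_continuous_onI D)
    have [measurable]: "\<phi> \<in> borel_measurable borel"
      using D(1) by (intro borel_measurable_continuous_onI) (meson DERIV_continuous_on has_field_derivative_at_within)
    show "(LINT x|lebesgue. deriv \<phi> x *\<^sub>R f x) = (LINT x|lborel. deriv \<phi> x *\<^sub>R f x)"
      "(LINT x|lebesgue. \<phi> x *\<^sub>R g x) = (LINT x|lborel. \<phi> x *\<^sub>R g x)"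
      by (simp_all add: integral_completion D(3))
  qed
  then show ?thesis unfolding has_weak_deriv_def by (auto simp: locally_integrable_borel)
qed

text \<open>Integration by parts: the product of a test function with \<open>prim g\<close> vanishes far to the
  right, where \<open>prim_mult\<close> expresses it as the sum of the two integrals.\<close>

lemma has_weak_deriv_prim:
  assumes g: "integrable lborel g"
  shows "has_weak_deriv (prim g) g"
proof -
  have [measurable]: "g \<in> borel_measurable borel" "prim g \<in> borel_measurable borel"
    using g by (auto intro!: borel_measurable_continuous_onI continuous_prim)
  have "(LINT x|lborel. deriv \<phi> x *\<^sub>R prim g x) = - (LINT x|lborel. \<phi> x *\<^sub>R g x)" if t: "test_function \<phi>" for \<phi>
  proof -
    obtain D R where D: "\<And>x. (\<phi> has_real_derivative D x) (at x)" "continuous_on UNIV D" "deriv \<phi> = D"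
      and R: "R > 0" "\<And>x. \<bar>x\<bar> > R \<Longrightarrow> \<phi> x = 0" "\<And>x. \<bar>x\<bar> > R \<Longrightarrow> D x = 0"
      using test_functionE[OF t] by metis
    note p = test_function_eq_prim[OF D(1,2) R(2,3), simplified]
    define x where "x = R + 1"
    have "0 = prim (\<lambda>x. of_real (D x)) x * prim g x" using p(2)[of x] R by (simp add: x_def)
    also have "\<dots> = prim (\<lambda>y. of_real (D y) * prim g y + prim (\<lambda>x. of_real (D x)) y * g y) x"
      by (rule prim_mult[OF p(1) g])
    also have "\<dots> = (LINT y|lborel. of_real (D y) * prim g y + prim (\<lambda>x. of_real (D x)) y * g y)"
      unfolding prim_def[of "\<lambda>y. of_real (D y) * prim g y + prim (\<lambda>x. of_real (D x)) y * g y"]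
      by (intro Bochner_Integration.integral_cong) (use R p(2) in \<open>auto simp: x_def indicator_def\<close>)
    also have "\<dots> = (LINT y|lborel. of_real (D y) * prim g y) + (LINT y|lborel. prim (\<lambda>x. of_real (D x)) y * g y)"
      by (intro Bochner_Integration.integral_add integrable_mult_prim g p(1))
    finally show ?thesis
      by (simp add: D(3) p(2) scaleR_conv_of_real eq_neg_iff_add_eq_0)
  qed
  then show ?thesis
    by (simp add: has_weak_deriv_borel continuous_imp_set_integrable continuous_prim g integrable_imp_set_integrable)
qed

lemma has_real_derivative_max0_sq:
  "((\<lambda>y::real. (max 0 y)\<^sup>2) has_real_derivative 2 * max 0 y) (at y)"
proof (cases y "0::real" rule: linorder_cases)
  case less
  have "((\<lambda>y::real. 0) has_real_derivative 2 * max 0 y) (at y)" using less by simp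
  then show ?thesis by (rule has_field_derivative_transform_within_open[of _ _ _ "{..<0}"]) (use less in auto)
next
  case greater
  have "((\<lambda>y::real. y\<^sup>2) has_real_derivative 2 * max 0 y) (at y)" using greater by (auto intro!: derivative_eq_intros)
  then show ?thesis by (rule has_field_derivative_transform_within_open[of _ _ _ "{0<..}"]) (use greater in auto)
next
  case equal
  have "((\<lambda>h::real. max 0 h) \<longlongrightarrow> max 0 0) (at 0)" by (intro tendsto_intros)
  then have "((\<lambda>h::real. max 0 h) \<longlongrightarrow> 0) (at 0)" by simp
  moreover have "eventually (\<lambda>h::real. max 0 h = ((max 0 (0 + h))\<^sup>2 - (max 0 0)\<^sup>2) / h) (at 0)"
    by (auto simp: eventually_at_filter power2_eq_square max_def)
  ultimately have "((\<lambda>h::real. ((max 0 (0 + h))\<^sup>2 - (max 0 0)\<^sup>2) / h) \<longlongrightarrow> 0) (at 0)"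
    using tendsto_cong by fastforce
  then show ?thesis using equal by (simp add: DERIV_def)
qed

text \<open>The functions are \<open>n g / (n g + 1)\<close> with \<open>g\<close> the square of the positive part of
  \<open>(x - a) (b - x)\<close>. They are continuously differentiable because \<open>g\<close> is, and tend to one exactly where
  \<open>g\<close> is positive.\<close>

lemma test_function_interval_approx:
  fixes a b :: real
  obtains \<zeta> :: "nat \<Rightarrow> real \<Rightarrow> real" where "\<And>n. test_function (\<zeta> n)"
    "\<And>x. (\<lambda>n. \<zeta> n x) \<longlonglongrightarrow> indicator {a<..<b} x" "\<And>n x. \<bar>\<zeta> n x\<bar> \<le> indicator {a..b} x"
proof -
  define q where "q = (\<lambda>x. (x - a) * (b - x))"
  define g where "g = (\<lambda>x. if a \<le> b then (max 0 (q x))\<^sup>2 else 0)"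
  define \<zeta> where "\<zeta> = (\<lambda>(n::nat) x. 1 - 1 / (n * g x + 1))"
  have g0: "g x \<ge> 0" for x by (simp add: g_def)
  have pos: "n * g x + 1 > 0" for n :: nat and x using g0[of x] by (auto intro: add_nonneg_pos)
  have out: "g x = 0" if "x \<notin> {a<..<b}" for x
    using that by (auto simp: g_def q_def max_def power2_eq_square mult_le_0_iff zero_le_mult_iff not_less)
  have inn: "g x > 0" if "x \<in> {a<..<b}" for x using that by (auto simp: g_def q_def)
  define g' where "g' = (\<lambda>x. if a \<le> b then 2 * max 0 (q x) * (b - x - (x - a)) else 0)"
  have q': "(q has_real_derivative (b - x - (x - a))) (at x)" for x
    unfolding q_def by (auto intro!: derivative_eq_intros)
  have g': "(g has_real_derivative g' x) (at x)" for x
    unfolding g_def g'_def using DERIV_chain2[OF has_real_derivative_max0_sq q'] by simp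
  have qc: "continuous_on UNIV q" unfolding q_def by (intro continuous_intros)
  have gc: "continuous_on UNIV g" "continuous_on UNIV g'"
    unfolding g_def g'_def by (cases "a \<le> b"; simp; intro continuous_intros qc)+
  have "test_function (\<zeta> n)" for n
  proof (rule test_functionI[where R="max \<bar>a\<bar> \<bar>b\<bar>"])
    show "(\<zeta> n has_real_derivative (n * g' x / (n * g x + 1)\<^sup>2)) (at x)" for x
      unfolding \<zeta>_def using pos[of n x]
      by (auto intro!: derivative_eq_intros g' simp: power2_eq_square)
    show "continuous_on UNIV (\<lambda>x. n * g' x / (n * g x + 1)\<^sup>2)"
      using pos[of n] by (intro continuous_intros gc) (metis less_irrefl power_not_zero)
    show "\<zeta> n x = 0" if "\<bar>x\<bar> > max \<bar>a\<bar> \<bar>b\<bar>" for x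
    proof -
      have "x \<notin> {a<..<b}" using that by auto
      then show ?thesis by (simp add: \<zeta>_def out)
    qed
  qed
  moreover have "(\<lambda>n. \<zeta> n x) \<longlonglongrightarrow> indicator {a<..<b} x" for x
  proof (cases "x \<in> {a<..<b}")
    case True
    have "filterlim (\<lambda>n::nat. n * g x + 1) at_top sequentially"
    proof (rule filterlim_at_top_mono[OF filterlim_tendsto_pos_mult_at_top[OF tendsto_const inn[OF True] filterlim_real_sequentially]])
    qed (auto simp: mult.commute)
    then have "(\<lambda>n::nat. 1 - 1 / (n * g x + 1)) \<longlonglongrightarrow> 1 - 0"
      by (intro tendsto_intros tendsto_divide_0[OF tendsto_const] filterlim_at_top_imp_at_infinity)
    then show ?thesis using True by (simp add: \<zeta>_def)
  next
    case False
    then show ?thesis by (simp add: \<zeta>_def out)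
  qed
  moreover have "\<bar>\<zeta> n x\<bar> \<le> indicator {a..b} x" for n x
  proof (cases "x \<in> {a<..<b}")
    case True
    have "n * g x \<ge> 0" using g0[of x] by simp
    then have "0 \<le> 1 / (n * g x + 1)" "1 / (n * g x + 1) \<le> 1" by (auto simp: divide_simps)
    then show ?thesis using True by (auto simp: \<zeta>_def indicator_def)
  next
    case False
    then show ?thesis by (simp add: \<zeta>_def out)
  qed
  ultimately show ?thesis using that by blast
qed

text \<open>The sets over which \<open>r\<close> has integral zero form a Dynkin system that contains the open
  intervals, hence all Borel sets.\<close>

lemma integral_intervals_0_imp_AE_0:
  fixes r :: "real \<Rightarrow> complex"
  assumes r: "integrable lborel r" and z: "\<And>a b. (LINT x|lborel. indicator {a<..<b} x *\<^sub>R r x) = 0"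
  shows "AE x in lborel. r x = 0"
proof (rule sigma_finite_measure.density_zero[OF lborel.sigma_finite_measure_axioms r])
  have gen: "sets borel = sigma_sets UNIV (range (\<lambda>(a, b). {a<..<b::real}))"
  proof -
    have e: "(borel :: real measure) = sigma UNIV (range (\<lambda>(a, b). {a<..<b}))"
      using borel_eq_box[where 'a=real] by (simp add: box_real)
    show ?thesis by (subst e) simp
  qed
  fix A :: "real set" assume "A \<in> sets lborel"
  then have A: "A \<in> sigma_sets UNIV (range (\<lambda>(a, b). {a<..<b::real}))"
    by (simp add: gen)
  have st: "Int_stable (range (\<lambda>(a, b). {a<..<b::real}))"
  proof (rule Int_stableI)
    fix A B :: "real set" assume "A \<in> range (\<lambda>(a, b). {a<..<b})" "B \<in> range (\<lambda>(a, b). {a<..<b})"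
    then obtain a b c d where "A = {a<..<b}" "B = {c<..<d}" by auto
    then have "A \<inter> B = {max a c<..<min b d}" by auto
    then show "A \<inter> B \<in> range (\<lambda>(a, b). {a<..<b})" by auto
  qed
  have sb: "X \<in> sets borel" if "X \<in> sigma_sets UNIV (range (\<lambda>(a, b). {a<..<b::real}))" for X
    using that by (simp add: gen)
  have tot: "integral\<^sup>L lborel r = 0"
  proof -
    have "(\<lambda>n. LINT x|lborel. indicator {- real n<..<real n} x *\<^sub>R r x) \<longlonglongrightarrow> integral\<^sup>L lborel r"
    proof (rule integral_dominated_convergence[where w="\<lambda>y. norm (r y)"])
      have "(\<lambda>n. indicator {- real n<..<real n} x *\<^sub>R r x) \<longlonglongrightarrow> r x" for x
      proof (rule tendsto_eventually)
        obtain N :: nat where "\<bar>x\<bar> < real N" using reals_Archimedean2 by blast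
        then have "\<forall>n\<ge>N. x \<in> {- real n<..<real n}" by (auto simp: abs_less_iff)
        then show "eventually (\<lambda>n. indicator {- real n<..<real n} x *\<^sub>R r x = r x) sequentially"
          unfolding eventually_sequentially by (intro exI[of _ N]) auto
      qed
      then show "AE x in lborel. (\<lambda>n. indicator {- real n<..<real n} x *\<^sub>R r x) \<longlonglongrightarrow> r x" by simp
    qed (use r in \<open>auto simp: indicator_def\<close>)
    then show ?thesis using z by (simp add: LIMSEQ_const_iff)
  qed
  show "set_lebesgue_integral lborel A r = 0"
    using st subset_UNIV[THEN PowI, THEN subsetI] A
  proof (induction rule: sigma_sets_induct_disjoint)
    case (basic A)
    then show ?case using z by (auto simp: set_lebesgue_integral_def)
  next
    case empty
    then show ?case by (simp add: set_lebesgue_integral_def)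
  next
    case (compl A)
    have "set_lebesgue_integral lborel (UNIV - A) r = (LINT x|lborel. r x - indicator A x *\<^sub>R r x)"
      unfolding set_lebesgue_integral_def by (intro Bochner_Integration.integral_cong) (auto simp: indicator_def)
    also have "\<dots> = integral\<^sup>L lborel r - set_lebesgue_integral lborel A r"
      unfolding set_lebesgue_integral_def
      by (intro Bochner_Integration.integral_diff r integrable_indicator_times sb compl)
    finally show ?case using compl tot by simp
  next
    case (union A)
    then have "set_lebesgue_integral lborel (\<Union>i. A i) r = (\<Sum>i. set_lebesgue_integral lborel (A i) r)"
      by (intro lebesgue_integral_countable_add)
         (auto simp: disjoint_family_on_def set_integrable_def intro!: integrable_indicator_times r sb sets.countable_UN sigma_sets.Union)
    then show ?case using union by simp
  qed
qed

lemma fundamental_lemma_of_variations: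
  fixes r :: "real \<Rightarrow> complex"
  assumes [measurable]: "r \<in> borel_measurable borel" and loc: "\<And>a b. set_integrable lborel {a..b} r"
    and z: "\<And>\<zeta>. test_function \<zeta> \<Longrightarrow> (LINT x|lborel. \<zeta> x *\<^sub>R r x) = 0"
  shows "AE x in lborel. r x = 0"
proof -
  have I: "(LINT x|lborel. indicator {a<..<b} x *\<^sub>R r x) = 0" for a b
  proof -
    obtain \<zeta> where \<zeta>: "\<And>n. test_function (\<zeta> n)"
      "\<And>x. (\<lambda>n. \<zeta> n x) \<longlonglongrightarrow> indicator {a<..<b} x" "\<And>n x. \<bar>\<zeta> n x\<bar> \<le> indicator {a..b} x"
      using test_function_interval_approx[of a b] by metis
    have [measurable]: "\<zeta> n \<in> borel_measurable borel" for n
    proof -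
      obtain D where "\<And>x. (\<zeta> n has_real_derivative D x) (at x)" using test_functionE[OF \<zeta>(1)] by metis
      then show ?thesis
        by (intro borel_measurable_continuous_onI) (meson DERIV_continuous_on has_field_derivative_at_within)
    qed
    have "(\<lambda>n. LINT x|lborel. \<zeta> n x *\<^sub>R r x) \<longlonglongrightarrow> (LINT x|lborel. indicator {a<..<b} x *\<^sub>R r x)"
    proof (rule integral_dominated_convergence[where w="\<lambda>x. norm (indicator {a..b} x *\<^sub>R r x)"])
      show "integrable lborel (\<lambda>x. norm (indicator {a..b} x *\<^sub>R r x))"
        using loc[of a b] unfolding set_integrable_def by (rule integrable_norm)
      show "AE x in lborel. (\<lambda>n. \<zeta> n x *\<^sub>R r x) \<longlonglongrightarrow> indicator {a<..<b} x *\<^sub>R r x"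
        by (intro AE_I2 tendsto_intros \<zeta>)
      show "AE x in lborel. norm (\<zeta> n x *\<^sub>R r x) \<le> norm (indicator {a..b} x *\<^sub>R r x)" for n
        using \<zeta>(3)[of n] by (intro AE_I2) (auto intro!: mult_right_mono)
    qed auto
    then show ?thesis using z[OF \<zeta>(1)] by (simp add: LIMSEQ_const_iff)
  qed
  have "AE x in lborel. indicator {-real n<..<real n} x *\<^sub>R r x = 0" for n :: nat
  proof (rule integral_intervals_0_imp_AE_0)
    show "integrable lborel (\<lambda>x. indicator {-real n<..<real n} x *\<^sub>R r x)"
      using loc[of "-real n" "real n", unfolded set_integrable_def]
      by (rule Bochner_Integration.integrable_bound) (auto simp: indicator_def)
    fix a b
    have "(LINT x|lborel. indicator {a<..<b} x *\<^sub>R indicator {-real n<..<real n} x *\<^sub>R r x) =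
          (LINT x|lborel. indicator {max a (-real n)<..<min b (real n)} x *\<^sub>R r x)"
      by (intro Bochner_Integration.integral_cong) (auto simp: indicator_def)
    then show "(LINT x|lborel. indicator {a<..<b} x *\<^sub>R indicator {-real n<..<real n} x *\<^sub>R r x) = 0"
      using I by simp
  qed
  then have "AE x in lborel. \<forall>n::nat. indicator {-real n<..<real n} x *\<^sub>R r x = 0"
    unfolding AE_all_countable by blast
  then show ?thesis
  proof eventually_elim
    case (elim x)
    obtain N :: nat where "\<bar>x\<bar> < real N" using reals_Archimedean2 by blast
    then have "x \<in> {-real N<..<real N}" by auto
    then show ?case using elim[rule_format, of N] by simp
  qed
qed

lemma test_function_continuous:
  assumes "test_function \<zeta>" shows "continuous_on UNIV \<zeta>"
proof -
  obtain D where "\<And>x. (\<zeta> has_real_derivative D x) (at x)" using test_functionE[OF assms] by metis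
  then show ?thesis by (meson DERIV_continuous_on has_field_derivative_at_within)
qed

lemma test_function_mult_integrable:
  fixes g :: "real \<Rightarrow> complex"
  assumes t: "test_function \<zeta>" and g: "g \<in> borel_measurable borel" "\<And>a b. set_integrable lborel {a..b} g"
  shows "integrable lborel (\<lambda>x. \<zeta> x *\<^sub>R g x)" "integrable lborel (\<lambda>x. deriv \<zeta> x *\<^sub>R g x)"
proof -
  obtain D R where D: "continuous_on UNIV D" "deriv \<zeta> = D" "\<And>x. \<bar>x\<bar> > R \<Longrightarrow> \<zeta> x = 0" "\<And>x. \<bar>x\<bar> > R \<Longrightarrow> D x = 0"
    using test_functionE[OF t] by metis
  show "integrable lborel (\<lambda>x. \<zeta> x *\<^sub>R g x)" "integrable lborel (\<lambda>x. deriv \<zeta> x *\<^sub>R g x)"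
    unfolding D(2)
    using locally_integrable_mult_compact_support[OF g test_function_continuous[OF t] D(3)]
      locally_integrable_mult_compact_support[OF g D(1,4)] by blast+
qed

text \<open>Every test function of mean zero is the derivative of a test function. Subtracting
  from a given test function a multiple of a fixed one with nonzero mean shows that \<open>r\<close> minus a
  constant annihilates all test functions.\<close>

lemma weak_deriv_0_imp_constant:
  fixes r :: "real \<Rightarrow> complex"
  assumes [measurable]: "r \<in> borel_measurable borel" and loc: "\<And>a b. set_integrable lborel {a..b} r"
    and z: "\<And>\<phi>. test_function \<phi> \<Longrightarrow> (LINT x|lborel. deriv \<phi> x *\<^sub>R r x) = 0"
  obtains c where "AE x in lborel. r x = c"
proof -
  have one: "set_integrable lborel {a..b} (\<lambda>_. c)" for a b :: real and c :: complex
    by (intro continuous_imp_set_integrable) auto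
  (* otherwise the constant function 1 would vanish by the fundamental lemma *)
  have "\<exists>\<eta>. test_function \<eta> \<and> (LINT x|lborel. \<eta> x *\<^sub>R (1::complex)) \<noteq> 0"
  proof (rule ccontr)
    assume "\<nexists>\<eta>. test_function \<eta> \<and> (LINT x|lborel. \<eta> x *\<^sub>R (1::complex)) \<noteq> 0"
    then have "AE x in (lborel::real measure). (1::complex) = 0"
      by (intro fundamental_lemma_of_variations one) auto
    then show False by (simp add: AE_iff_measurable[OF _ refl])
  qed
  then obtain \<eta> where \<eta>: "test_function \<eta>" "(LINT x|lborel. \<eta> x *\<^sub>R (1::complex)) \<noteq> 0" by blast
  define I where "I = (\<lambda>\<zeta>::real \<Rightarrow> real. LINT x|lborel. \<zeta> x)"
  have I1: "(LINT x|lborel. \<zeta> x *\<^sub>R (c::complex)) = I \<zeta> *\<^sub>R c" if "test_function \<zeta>" for \<zeta> c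
  proof -
    have "integrable lborel \<zeta>"
      using integrable_Re[OF test_function_mult_integrable(1)[OF that _ one[of _ _ 1]]] by simp
    then show ?thesis by (simp add: I_def)
  qed
  have I\<eta>: "I \<eta> \<noteq> 0" using \<eta> I1[OF \<eta>(1), of 1] by auto
  define c where "c = (LINT x|lborel. \<eta> x *\<^sub>R r x) / of_real (I \<eta>)"
  have "AE x in lborel. r x - c = 0"
  proof (rule fundamental_lemma_of_variations)
    fix \<zeta> assume \<zeta>: "test_function \<zeta>"
    define \<xi> where "\<xi> = (\<lambda>x. \<zeta> x - (I \<zeta> / I \<eta>) * \<eta> x)"
    obtain R1 where R1: "\<And>x. \<bar>x\<bar> > R1 \<Longrightarrow> \<zeta> x = 0" using \<zeta> unfolding test_function_def by auto
    obtain R2 where R2: "\<And>x. \<bar>x\<bar> > R2 \<Longrightarrow> \<eta> x = 0" using \<eta> unfolding test_function_def by auto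
    define R where "R = max 0 (max R1 R2)"
    have R: "\<xi> x = 0" if "\<bar>x\<bar> > R" for x using that R1 R2 by (auto simp: R_def \<xi>_def)
    have \<xi>c: "continuous_on UNIV \<xi>" unfolding \<xi>_def
      by (intro continuous_intros test_function_continuous \<zeta> \<eta>)
    have i\<zeta>: "integrable lborel (\<lambda>x. \<zeta> x *\<^sub>R g x)" "integrable lborel (\<lambda>x. \<eta> x *\<^sub>R g x)"
      if "g \<in> borel_measurable borel" "\<And>a b. set_integrable lborel {a..b} g" for g :: "real \<Rightarrow> complex"
      using test_function_mult_integrable(1) \<zeta> \<eta> that by blast+
    have L: "(LINT x|lborel. \<xi> x *\<^sub>R g x) = (LINT x|lborel. \<zeta> x *\<^sub>R g x) - (I \<zeta> / I \<eta>) *\<^sub>R (LINT x|lborel. \<eta> x *\<^sub>R g x)"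
      if "g \<in> borel_measurable borel" "\<And>a b. set_integrable lborel {a..b} g" for g :: "real \<Rightarrow> complex"
    proof -
      have "(LINT x|lborel. \<xi> x *\<^sub>R g x) = (LINT x|lborel. \<zeta> x *\<^sub>R g x - (I \<zeta> / I \<eta>) *\<^sub>R (\<eta> x *\<^sub>R g x))"
        by (simp add: \<xi>_def scaleR_diff_left)
      also have "\<dots> = (LINT x|lborel. \<zeta> x *\<^sub>R g x) - (LINT x|lborel. (I \<zeta> / I \<eta>) *\<^sub>R (\<eta> x *\<^sub>R g x))"
        by (intro Bochner_Integration.integral_diff integrable_scaleR_right i\<zeta> that)
      also have "(LINT x|lborel. (I \<zeta> / I \<eta>) *\<^sub>R (\<eta> x *\<^sub>R g x)) = (I \<zeta> / I \<eta>) *\<^sub>R (LINT x|lborel. \<eta> x *\<^sub>R g x)"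
        by (rule integral_scaleR_right)
      finally show ?thesis .
    qed
    have i\<xi>: "integrable lborel (\<lambda>x. complex_of_real (\<xi> x))"
      using locally_integrable_mult_compact_support[OF _ one[of _ _ 1] \<xi>c R] by (simp add: scaleR_conv_of_real)
    have tot: "(LINT x|lborel. complex_of_real (\<xi> x)) = 0"
      using L[OF _ one[of _ _ 1]] I1[OF \<zeta>, of 1] I1[OF \<eta>(1), of 1] I\<eta> by (simp add: scaleR_conv_of_real)
    define \<phi> where "\<phi> = (\<lambda>x. Re (prim (\<lambda>x. of_real (\<xi> x)) x))"
    have d: "(\<phi> has_real_derivative \<xi> x) (at x)" for x
    proof -
      have "(prim (\<lambda>x. of_real (\<xi> x)) has_vector_derivative complex_of_real (\<xi> x)) (at x)"
        by (intro prim_has_vector_derivative i\<xi> continuous_intros \<xi>c)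
      from bounded_linear.has_vector_derivative[OF bounded_linear_Re this] show ?thesis
        by (simp add: \<phi>_def has_real_derivative_iff_has_vector_derivative)
    qed
    have "test_function \<phi>"
    proof (rule test_functionI[OF d \<xi>c, of R])
      fix x :: real assume x: "\<bar>x\<bar> > R"
      have "prim (\<lambda>x. of_real (\<xi> x)) x = 0"
      proof (cases "x > 0")
        case True
        have "prim (\<lambda>x. of_real (\<xi> x)) x = (LINT x|lborel. complex_of_real (\<xi> x))"
          unfolding prim_def by (intro Bochner_Integration.integral_cong) (use x True R in \<open>auto simp: indicator_def\<close>)
        then show ?thesis using tot by simp
      next
        case False
        have "prim (\<lambda>x. of_real (\<xi> x)) x = (LINT x|(lborel::real measure). 0)"
          unfolding prim_def by (intro Bochner_Integration.integral_cong) (use x False R in \<open>auto simp: indicator_def\<close>)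
        then show ?thesis by simp
      qed
      then show "\<phi> x = 0" by (simp add: \<phi>_def)
    qed
    moreover have "deriv \<phi> = \<xi>" using d by (auto simp: fun_eq_iff intro: DERIV_imp_deriv)
    ultimately have "(LINT x|lborel. \<xi> x *\<^sub>R r x) = 0" using z by metis
    then have "(LINT x|lborel. \<zeta> x *\<^sub>R r x) = I \<zeta> *\<^sub>R c"
      using L[OF assms(1) loc] I\<eta> by (simp add: c_def scaleR_conv_of_real divide_simps)
    moreover have "(LINT x|lborel. \<zeta> x *\<^sub>R (r x - c)) = (LINT x|lborel. \<zeta> x *\<^sub>R r x) - (LINT x|lborel. \<zeta> x *\<^sub>R c)"
      unfolding scaleR_diff_right by (intro Bochner_Integration.integral_diff i\<zeta> loc one) auto
    ultimately show "(LINT x|lborel. \<zeta> x *\<^sub>R (r x - c)) = 0"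
      using I1[OF \<zeta>, of c] by simp
  next
    show "set_integrable lborel {a..b} (\<lambda>x. r x - c)" for a b
      by (intro set_integral_diff loc one)
  qed auto
  then have "AE x in lborel. r x = c" by eventually_elim simp
  then show ?thesis using that by blast
qed

text \<open>The lemma of du Bois-Reymond. Integrability of \<open>f\<close> forces the constant to be zero,
  because \<open>prim g\<close> tends to zero at minus infinity.\<close>

lemma has_weak_deriv_imp_prim:
  fixes f g :: "real \<Rightarrow> complex"
  assumes w: "has_weak_deriv f g" and f: "integrable lborel f" and g: "integrable lborel g"
  shows "AE x in lborel. f x = prim g x"
proof -
  have [measurable]: "f \<in> borel_measurable borel" "g \<in> borel_measurable borel" using f g by auto
  have [measurable]: "prim g \<in> borel_measurable borel" by (intro borel_measurable_continuous_onI continuous_prim g)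
  have lf: "set_integrable lborel {a..b} f" and lp: "set_integrable lborel {a..b} (prim g)" for a b
    by (rule integrable_imp_set_integrable[OF f], rule continuous_imp_set_integrable[OF continuous_prim[OF g]])
  have z: "(LINT x|lborel. deriv \<phi> x *\<^sub>R (f x - prim g x)) = 0" if t: "test_function \<phi>" for \<phi>
  proof -
    have "(LINT x|lborel. deriv \<phi> x *\<^sub>R (f x - prim g x)) = (LINT x|lborel. deriv \<phi> x *\<^sub>R f x) - (LINT x|lborel. deriv \<phi> x *\<^sub>R prim g x)"
      unfolding scaleR_diff_right by (intro Bochner_Integration.integral_diff test_function_mult_integrable t lf lp) auto
    then show ?thesis
      using w has_weak_deriv_prim[OF g] t by (simp add: has_weak_deriv_borel)
  qed
  obtain c where c: "AE x in lborel. f x - prim g x = c"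
    by (rule weak_deriv_0_imp_constant[OF _ _ z]) (auto intro!: set_integral_diff lf lp)
  have "c = 0"
  proof (rule ccontr)
    assume c0: "c \<noteq> 0"
    define h where "h = (\<lambda>x. complex_of_real (norm (g x)))"
    have h: "integrable lborel h" unfolding h_def using g by auto
    have "eventually (\<lambda>n. norm (prim h (- real n)) < norm c / 2) sequentially"
      using prim_at_minus_infinity[OF h] c0 tendsto_norm_zero by (intro order_tendstoD) auto
    then obtain N where N: "norm (prim h (- real N)) < norm c / 2" by (auto simp: eventually_sequentially)
    have small: "norm (prim g x) \<le> norm c / 2" if "x \<le> - real N" for x
    proof -
      have "norm (prim g x) \<le> (LINT y|lborel. norm (indicator {..x} y *\<^sub>R g y))"
        unfolding prim_def by (rule integral_norm_bound)
      also have "\<dots> \<le> (LINT y|lborel. indicator {..-real N} y *\<^sub>R norm (g y))"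
        using that g by (intro integral_mono integrable_norm integrable_indicator_times) (auto simp: indicator_def)
      also have "\<dots> = Re (prim h (- real N))"
        unfolding prim_def h_def by (simp add: scaleR_conv_of_real flip: of_real_mult)
      also have "\<dots> \<le> norm (prim h (- real N))" by (rule complex_Re_le_cmod)
      finally show ?thesis using N by linarith
    qed
    (* near minus infinity f stays away from zero, which contradicts integrability *)
    have big: "(norm c / 2) * real m \<le> (LINT x|lborel. norm (f x))" for m :: nat
    proof -
      have i: "integrable lborel (\<lambda>x. indicator {- real N - real m..- real N} x *\<^sub>R (norm c / 2))"
        by (intro integrable_scaleR_left integrable_real_indicator) auto
      have "(norm c / 2) * real m = (LINT x|lborel. indicator {- real N - real m..- real N} x *\<^sub>R (norm c / 2))"
        by simp
      also have "\<dots> \<le> (LINT x|lborel. norm (f x))"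
      proof (rule integral_mono_AE[OF i])
        show "AE x in lborel. indicator {- real N - real m..- real N} x *\<^sub>R (norm c / 2) \<le> norm (f x)"
          using c
        proof eventually_elim
          case (elim x)
          show ?case
          proof (cases "x \<le> - real N")
            case True
            have "norm c \<le> norm (f x) + norm (prim g x)" using norm_triangle_ineq4[of "f x" "prim g x"] elim by simp
            then show ?thesis using small[OF True] by (auto simp: indicator_def)
          next
            case False
            then show ?thesis by auto
          qed
        qed
      qed (use f in auto)
      finally show ?thesis .
    qed
    obtain m :: nat where "(LINT x|lborel. norm (f x)) / (norm c / 2) < real m" using reals_Archimedean2 by blast
    then show False using big[of m] c0 by (simp add: field_simps)
  qed
  then show ?thesis using c by auto
qed

lemma borel_representative:
  fixes f :: "real \<Rightarrow> complex"
  assumes "f \<in> borel_measurable lebesgue"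
  obtains f' where "f' \<in> borel_measurable borel" "AE x in lebesgue. f x = f' x"
proof -
  have "(\<lambda>x. Re (f x)) \<in> borel_measurable lebesgue" "(\<lambda>x. Im (f x)) \<in> borel_measurable lebesgue"
    using assms by (auto simp: borel_measurable_complex_iff)
  note m = this[THEN completion_ex_borel_measurable_real]
  obtain r where r: "r \<in> borel_measurable lborel" "AE x in lborel. Re (f x) = r x" using m(1) by blast
  obtain i where i: "i \<in> borel_measurable lborel" "AE x in lborel. Im (f x) = i x" using m(2) by blast
  have "AE x in lborel. f x = Complex (r x) (i x)" using r(2) i(2) by eventually_elim (simp add: complex_eq_iff)
  then have "AE x in lebesgue. f x = Complex (r x) (i x)" by (rule AE_completion)
  moreover have "(\<lambda>x. Complex (r x) (i x)) \<in> borel_measurable borel"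
    using r i by (simp add: borel_measurable_complex_iff)
  ultimately show ?thesis using that by blast
qed

lemma locally_integrable_measurable:
  assumes "locally_integrable f" shows "f \<in> borel_measurable lebesgue"
proof (rule borel_measurable_LIMSEQ_metric)
  show "(\<lambda>x. indicator {-real n..real n} x *\<^sub>R f x) \<in> borel_measurable lebesgue" for n
    using assms unfolding locally_integrable_def set_integrable_def by (blast intro: borel_measurable_integrable)
  fix x
  obtain N :: nat where "\<bar>x\<bar> < real N" using reals_Archimedean2 by blast
  then have "\<forall>n\<ge>N. x \<in> {-real n..real n}" by (auto simp: abs_less_iff)
  then show "(\<lambda>n. indicator {-real n..real n} x *\<^sub>R f x) \<longlonglongrightarrow> f x"
    by (intro tendsto_eventually) (auto simp: eventually_sequentially intro!: exI[of _ N])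
qed

lemma has_weak_deriv_cong_AE:
  assumes w: "has_weak_deriv f g" and f: "AE x in lebesgue. f x = f' x" and g: "AE x in lebesgue. g x = g' x"
    and m: "f' \<in> borel_measurable lebesgue" "g' \<in> borel_measurable lebesgue"
  shows "has_weak_deriv f' g'"
proof -
  note [measurable] = m
  have l: "locally_integrable f" "locally_integrable g" using w by (auto simp: has_weak_deriv_def)
  note [measurable] = l[THEN locally_integrable_measurable]
  have li: "locally_integrable f'" if "locally_integrable f" "AE x in lebesgue. f x = f' x" "f' \<in> borel_measurable lebesgue"
    for f f' :: "real \<Rightarrow> complex"
    unfolding locally_integrable_def set_integrable_def
  proof safe
    fix a b
    note [measurable] = that(3) locally_integrable_measurable[OF that(1)]
    have "integrable lebesgue (\<lambda>x. indicat_real {a..b} x *\<^sub>R f x)"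
      using that(1) by (auto simp: locally_integrable_def set_integrable_def)
    then show "integrable lebesgue (\<lambda>x. indicat_real {a..b} x *\<^sub>R f' x)"
      by (rule integrable_cong_AE_imp) (use that(2) in \<open>auto intro!: borel_measurable_scaleR borel_measurable_indicator that(3)\<close>)
  qed
  have "(LINT x|lebesgue. deriv \<phi> x *\<^sub>R f' x) = - (LINT x|lebesgue. \<phi> x *\<^sub>R g' x)" if t: "test_function \<phi>" for \<phi>
  proof -
    obtain D where D: "continuous_on UNIV D" "deriv \<phi> = D" using test_functionE[OF t] by metis
    have "\<phi> \<in> borel_measurable borel" "D \<in> borel_measurable borel"
      by (intro borel_measurable_continuous_onI D test_function_continuous t)+
    then have [measurable]: "\<phi> \<in> borel_measurable lebesgue" "deriv \<phi> \<in> borel_measurable lebesgue"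
      by (auto simp: D(2) intro: measurable_completion)
    have "(LINT x|lebesgue. deriv \<phi> x *\<^sub>R f' x) = (LINT x|lebesgue. deriv \<phi> x *\<^sub>R f x)"
      by (rule integral_cong_AE) (use f in auto)
    moreover have "(LINT x|lebesgue. \<phi> x *\<^sub>R g' x) = (LINT x|lebesgue. \<phi> x *\<^sub>R g x)"
      by (rule integral_cong_AE) (use g in auto)
    ultimately show ?thesis using w t by (simp add: has_weak_deriv_def)
  qed
  then show ?thesis using li l f g m by (auto simp: has_weak_deriv_def)
qed

lemma has_weak_deriv_unique:
  assumes 1: "has_weak_deriv f g" and 2: "has_weak_deriv f g'"
  shows "AE x in lebesgue. g x = g' x"
proof -
  have m: "f \<in> borel_measurable lebesgue" "g \<in> borel_measurable lebesgue" "g' \<in> borel_measurable lebesgue"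
    using 1 2 by (auto simp: has_weak_deriv_def intro: locally_integrable_measurable)
  obtain f0 where f0: "f0 \<in> borel_measurable borel" "AE x in lebesgue. f x = f0 x" using borel_representative[OF m(1)] .
  obtain h where h: "h \<in> borel_measurable borel" "AE x in lebesgue. g x = h x" using borel_representative[OF m(2)] .
  obtain h' where h': "h' \<in> borel_measurable borel" "AE x in lebesgue. g' x = h' x" using borel_representative[OF m(3)] .
  note [measurable] = f0(1) h(1) h'(1)
  have "has_weak_deriv f0 h" "has_weak_deriv f0 h'"
    using has_weak_deriv_cong_AE[OF 1 f0(2) h(2)] has_weak_deriv_cong_AE[OF 2 f0(2) h'(2)]
    using f0(1) h(1) h'(1) by (simp_all add: measurable_completion)
  note w = this[unfolded has_weak_deriv_borel[OF f0(1) h(1)] has_weak_deriv_borel[OF f0(1) h'(1)]]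
  have "AE x in lborel. h x - h' x = 0"
  proof (rule fundamental_lemma_of_variations)
    fix \<zeta> assume t: "test_function \<zeta>"
    have "(LINT x|lborel. \<zeta> x *\<^sub>R (h x - h' x)) = (LINT x|lborel. \<zeta> x *\<^sub>R h x) - (LINT x|lborel. \<zeta> x *\<^sub>R h' x)"
      unfolding scaleR_diff_right by (intro Bochner_Integration.integral_diff test_function_mult_integrable t) (use w in auto)
    then show "(LINT x|lborel. \<zeta> x *\<^sub>R (h x - h' x)) = 0" using w(1)[THEN conjunct2, THEN conjunct2, rule_format, OF t] w(2)[THEN conjunct2, THEN conjunct2, rule_format, OF t] by simp
  qed (use w in \<open>auto intro!: set_integral_diff\<close>)
  then have "AE x in lebesgue. h x - h' x = 0" by (rule AE_completion)
  then show ?thesis using h(2) h'(2) by eventually_elim simp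
qed

section \<open>The space I parametrised by second derivatives\<close>

text \<open>The functions \<open>w\<close> for which \<open>prim (prim w)\<close> lies in \<open>\<I>\<close>, with first derivative \<open>prim w\<close>
  and second derivative \<open>w\<close>.\<close>

definition H2_density :: "(real \<Rightarrow> complex) \<Rightarrow> bool" where
  "H2_density w \<longleftrightarrow> weighted_L2 w \<and> weighted_L2 (prim w) \<and> weighted_L2 (prim (prim w))"

lemma L21_cong_AE:
  assumes f: "f \<in> borel_measurable lebesgue" and g: "g \<in> borel_measurable borel"
    and e: "AE x in lebesgue. f x = g x"
  shows "f \<in> L21 \<longleftrightarrow> weighted_L2 g" "norm_L21 f = sqrt (weighted_sq g)"
proof -
  note [measurable] = f g
  have gl[measurable]: "g \<in> borel_measurable lebesgue" using g by (simp add: measurable_completion)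
  have m1: "(\<lambda>x. ((1 + \<bar>x\<bar>) * cmod (g x))\<^sup>2) \<in> borel_measurable borel" by measurable
  have m2: "(\<lambda>x. ((1 + \<bar>x\<bar>) * cmod (g x))\<^sup>2) \<in> borel_measurable lebesgue"
    using m1 by (simp add: measurable_completion)
  have a: "(\<lambda>x. 1 + \<bar>x::real\<bar>) \<in> borel_measurable lebesgue"
    by (rule measurable_completion) simp
  have m3: "(\<lambda>x. ((1 + \<bar>x\<bar>) * cmod (f x))\<^sup>2) \<in> borel_measurable lebesgue"
    using a measurable_compose[OF f borel_measurable_norm] by (intro borel_measurable_power borel_measurable_times)
  have ae: "AE x in lebesgue. ((1 + \<bar>x\<bar>) * cmod (f x))\<^sup>2 = ((1 + \<bar>x\<bar>) * cmod (g x))\<^sup>2"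
    using e by eventually_elim simp
  have "integrable lebesgue (\<lambda>x. ((1 + \<bar>x\<bar>) * cmod (f x))\<^sup>2) \<longleftrightarrow> integrable lebesgue (\<lambda>x. ((1 + \<bar>x\<bar>) * cmod (g x))\<^sup>2)"
    by (rule integrable_cong_AE[OF m3 m2 ae])
  also have "\<dots> \<longleftrightarrow> integrable lborel (\<lambda>x. ((1 + \<bar>x\<bar>) * cmod (g x))\<^sup>2)"
    using m1 by (simp add: integrable_completion)
  finally show "f \<in> L21 \<longleftrightarrow> weighted_L2 g" using f g by (simp add: L21_def weighted_L2_def)
  have "(LINT x|lebesgue. ((1 + \<bar>x\<bar>) * cmod (f x))\<^sup>2) = (LINT x|lebesgue. ((1 + \<bar>x\<bar>) * cmod (g x))\<^sup>2)"
    by (rule integral_cong_AE[OF m3 m2 ae])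
  also have "\<dots> = weighted_sq g" using m1 by (simp add: integral_completion weighted_sq_def)
  finally show "norm_L21 f = sqrt (weighted_sq g)" by (simp add: norm_L21_def)
qed

lemma H2_densityD:
  assumes "H2_density w"
  shows "integrable lborel w" "integrable lborel (prim w)" "weighted_L2 w" "weighted_L2 (prim w)" "weighted_L2 (prim (prim w))"
  using assms weighted_L2_integrable(1) by (auto simp: H2_density_def)

lemma weighted_L2_L21:
  assumes "weighted_L2 g" shows "g \<in> L21" "norm_L21 g = sqrt (weighted_sq g)" "g \<in> borel_measurable lebesgue"
proof -
  have m: "g \<in> borel_measurable borel" using assms by (simp add: weighted_L2_def)
  then show m': "g \<in> borel_measurable lebesgue" by (simp add: measurable_completion)
  show "g \<in> L21" "norm_L21 g = sqrt (weighted_sq g)" using L21_cong_AE[OF m' m] assms by auto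
qed

lemma H2_density_space_I:
  assumes w: "H2_density w"
  shows "prim (prim w) \<in> space_I"
  unfolding space_I_def
  using weighted_L2_L21(1) H2_densityD[OF w] has_weak_deriv_prim by blast

text \<open>The selected versions of the weak derivatives agree almost everywhere with
  \<open>prim w\<close> and \<open>w\<close>, and the norm cannot distinguish them.\<close>

lemma H2_density_norm_I:
  assumes w: "H2_density w"
  shows "norm_I (prim (prim w)) = sqrt (weighted_sq (prim (prim w))) + sqrt (weighted_sq (prim w)) + sqrt (weighted_sq w)"
proof -
  note D = H2_densityD[OF w]
  define h where "h = weak_deriv (prim (prim w))"
  have h1: "has_weak_deriv (prim (prim w)) h"
    unfolding h_def weak_deriv_def by (rule someI[of _ "prim w"]) (rule has_weak_deriv_prim[OF D(2)])
  have h2: "AE x in lebesgue. h x = prim w x"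
    by (rule has_weak_deriv_unique[OF h1 has_weak_deriv_prim[OF D(2)]])
  have hm: "h \<in> borel_measurable lebesgue" using h1 by (auto simp: has_weak_deriv_def intro: locally_integrable_measurable)
  note L = weighted_L2_L21[OF D(3)] weighted_L2_L21[OF D(4)] weighted_L2_L21[OF D(5)]
  have "has_weak_deriv h w"
    by (rule has_weak_deriv_cong_AE[OF has_weak_deriv_prim[OF D(1)]]) (use h2 hm L in auto)
  then have k1: "has_weak_deriv h (weak_deriv h)"
    unfolding weak_deriv_def by (rule someI[of "has_weak_deriv h" w])
  then have km: "weak_deriv h \<in> borel_measurable lebesgue" by (auto simp: has_weak_deriv_def intro: locally_integrable_measurable)
  have "has_weak_deriv (prim w) (weak_deriv h)"
    by (rule has_weak_deriv_cong_AE[OF k1 h2]) (use km L in auto)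
  then have k2: "AE x in lebesgue. weak_deriv h x = w x"
    by (rule has_weak_deriv_unique[OF _ has_weak_deriv_prim[OF D(1)]])
  show ?thesis
    unfolding norm_I_def h_def[symmetric]
    using L L21_cong_AE(2)[OF hm weighted_L2D(1)[OF D(4)] h2] L21_cong_AE(2)[OF km weighted_L2D(1)[OF D(3)] k2] by simp
qed

lemma space_I_density:
  assumes f: "f \<in> space_I"
  obtains w where "H2_density w" "AE x in lebesgue. f x = prim (prim w) x"
proof -
  obtain f1 f2 where m: "f \<in> L21" "f1 \<in> L21" "f2 \<in> L21" and d: "has_weak_deriv f f1" "has_weak_deriv f1 f2"
    using f by (auto simp: space_I_def)
  have ml: "f \<in> borel_measurable lebesgue" "f1 \<in> borel_measurable lebesgue" "f2 \<in> borel_measurable lebesgue"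
    using m by (auto simp: L21_def)
  obtain g where g: "g \<in> borel_measurable borel" "AE x in lebesgue. f x = g x" using borel_representative[OF ml(1)] .
  obtain p where p: "p \<in> borel_measurable borel" "AE x in lebesgue. f1 x = p x" using borel_representative[OF ml(2)] .
  obtain w where w: "w \<in> borel_measurable borel" "AE x in lebesgue. f2 x = w x" using borel_representative[OF ml(3)] .
  have W: "weighted_L2 g" "weighted_L2 p" "weighted_L2 w"
    using L21_cong_AE(1) ml g p w m by metis+
  note I = W[THEN weighted_L2_integrable(1)]
  note MB = W[THEN weighted_L2_L21(3)]
  have d1: "has_weak_deriv g p" by (rule has_weak_deriv_cong_AE[OF d(1) g(2) p(2) MB(1,2)])
  have d2: "has_weak_deriv p w" by (rule has_weak_deriv_cong_AE[OF d(2) p(2) w(2) MB(2,3)])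
  have ep: "AE x in lborel. p x = prim w x" by (rule has_weak_deriv_imp_prim[OF d2 I(2,3)])
  have eg: "AE x in lborel. g x = prim p x" by (rule has_weak_deriv_imp_prim[OF d1 I(1,2)])
  have [measurable]: "prim w \<in> borel_measurable borel" by (intro borel_measurable_continuous_onI continuous_prim I)
  note [measurable] = p(1)
  have pp: "prim p = prim (prim w)"
  proof
    show "prim p x = prim (prim w) x" for x
      unfolding prim_def[of p] prim_def[of "prim w"] by (rule integral_cong_AE) (use ep in auto)
  qed
  have Wp: "weighted_L2 (prim w)"
    using L21_cong_AE(1)[OF MB(2) _ AE_completion[OF ep]] weighted_L2_L21(1)[OF W(2)] by simp
  then have "integrable lborel (prim w)" by (rule weighted_L2_integrable)
  then have "prim (prim w) \<in> borel_measurable borel" by (intro borel_measurable_continuous_onI continuous_prim)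
  then have "weighted_L2 (prim (prim w))"
    using L21_cong_AE(1)[OF MB(1) _ AE_completion[OF eg[unfolded pp]]] weighted_L2_L21(1)[OF W(1)] by simp
  moreover have "AE x in lebesgue. f x = prim (prim w) x"
    using g(2) AE_completion[OF eg[unfolded pp]] by eventually_elim simp
  ultimately show ?thesis using that[of w] W(3) Wp by (simp add: H2_density_def)
qed

lemma continuous_AE_eq:
  fixes f g :: "real \<Rightarrow> complex"
  assumes "continuous_on UNIV f" "continuous_on UNIV g" "AE x in lebesgue. f x = g x"
  shows "f = g"
proof -
  have "open {x. f x \<noteq> g x}" by (rule open_Collect_neq[OF assms(1,2)])
  moreover have "negligible {x. f x \<noteq> g x}"
    using assms(3) AE_iff_null_sets[of "{x. f x \<noteq> g x}" lebesgue] \<open>open {x. f x \<noteq> g x}\<close>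
    by (simp add: negligible_iff_null_sets)
  ultimately have "{x. f x \<noteq> g x} = {}" using open_not_negligible by blast
  then show ?thesis by auto
qed

lemma space_I_continuous_density:
  assumes "f \<in> space_I" "continuous_on UNIV f"
  obtains w where "H2_density w" "f = prim (prim w)"
proof -
  obtain w where w: "H2_density w" "AE x in lebesgue. f x = prim (prim w) x" using space_I_density[OF assms(1)] .
  then have "f = prim (prim w)"
    by (intro continuous_AE_eq assms continuous_prim H2_densityD) auto
  then show ?thesis using that w by blast
qed

lemma H2_density_diff:
  assumes a: "H2_density a" and b: "H2_density b"
  shows "H2_density (\<lambda>x. a x - b x)" "prim (\<lambda>x. a x - b x) = (\<lambda>x. prim a x - prim b x)"
    "prim (prim (\<lambda>x. a x - b x)) = (\<lambda>x. prim (prim a) x - prim (prim b) x)"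
proof -
  note A = H2_densityD[OF a] and B = H2_densityD[OF b]
  show p: "prim (\<lambda>x. a x - b x) = (\<lambda>x. prim a x - prim b x)" using prim_diff[OF A(1) B(1)] by auto
  show pp: "prim (prim (\<lambda>x. a x - b x)) = (\<lambda>x. prim (prim a) x - prim (prim b) x)"
    unfolding p using prim_diff[OF A(2) B(2)] by auto
  have d: "weighted_L2 (\<lambda>x. f x - g x)" if "weighted_L2 f" "weighted_L2 g" for f g :: "real \<Rightarrow> complex"
    using weighted_L2_add(1)[OF that(1) weighted_L2_dominated(1)[OF that(2), of "\<lambda>x. - g x" 1]] weighted_L2D(1)[OF that(2)] by simp
  show "H2_density (\<lambda>x. a x - b x)"
    unfolding H2_density_def using A B d by (simp only: pp) (auto simp: p)
qed

section \<open>Continuity of translations in weighted L2\<close>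

lemma integrable_translate:
  fixes f :: "real \<Rightarrow> 'a::{banach, second_countable_topology}"
  assumes "integrable lborel f"
  shows "integrable lborel (\<lambda>x. f (x + h))" "(LINT x|lborel. f (x + h)) = integral\<^sup>L lborel f"
  using lborel_integrable_real_affine[OF assms, of 1 h] lborel_integral_real_affine[of 1 f h]
  by (simp_all add: add.commute)

text \<open>The indicator of an open set is lower semicontinuous, so the positive part of
  \<open>1\<^sub>U x - 1\<^sub>U (x + h)\<close> tends to zero pointwise. The difference itself has integral zero, so its absolute
  value has twice the integral of its positive part.\<close>

lemma translation_continuous_indicator_open:
  assumes U: "open U" "emeasure lborel U < \<infinity>" and X: "X \<longlonglongrightarrow> (0::real)"
  shows "(\<lambda>n. LINT x|lborel. \<bar>indicator U (x + X n) - indicat_real U x\<bar>) \<longlonglongrightarrow> 0"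
proof -
  have [measurable]: "U \<in> sets borel" using U by simp
  have i: "integrable lborel (indicat_real U)" using U by (intro integrable_real_indicator) auto
  have ih: "integrable lborel (\<lambda>x. indicat_real U (x + h))" for h by (rule integrable_translate(1)[OF i])
  have eq: "(LINT x|lborel. \<bar>indicator U (x + h) - indicat_real U x\<bar>) = 2 * (LINT x|lborel. max 0 (indicat_real U x - indicator U (x + h)))" for h
  proof -
    have "integrable lborel (\<lambda>x. indicat_real U x - indicator U (x + h))" using i ih by auto
    then have im: "integrable lborel (\<lambda>x. max 0 (indicat_real U x - indicator U (x + h)))"
      by (intro integrable_max) auto
    have "(LINT x|lborel. \<bar>indicator U (x + h) - indicat_real U x\<bar>) =
      (LINT x|lborel. 2 * max 0 (indicat_real U x - indicator U (x + h)) - (indicat_real U x - indicator U (x + h)))"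
      by (intro Bochner_Integration.integral_cong) (auto simp: indicator_def)
    also have "\<dots> = (LINT x|lborel. 2 * max 0 (indicat_real U x - indicator U (x + h))) - ((LINT x|lborel. indicat_real U x) - (LINT x|lborel. indicator U (x + h)))"
      using i ih im by simp
    also have "(LINT x|lborel. indicat_real U (x + h)) = (LINT x|lborel. indicat_real U x)"
      by (rule integrable_translate(2)[OF i])
    finally show ?thesis by simp
  qed
  have "(\<lambda>n. LINT x|lborel. max 0 (indicat_real U x - indicator U (x + X n))) \<longlonglongrightarrow> (LINT x|(lborel::real measure). 0)"
  proof (rule integral_dominated_convergence[where w="indicat_real U"])
    have "(\<lambda>n. max 0 (indicat_real U x - indicator U (x + X n))) \<longlonglongrightarrow> 0" for x
    proof (cases "x \<in> U")
      case True
      have "(\<lambda>n. x + X n) \<longlonglongrightarrow> x + 0" by (intro tendsto_intros X)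
      then have "eventually (\<lambda>n. x + X n \<in> U) sequentially" using U(1) True by (auto intro: topological_tendstoD)
      then show ?thesis by (intro tendsto_eventually) (auto elim!: eventually_mono simp: True)
    next
      case False then show ?thesis by simp
    qed
    then show "AE x in lborel. (\<lambda>n. max 0 (indicat_real U x - indicator U (x + X n))) \<longlonglongrightarrow> 0" by simp
  qed (auto simp: i indicator_def)
  then have "(\<lambda>n. 2 * (LINT x|lborel. max 0 (indicat_real U x - indicator U (x + X n)))) \<longlonglongrightarrow> 2 * 0"
    by (intro tendsto_intros) simp
  then show ?thesis by (simp add: eq)
qed

lemma L1_translate_diff_le:
  fixes f g :: "real \<Rightarrow> real"
  assumes f: "integrable lborel f" and g: "integrable lborel g"
  shows "(LINT x|lborel. \<bar>f (x + h) - f x\<bar>) \<le> 2 * (LINT x|lborel. \<bar>f x - g x\<bar>) + (LINT x|lborel. \<bar>g (x + h) - g x\<bar>)"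
proof -
  note t = integrable_translate(1)[OF f, of h] integrable_translate(1)[OF g, of h]
  have d: "integrable lborel (\<lambda>x. \<bar>f x - g x\<bar>)" using f g by auto
  have "(LINT x|lborel. \<bar>f (x + h) - f x\<bar>) \<le> (LINT x|lborel. \<bar>f (x + h) - g (x + h)\<bar> + \<bar>f x - g x\<bar> + \<bar>g (x + h) - g x\<bar>)"
    using f g t by (intro integral_mono) auto
  also have "\<dots> = (LINT x|lborel. \<bar>f (x + h) - g (x + h)\<bar>) + (LINT x|lborel. \<bar>f x - g x\<bar>) + (LINT x|lborel. \<bar>g (x + h) - g x\<bar>)"
    using f g t by simp
  finally show ?thesis using integrable_translate(2)[OF d, of h] by simp
qed

text \<open>Indicators of Borel sets of finite measure are approximated from outside by open sets.\<close>

lemma translation_continuous_L1: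
  fixes f :: "real \<Rightarrow> real"
  assumes f: "integrable lborel f" and X: "X \<longlonglongrightarrow> (0::real)"
  shows "(\<lambda>n. LINT x|lborel. \<bar>f (x + X n) - f x\<bar>) \<longlonglongrightarrow> 0"
proof -
  have nonneg: "(LINT x|lborel. \<bar>g (x + h) - g x\<bar>) \<ge> 0" for g :: "real \<Rightarrow> real" and h
    by (intro integral_nonneg_AE) auto
  have approx: "(\<lambda>n. LINT x|lborel. \<bar>f (x + X n) - f x\<bar>) \<longlonglongrightarrow> 0"
    if f: "integrable lborel f" and a: "\<And>e. e > 0 \<Longrightarrow> \<exists>g. integrable lborel g \<and> (LINT x|lborel. \<bar>f x - g x\<bar>) < e \<and>
        (\<lambda>n. LINT x|lborel. \<bar>g (x + X n) - g x\<bar>) \<longlonglongrightarrow> 0" for f :: "real \<Rightarrow> real"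
  proof (rule tendstoI)
    fix e :: real assume "e > 0"
    then obtain g where g: "integrable lborel g" "(LINT x|lborel. \<bar>f x - g x\<bar>) < e / 4"
      "(\<lambda>n. LINT x|lborel. \<bar>g (x + X n) - g x\<bar>) \<longlonglongrightarrow> 0" using a[of "e/4"] by auto
    have "eventually (\<lambda>n. (LINT x|lborel. \<bar>g (x + X n) - g x\<bar>) < e / 2) sequentially"
      using g(3) \<open>e > 0\<close> by (intro order_tendstoD) auto
    then show "eventually (\<lambda>n. dist (LINT x|lborel. \<bar>f (x + X n) - f x\<bar>) 0 < e) sequentially"
    proof eventually_elim
      case (elim n)
      show ?case using L1_translate_diff_le[OF f g(1), of "X n"] elim g(2) nonneg[of f "X n"] by auto
    qed
  qed
  show ?thesis using f
  proof (induction rule: integrable_induct)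
    case (base A c)
    then have [measurable]: "A \<in> sets borel" by simp
    have iA: "integrable lborel (indicat_real A)" using base by (intro integrable_real_indicator) auto
    have "(\<lambda>n. LINT x|lborel. \<bar>indicat_real A (x + X n) - indicat_real A x\<bar>) \<longlonglongrightarrow> 0"
    proof (rule approx[OF iA])
      fix e :: real assume e: "e > 0"
      obtain U where U: "open U" "A \<subseteq> U" "emeasure lborel (U - A) < e"
        using outer_regular_lborel[of A e] e base by auto
      have [measurable]: "U \<in> sets borel" using U by simp
      have "emeasure lborel U \<le> emeasure lborel A + emeasure lborel (U - A)"
        using emeasure_subadditive[of A lborel "U - A"] U(2) by (simp add: Un_absorb1)
      also have "\<dots> < \<infinity>" using base U(3) by (auto simp: ennreal_add_less_top intro: less_trans[of _ "ennreal e"])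
      finally have fU: "emeasure lborel U < \<infinity>" .
      have "(LINT x|lborel. \<bar>indicat_real A x - indicat_real U x\<bar>) = (LINT x|lborel. indicat_real (U - A) x)"
        using U(2) by (intro Bochner_Integration.integral_cong) (auto simp: indicator_def)
      also have "\<dots> = measure lborel (U - A)" by simp
      also have "\<dots> < e"
      proof -
        have "emeasure lborel (U - A) < top" using U(3) by (rule less_trans) simp
        then have "emeasure lborel (U - A) = ennreal (measure lborel (U - A))"
          by (intro emeasure_eq_ennreal_measure) auto
        then show ?thesis using U(3) e by (simp add: ennreal_less_iff)
      qed
      finally show "\<exists>g. integrable lborel g \<and> (LINT x|lborel. \<bar>indicat_real A x - g x\<bar>) < e \<and>
        (\<lambda>n. LINT x|lborel. \<bar>g (x + X n) - g x\<bar>) \<longlonglongrightarrow> 0"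
        using fU translation_continuous_indicator_open[OF U(1) fU X]
        by (intro exI[of _ "indicat_real U"]) (auto intro!: integrable_real_indicator)
    qed
    then have "(\<lambda>n. \<bar>c\<bar> * (LINT x|lborel. \<bar>indicat_real A (x + X n) - indicat_real A x\<bar>)) \<longlonglongrightarrow> \<bar>c\<bar> * 0"
      by (intro tendsto_intros)
    moreover have "(LINT x|lborel. \<bar>indicator A (x + X n) *\<^sub>R c - indicator A x *\<^sub>R c\<bar>) = \<bar>c\<bar> * (LINT x|lborel. \<bar>indicat_real A (x + X n) - indicat_real A x\<bar>)" for n
    proof -
      have "(LINT x|lborel. \<bar>indicator A (x + X n) *\<^sub>R c - indicator A x *\<^sub>R c\<bar>) = (LINT x|lborel. \<bar>c\<bar> * \<bar>indicat_real A (x + X n) - indicat_real A x\<bar>)"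
        by (intro Bochner_Integration.integral_cong) (auto simp: indicator_def)
      then show ?thesis by simp
    qed
    ultimately show ?case by simp
  next
    case (add f g)
    have "(\<lambda>n. (LINT x|lborel. \<bar>f (x + X n) - f x\<bar>) + (LINT x|lborel. \<bar>g (x + X n) - g x\<bar>)) \<longlonglongrightarrow> 0 + 0"
      using add by (intro tendsto_add)
    then have z: "(\<lambda>n. (LINT x|lborel. \<bar>f (x + X n) - f x\<bar>) + (LINT x|lborel. \<bar>g (x + X n) - g x\<bar>)) \<longlonglongrightarrow> 0" by simp
    show ?case
    proof (rule Lim_null_comparison[OF _ z])
      have "(LINT x|lborel. \<bar>f (x + h) + g (x + h) - (f x + g x)\<bar>) \<le> (LINT x|lborel. \<bar>f (x + h) - f x\<bar>) + (LINT x|lborel. \<bar>g (x + h) - g x\<bar>)" for h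
      proof -
        note t = integrable_translate(1)[OF add(1), of h] integrable_translate(1)[OF add(2), of h]
        have "(LINT x|lborel. \<bar>f (x + h) + g (x + h) - (f x + g x)\<bar>) \<le> (LINT x|lborel. \<bar>f (x + h) - f x\<bar> + \<bar>g (x + h) - g x\<bar>)"
          using add(1,2) t by (intro integral_mono) auto
        then show ?thesis using add(1,2) t by simp
      qed
      then show "\<forall>\<^sub>F n in sequentially. norm (LINT x|lborel. \<bar>f (x + X n) + g (x + X n) - (f x + g x)\<bar>)
         \<le> (LINT x|lborel. \<bar>f (x + X n) - f x\<bar>) + (LINT x|lborel. \<bar>g (x + X n) - g x\<bar>)"
        using nonneg[of "\<lambda>x. f x + g x"] by (intro always_eventually) auto
    qed
  next
    case (lim f s)
    show ?case
    proof (rule approx[OF \<open>integrable lborel f\<close>])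
      fix e :: real assume e: "e > 0"
      have "(\<lambda>i. LINT x|lborel. \<bar>f x - s i x\<bar>) \<longlonglongrightarrow> (LINT x|(lborel::real measure). 0)"
      proof (rule integral_dominated_convergence[where w="\<lambda>x. 3 * \<bar>f x\<bar>"])
        show "AE x in lborel. (\<lambda>i. \<bar>f x - s i x\<bar>) \<longlonglongrightarrow> 0"
        proof (rule AE_I2)
          fix x
          have "(\<lambda>i. \<bar>f x - s i x\<bar>) \<longlonglongrightarrow> \<bar>f x - f x\<bar>" by (intro tendsto_intros lim) simp
          then show "(\<lambda>i. \<bar>f x - s i x\<bar>) \<longlonglongrightarrow> 0" by simp
        qed
        show "AE x in lborel. norm \<bar>f x - s i x\<bar> \<le> 3 * \<bar>f x\<bar>" for i
        proof (rule AE_I2)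
          fix x show "norm \<bar>f x - s i x\<bar> \<le> 3 * \<bar>f x\<bar>" using lim(3)[of x i] by simp
        qed
        show "(\<lambda>x. \<bar>f x - s i x\<bar>) \<in> borel_measurable lborel" for i
          using lim(1)[of i] \<open>integrable lborel f\<close> by auto
      qed (use \<open>integrable lborel f\<close> in auto)
      then have "eventually (\<lambda>i. (LINT x|lborel. \<bar>f x - s i x\<bar>) < e) sequentially"
        using e by (intro order_tendstoD) auto
      then obtain i where "(LINT x|lborel. \<bar>f x - s i x\<bar>) < e" by (auto simp: eventually_sequentially)
      then show "\<exists>g. integrable lborel g \<and> (LINT x|lborel. \<bar>f x - g x\<bar>) < e \<and>
        (\<lambda>n. LINT x|lborel. \<bar>g (x + X n) - g x\<bar>) \<longlonglongrightarrow> 0"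
        using lim by (intro exI[of _ "s i"]) auto
    qed
  qed
qed

lemma weighted_L2_translate:
  fixes f :: "real \<Rightarrow> 'a::euclidean_space"
  assumes f: "weighted_L2 f"
  shows "weighted_L2 (\<lambda>x. f (x + h))" "weighted_sq (\<lambda>x. f (x + h)) \<le> (1 + \<bar>h\<bar>)\<^sup>2 * weighted_sq f"
proof -
  note [measurable] = weighted_L2D(1)[OF f]
  define G where "G = (\<lambda>x. (1 + \<bar>h\<bar>)\<^sup>2 * ((1 + \<bar>x\<bar>) * norm (f x))\<^sup>2)"
  have G: "integrable lborel G" using weighted_L2D(2)[OF f] by (simp add: G_def)
  note Gh = integrable_translate[OF G, of h]
  have p: "((1 + \<bar>x\<bar>) * norm (f (x + h)))\<^sup>2 \<le> G (x + h)" for x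
  proof -
    have "1 + \<bar>x\<bar> \<le> 1 + \<bar>h\<bar> + \<bar>x + h\<bar>" by linarith
    also have "\<dots> \<le> 1 + \<bar>h\<bar> + \<bar>x + h\<bar> + \<bar>h\<bar> * \<bar>x + h\<bar>" by simp
    also have "\<dots> = (1 + \<bar>h\<bar>) * (1 + \<bar>x + h\<bar>)" by (simp add: algebra_simps)
    finally have "(1 + \<bar>x\<bar>) * norm (f (x + h)) \<le> ((1 + \<bar>h\<bar>) * (1 + \<bar>x + h\<bar>)) * norm (f (x + h))"
      by (intro mult_right_mono) auto
    then have "((1 + \<bar>x\<bar>) * norm (f (x + h)))\<^sup>2 \<le> (((1 + \<bar>h\<bar>) * (1 + \<bar>x + h\<bar>)) * norm (f (x + h)))\<^sup>2"
      by (intro power_mono) auto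
    then show ?thesis by (simp add: G_def power_mult_distrib mult_ac)
  qed
  have i: "integrable lborel (\<lambda>x. ((1 + \<bar>x\<bar>) * norm (f (x + h)))\<^sup>2)"
    by (rule Bochner_Integration.integrable_bound[OF Gh(1)]) (use p in \<open>auto simp: G_def\<close>)
  then show "weighted_L2 (\<lambda>x. f (x + h))" by (simp add: weighted_L2_def)
  have "weighted_sq (\<lambda>x. f (x + h)) \<le> (LINT x|lborel. G (x + h))"
    unfolding weighted_sq_def by (intro integral_mono i Gh p)
  also have "\<dots> = (1 + \<bar>h\<bar>)\<^sup>2 * weighted_sq f" unfolding Gh(2) by (simp add: G_def weighted_sq_def)
  finally show "weighted_sq (\<lambda>x. f (x + h)) \<le> (1 + \<bar>h\<bar>)\<^sup>2 * weighted_sq f" .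
qed

lemma square_diff_le_abs_diff_squares:
  fixes a b :: real assumes "a \<ge> 0" "b \<ge> 0" shows "(a - b)\<^sup>2 \<le> \<bar>a\<^sup>2 - b\<^sup>2\<bar>"
proof -
  have "\<bar>a - b\<bar> * \<bar>a - b\<bar> \<le> \<bar>a - b\<bar> * (a + b)" using assms by (intro mult_left_mono) auto
  also have "\<dots> = \<bar>a\<^sup>2 - b\<^sup>2\<bar>" using assms by (simp add: power2_eq_square square_diff_square_factored abs_mult mult.commute)
  finally show ?thesis by (simp add: power2_eq_square)
qed

text \<open>Reduced to \<open>L\<^sup>1\<close> by \<open>(a - b)\<^sup>2 \<le> \<bar>a\<^sup>2 - b\<^sup>2\<bar>\<close> for nonnegative numbers, applied to the positive
  and negative parts of the real and imaginary parts.\<close>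

lemma translation_continuous_L2:
  fixes g :: "real \<Rightarrow> complex"
  assumes [measurable]: "g \<in> borel_measurable borel" and i: "integrable lborel (\<lambda>x. (norm (g x))\<^sup>2)" and X: "X \<longlonglongrightarrow> (0::real)"
  shows "(\<lambda>n. LINT x|lborel. (norm (g (x + X n) - g x))\<^sup>2) \<longlonglongrightarrow> 0"
    "integrable lborel (\<lambda>x. (norm (g (x + h) - g x))\<^sup>2)"
proof -
  (* the positive and negative parts of the real and imaginary parts *)
  define r where "r = (\<lambda>(k::nat) z. if k = 0 then max 0 (Re z) else if k = 1 then max 0 (- Re z) else if k = 2 then max 0 (Im z) else max 0 (- Im z))"
  have r0: "r k z \<ge> 0" for k z by (simp add: r_def)
  have rn: "(r k z)\<^sup>2 \<le> (norm z)\<^sup>2" for k z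
    by (intro power_mono r0) (use abs_Re_le_cmod[of z] abs_Im_le_cmod[of z] in \<open>auto simp: r_def max_def\<close>)
  have rm[measurable]: "r k \<in> borel_measurable borel" for k
    unfolding r_def by (cases "k = 0"; cases "k = 1"; cases "k = 2"; simp)
  have ir: "integrable lborel (\<lambda>x. (r k (g x))\<^sup>2)" for k
    by (rule Bochner_Integration.integrable_bound[OF i]) (auto simp: rn)
  have p: "(norm (z - w))\<^sup>2 \<le> (\<Sum>k<4. 2 * \<bar>(r k z)\<^sup>2 - (r k w)\<^sup>2\<bar>)" for z w
  proof -
    have *: "(a - b)\<^sup>2 \<le> 2 * \<bar>(max 0 a)\<^sup>2 - (max 0 b)\<^sup>2\<bar> + 2 * \<bar>(max 0 (- a))\<^sup>2 - (max 0 (- b))\<^sup>2\<bar>" for a b :: real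
    proof -
      have "a - b = (max 0 a - max 0 b) - (max 0 (- a) - max 0 (- b))" by (auto simp: max_def)
      moreover have "(c - d)\<^sup>2 \<le> 2 * c\<^sup>2 + 2 * d\<^sup>2" for c d :: real
        using zero_le_power2[of "c + d"] by (simp add: power2_eq_square algebra_simps)
      ultimately have "(a - b)\<^sup>2 \<le> 2 * (max 0 a - max 0 b)\<^sup>2 + 2 * (max 0 (- a) - max 0 (- b))\<^sup>2" by metis
      then show ?thesis
        using square_diff_le_abs_diff_squares[of "max 0 a" "max 0 b"] square_diff_le_abs_diff_squares[of "max 0 (- a)" "max 0 (- b)"]
        by simp
    qed
    have "(norm (z - w))\<^sup>2 = (Re z - Re w)\<^sup>2 + (Im z - Im w)\<^sup>2" by (simp add: cmod_power2)
    then show ?thesis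
      using *[of "Re z" "Re w"] *[of "Im z" "Im w"] by (simp add: r_def numeral_eq_Suc)
  qed
  have it: "integrable lborel (\<lambda>x. \<Sum>k<4. 2 * \<bar>(r k (g (x + h)))\<^sup>2 - (r k (g x))\<^sup>2\<bar>)" for h
    using ir integrable_translate(1)[OF ir] by auto
  show j: "integrable lborel (\<lambda>x. (norm (g (x + h) - g x))\<^sup>2)" for h
    by (rule Bochner_Integration.integrable_bound[OF it[of h]]) (use p in \<open>auto intro: order_trans[OF _ abs_ge_self]\<close>)
  have "(\<lambda>n. \<Sum>k<4. 2 * (LINT x|lborel. \<bar>(r k (g (x + X n)))\<^sup>2 - (r k (g x))\<^sup>2\<bar>)) \<longlonglongrightarrow> (\<Sum>k<(4::nat). 2 * 0)"
    by (intro tendsto_sum tendsto_mult tendsto_const translation_continuous_L1[OF ir X])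
  moreover have "(LINT x|lborel. (norm (g (x + h) - g x))\<^sup>2) \<le> (\<Sum>k<4. 2 * (LINT x|lborel. \<bar>(r k (g (x + h)))\<^sup>2 - (r k (g x))\<^sup>2\<bar>))" for h
  proof -
    have "(LINT x|lborel. (norm (g (x + h) - g x))\<^sup>2) \<le> (LINT x|lborel. (\<Sum>k<4. 2 * \<bar>(r k (g (x + h)))\<^sup>2 - (r k (g x))\<^sup>2\<bar>))"
      by (intro integral_mono j it p)
    also have "\<dots> = (\<Sum>k<4. 2 * (LINT x|lborel. \<bar>(r k (g (x + h)))\<^sup>2 - (r k (g x))\<^sup>2\<bar>))"
      using ir integrable_translate(1)[OF ir] by (subst Bochner_Integration.integral_sum) auto
    finally show ?thesis .
  qed
  moreover have "(LINT x|lborel. (norm (g (x + h) - g x))\<^sup>2) \<ge> 0" for h by (intro integral_nonneg_AE) auto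
  ultimately show "(\<lambda>n. LINT x|lborel. (norm (g (x + X n) - g x))\<^sup>2) \<longlonglongrightarrow> 0"
    by (intro tendsto_sandwich[OF _ _ tendsto_const, of "0::real" "\<lambda>n. LINT x|lborel. (norm (g (x + X n) - g x))\<^sup>2" sequentially
          "\<lambda>n. \<Sum>k<4. 2 * (LINT x|lborel. \<bar>(r k (g (x + X n)))\<^sup>2 - (r k (g x))\<^sup>2\<bar>)"]) auto
qed

lemma weighted_L2_diff:
  fixes f g :: "real \<Rightarrow> 'a::euclidean_space"
  assumes f: "weighted_L2 f" and g: "weighted_L2 g"
  shows "weighted_L2 (\<lambda>x. f x - g x)"
  using weighted_L2_add(1)[OF f weighted_L2_dominated(1)[OF g, of "\<lambda>x. - g x" 1]] weighted_L2D(1)[OF g] by simp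

text \<open>Multiplication by the weight commutes with the translation by \<open>h\<close> up to an error
  of size \<open>\<bar>h\<bar>\<close>, since the weight is Lipschitz.\<close>

lemma translation_continuous_weighted_L2:
  fixes f :: "real \<Rightarrow> complex"
  assumes f: "weighted_L2 f" and X: "X \<longlonglongrightarrow> (0::real)"
  shows "(\<lambda>n. weighted_sq (\<lambda>x. f (x + X n) - f x)) \<longlonglongrightarrow> 0"
proof -
  note [measurable] = weighted_L2D(1)[OF f]
  define g where "g = (\<lambda>x. (1 + \<bar>x\<bar>) *\<^sub>R f x)"
  have ng: "norm (g x) = (1 + \<bar>x\<bar>) * norm (f x)" for x by (simp add: g_def)
  have [measurable]: "g \<in> borel_measurable borel" unfolding g_def by measurable
  have ig: "integrable lborel (\<lambda>x. (norm (g x))\<^sup>2)" unfolding ng by (rule weighted_L2D(2)[OF f])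
  have iff: "integrable lborel (\<lambda>x. (norm (f x))\<^sup>2)"
  proof (rule Bochner_Integration.integrable_bound[OF ig])
    have "norm (f x) \<le> norm (g x)" for x unfolding ng by (simp add: algebra_simps)
    then show "AE x in lborel. norm ((cmod (f x))\<^sup>2) \<le> norm ((cmod (g x))\<^sup>2)"
      by (intro AE_I2) (simp add: power_mono)
  qed auto
  note T = translation_continuous_L2[OF _ ig]
  note th = integrable_translate[OF iff]
  have le: "weighted_sq (\<lambda>x. f (x + h) - f x) \<le> 2 * (LINT x|lborel. (norm (g (x + h) - g x))\<^sup>2) + 2 * h\<^sup>2 * (LINT x|lborel. (norm (f x))\<^sup>2)" for h
  proof -
    have p: "((1 + \<bar>x\<bar>) * norm (f (x + h) - f x))\<^sup>2 \<le> 2 * (norm (g (x + h) - g x))\<^sup>2 + 2 * h\<^sup>2 * (norm (f (x + h)))\<^sup>2" for x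
    proof -
      have "(1 + \<bar>x\<bar>) *\<^sub>R (f (x + h) - f x) = (g (x + h) - g x) + (\<bar>x\<bar> - \<bar>x + h\<bar>) *\<^sub>R f (x + h)"
        by (simp add: g_def algebra_simps)
      then have "(1 + \<bar>x\<bar>) * norm (f (x + h) - f x) = norm ((g (x + h) - g x) + (\<bar>x\<bar> - \<bar>x + h\<bar>) *\<^sub>R f (x + h))"
        by (metis norm_scaleR abs_of_nonneg add_nonneg_nonneg zero_le_one abs_ge_zero)
      also have "\<dots> \<le> norm (g (x + h) - g x) + \<bar>\<bar>x\<bar> - \<bar>x + h\<bar>\<bar> * norm (f (x + h))"
        by (rule order_trans[OF norm_triangle_ineq]) simp
      also have "\<dots> \<le> norm (g (x + h) - g x) + \<bar>h\<bar> * norm (f (x + h))"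
        by (intro add_left_mono mult_right_mono) auto
      finally have "((1 + \<bar>x\<bar>) * norm (f (x + h) - f x))\<^sup>2 \<le> (norm (g (x + h) - g x) + \<bar>h\<bar> * norm (f (x + h)))\<^sup>2"
        by (intro power_mono) auto
      also have "\<dots> \<le> 2 * (norm (g (x + h) - g x))\<^sup>2 + 2 * (\<bar>h\<bar> * norm (f (x + h)))\<^sup>2"
        using sum_squares_bound[of "norm (g (x + h) - g x)" "\<bar>h\<bar> * norm (f (x + h))"] unfolding power2_sum by linarith
      finally show ?thesis by (simp add: power_mult_distrib)
    qed
    have "weighted_sq (\<lambda>x. f (x + h) - f x) \<le> (LINT x|lborel. 2 * (norm (g (x + h) - g x))\<^sup>2 + 2 * h\<^sup>2 * (norm (f (x + h)))\<^sup>2)"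
      unfolding weighted_sq_def
    proof (rule integral_mono[OF _ _ p])
      show "integrable lborel (\<lambda>x. ((1 + \<bar>x\<bar>) * cmod (f (x + h) - f x))\<^sup>2)"
        by (rule weighted_L2D(2)[OF weighted_L2_diff[OF weighted_L2_translate(1)[OF f] f]])
      show "integrable lborel (\<lambda>x. 2 * (norm (g (x + h) - g x))\<^sup>2 + 2 * h\<^sup>2 * (norm (f (x + h)))\<^sup>2)"
        using T(2)[OF _ X] th(1) by auto
    qed
    also have "\<dots> = 2 * (LINT x|lborel. (norm (g (x + h) - g x))\<^sup>2) + 2 * h\<^sup>2 * (LINT x|lborel. (norm (f (x + h)))\<^sup>2)"
      using T(2)[OF _ X] th(1) by simp
    finally show ?thesis by (simp add: th(2))
  qed
  have "(\<lambda>n. 2 * (LINT x|lborel. (norm (g (x + X n) - g x))\<^sup>2) + 2 * (X n)\<^sup>2 * (LINT x|lborel. (norm (f x))\<^sup>2)) \<longlonglongrightarrow> 2 * 0 + 2 * 0\<^sup>2 * (LINT x|lborel. (norm (f x))\<^sup>2)"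
    by (intro tendsto_intros T(1) X) auto
  then show ?thesis
    by (intro tendsto_sandwich[OF _ _ tendsto_const, of "0::real" "\<lambda>n. weighted_sq (\<lambda>x. f (x + X n) - f x)"])
       (auto intro: le weighted_sq_nonneg always_eventually)
qed

text \<open>If the values along every characteristic are continuous and dominated, the
  profile seen in the moving frame is continuous by dominated convergence. Returning to the fixed
  frame costs the translation of one fixed profile.\<close>

lemma weighted_L2_continuous_along_characteristics:
  fixes F :: "real \<Rightarrow> real \<Rightarrow> complex" and \<psi> :: "real \<Rightarrow> real"
  assumes m: "\<And>s. F s \<in> borel_measurable borel"
    and dom: "\<And>s y. \<bar>s\<bar> \<le> T \<Longrightarrow> norm (F s (y + c * s)) \<le> \<psi> y" and psi: "weighted_L2 \<psi>"
    and c: "\<bar>c\<bar> \<le> 1" and t: "\<bar>t\<bar> < T"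
    and cont: "\<And>y. isCont (\<lambda>s. F s (y + c * s)) t"
  shows "((\<lambda>s. weighted_sq (\<lambda>x. F s x - F t x)) \<longlongrightarrow> 0) (at t)"
  unfolding tendsto_at_iff_sequentially comp_def
proof safe
  fix S :: "nat \<Rightarrow> real" assume "S \<longlonglongrightarrow> t"
  have "eventually (\<lambda>n. S n \<in> {-T<..<T}) sequentially"
    using \<open>S \<longlonglongrightarrow> t\<close> t by (intro topological_tendstoD) auto
  then obtain N where N: "\<And>n. n \<ge> N \<Longrightarrow> \<bar>S n\<bar> \<le> T" by (fastforce simp: eventually_sequentially)
  define s where "s = (\<lambda>n. S (n + N))"
  have s: "s \<longlonglongrightarrow> t" "\<And>n. \<bar>s n\<bar> \<le> T" using \<open>S \<longlonglongrightarrow> t\<close> N by (auto simp: s_def intro: LIMSEQ_ignore_initial_segment)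
  define G where "G = (\<lambda>r y. F r (y + c * r))"
  have Gm[measurable]: "G r \<in> borel_measurable borel" for r
    unfolding G_def using measurable_compose[OF _ m[of r], of "\<lambda>y. y + c * r" borel] by simp
  have psi0: "\<psi> y \<ge> 0" for y using order_trans[OF norm_ge_zero dom[of t y]] t by simp
  have WG: "weighted_L2 (G r)" if "\<bar>r\<bar> \<le> T" for r
    by (rule weighted_L2_dominated(1)[OF psi Gm, of r 1]) (use dom[OF that] psi0 in \<open>auto simp: G_def\<close>)
  note wt = WG[OF less_imp_le[OF t]] and ws = WG[OF s(2)]
  define D where "D = (\<lambda>n y. G (s n) y - G t y)"
  have WD: "weighted_L2 (D n)" for n unfolding D_def by (rule weighted_L2_diff[OF ws wt])
  have lim1: "(\<lambda>n. weighted_sq (D n)) \<longlonglongrightarrow> 0"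
  proof -
    have "(\<lambda>n. LINT y|lborel. ((1 + \<bar>y\<bar>) * norm (D n y))\<^sup>2) \<longlonglongrightarrow> (LINT y|(lborel::real measure). 0)"
    proof (rule integral_dominated_convergence[where w="\<lambda>y. 4 * ((1 + \<bar>y\<bar>) * norm (\<psi> y))\<^sup>2"])
      show "integrable lborel (\<lambda>y. 4 * ((1 + \<bar>y\<bar>) * norm (\<psi> y))\<^sup>2)" using weighted_L2D(2)[OF psi] by simp
      show "(\<lambda>y. ((1 + \<bar>y\<bar>) * norm (D n y))\<^sup>2) \<in> borel_measurable lborel" for n
        using weighted_L2D(2)[OF WD[of n]] by auto
      have "(\<lambda>n. D n y) \<longlonglongrightarrow> G t y - G t y" for y
        unfolding D_def using isCont_tendsto_compose[OF cont s(1), of y] by (intro tendsto_diff) (auto simp: G_def)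
      then have "(\<lambda>n. ((1 + \<bar>y\<bar>) * norm (D n y))\<^sup>2) \<longlonglongrightarrow> ((1 + \<bar>y\<bar>) * norm (0::complex))\<^sup>2" for y
        by (intro tendsto_intros) simp
      then show "AE y in lborel. (\<lambda>n. ((1 + \<bar>y\<bar>) * norm (D n y))\<^sup>2) \<longlonglongrightarrow> 0" by simp
      show "AE y in lborel. norm (((1 + \<bar>y\<bar>) * norm (D n y))\<^sup>2) \<le> 4 * ((1 + \<bar>y\<bar>) * norm (\<psi> y))\<^sup>2" for n
      proof (rule AE_I2)
        fix y
        have "norm (D n y) \<le> norm (G (s n) y) + norm (G t y)" unfolding D_def by (rule norm_triangle_ineq4)
        also have "\<dots> \<le> 2 * \<psi> y" using dom[OF s(2), of n y] dom[of t y] t by (simp add: G_def)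
        finally have "(1 + \<bar>y\<bar>) * norm (D n y) \<le> (1 + \<bar>y\<bar>) * (2 * \<psi> y)" by (intro mult_left_mono) auto
        then have "((1 + \<bar>y\<bar>) * norm (D n y))\<^sup>2 \<le> ((1 + \<bar>y\<bar>) * (2 * \<psi> y))\<^sup>2" by (intro power_mono) auto
        then show "norm (((1 + \<bar>y\<bar>) * norm (D n y))\<^sup>2) \<le> 4 * ((1 + \<bar>y\<bar>) * norm (\<psi> y))\<^sup>2"
          by (simp add: power_mult_distrib)
      qed
    qed auto
    then show ?thesis by (simp add: weighted_sq_def)
  qed
  define h where "h = (\<lambda>n. - c * (s n - t))"
  have h: "h \<longlonglongrightarrow> 0"
  proof -
    have "h \<longlonglongrightarrow> - c * (t - t)" unfolding h_def by (intro tendsto_intros s)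
    then show ?thesis by simp
  qed
  define E where "E = (\<lambda>n y. G t (y + h n) - G t y)"
  have WE: "weighted_L2 (E n)" for n unfolding E_def by (rule weighted_L2_diff[OF weighted_L2_translate(1)[OF wt] wt])
  have lim2: "(\<lambda>n. weighted_sq (E n)) \<longlonglongrightarrow> 0"
    unfolding E_def by (rule translation_continuous_weighted_L2[OF wt h])
  have cr: "\<bar>- c * r\<bar> \<le> T" if "\<bar>r\<bar> \<le> T" for r
    using mult_mono[OF c that] by (simp add: abs_mult)
  have le: "weighted_sq (\<lambda>x. F (s n) x - F t x) \<le> 2 * ((1 + T)\<^sup>2 * weighted_sq (D n)) + 2 * ((1 + T)\<^sup>2 * weighted_sq (E n))" for n
  proof -
    have sh: "weighted_sq (\<lambda>x. f (x + - c * r)) \<le> (1 + T)\<^sup>2 * weighted_sq f" if f: "weighted_L2 f" and r: "\<bar>r\<bar> \<le> T" for f :: "real \<Rightarrow> complex" and r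
    proof (rule order_trans[OF weighted_L2_translate(2)[OF f]])
      show "(1 + \<bar>- c * r\<bar>)\<^sup>2 * weighted_sq f \<le> (1 + T)\<^sup>2 * weighted_sq f"
        using cr[OF r] by (intro mult_right_mono weighted_sq_nonneg power_mono) auto
    qed
    have eq: "F (s n) x - F t x = D n (x + - c * s n) + E n (x + - c * t)" for x
      by (simp add: D_def E_def G_def h_def algebra_simps)
    have "weighted_sq (\<lambda>x. F (s n) x - F t x) \<le> 2 * weighted_sq (\<lambda>x. D n (x + - c * s n)) + 2 * weighted_sq (\<lambda>x. E n (x + - c * t))"
      unfolding eq by (intro weighted_L2_add weighted_L2_translate WD WE)
    also have "\<dots> \<le> 2 * ((1 + T)\<^sup>2 * weighted_sq (D n)) + 2 * ((1 + T)\<^sup>2 * weighted_sq (E n))"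
      by (intro add_mono mult_left_mono sh WD WE s less_imp_le[OF t]) auto
    finally show ?thesis .
  qed
  have "(\<lambda>n. 2 * ((1 + T)\<^sup>2 * weighted_sq (D n)) + 2 * ((1 + T)\<^sup>2 * weighted_sq (E n))) \<longlonglongrightarrow> 2 * ((1 + T)\<^sup>2 * 0) + 2 * ((1 + T)\<^sup>2 * 0)"
    by (intro tendsto_intros lim1 lim2)
  then have "(\<lambda>n. weighted_sq (\<lambda>x. F (s n) x - F t x)) \<longlonglongrightarrow> 0"
    by (intro tendsto_sandwich[OF _ _ tendsto_const, of "0::real" "\<lambda>n. weighted_sq (\<lambda>x. F (s n) x - F t x)"])
       (auto intro: le weighted_sq_nonneg always_eventually)
  then show "(\<lambda>n. weighted_sq (\<lambda>x. F (S n) x - F t x)) \<longlonglongrightarrow> 0"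
    unfolding s_def by (rule LIMSEQ_offset)
qed

section \<open>Averaging against a slowly varying kernel\<close>

text \<open>The kernel decays fast enough for the average of a weighted square-integrable function
  to be of the same kind, and varies so slowly that a bounded shift changes the average at most by a
  constant factor. Both properties are used to carry pointwise bounds along characteristics.\<close>

definition kernel_average :: "(real \<Rightarrow> real) \<Rightarrow> real \<Rightarrow> real" where
  "kernel_average \<phi> x = (LINT y|lborel. \<phi> y / (1 + \<bar>x - y\<bar>)^4)"

lemma one_plus_abs_add_le: "1 + \<bar>x + y\<bar> \<le> (1 + \<bar>x\<bar>) * (1 + \<bar>y::real\<bar>)"
proof -
  have "1 + \<bar>x + y\<bar> \<le> 1 + \<bar>x\<bar> + \<bar>y\<bar> + \<bar>x\<bar> * \<bar>y\<bar>" by (simp add: add_increasing2)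
  then show ?thesis by (simp add: algebra_simps)
qed

lemma kernel_average_integrable:
  fixes \<phi> :: "real \<Rightarrow> real"
  assumes \<phi>: "integrable lborel \<phi>"
  shows "integrable lborel (\<lambda>y. \<phi> y / (1 + \<bar>x - y\<bar>)^4)"
proof (rule Bochner_Integration.integrable_bound[OF \<phi>])
  have "\<bar>\<phi> y / (1 + \<bar>x - y\<bar>)^4\<bar> \<le> \<bar>\<phi> y\<bar>" for y
  proof -
    have "\<bar>\<phi> y\<bar> / (1 + \<bar>x - y\<bar>)^4 \<le> \<bar>\<phi> y\<bar> / 1"
      by (intro divide_left_mono) (auto intro: one_le_power)
    then show ?thesis by simp
  qed
  then show "AE y in lborel. norm (\<phi> y / (1 + \<bar>x - y\<bar>)^4) \<le> norm (\<phi> y)" by simp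
qed (use \<phi> in auto)

lemma kernel_average_nonneg: "(\<And>x. \<phi> x \<ge> 0) \<Longrightarrow> kernel_average \<phi> x \<ge> 0"
  unfolding kernel_average_def by (intro integral_nonneg_AE) auto

lemma kernel_average_le:
  assumes \<phi>: "integrable lborel \<phi>" "\<And>x. \<phi> x \<ge> 0"
  shows "kernel_average \<phi> x \<le> (LINT y|lborel. \<phi> y)"
  unfolding kernel_average_def
proof (rule integral_mono[OF kernel_average_integrable[OF \<phi>(1)] \<phi>(1)])
  fix y
  have "\<phi> y / (1 + \<bar>x - y\<bar>)^4 \<le> \<phi> y / 1"
    using \<phi>(2) by (intro divide_left_mono) (auto intro: one_le_power)
  then show "\<phi> y / (1 + \<bar>x - y\<bar>)^4 \<le> \<phi> y" by simp
qed

lemma kernel_average_shift: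
  assumes \<phi>: "integrable lborel \<phi>" "\<And>x. \<phi> x \<ge> 0"
  shows "kernel_average \<phi> (x + r) \<le> (1 + \<bar>r\<bar>)^4 * kernel_average \<phi> x"
proof -
  have "kernel_average \<phi> (x + r) \<le> (LINT y|lborel. (1 + \<bar>r\<bar>)^4 * (\<phi> y / (1 + \<bar>x - y\<bar>)^4))"
    unfolding kernel_average_def
  proof (rule integral_mono[OF kernel_average_integrable[OF \<phi>(1)]])
    show "integrable lborel (\<lambda>y. (1 + \<bar>r\<bar>)^4 * (\<phi> y / (1 + \<bar>x - y\<bar>)^4))"
      by (intro integrable_mult_right kernel_average_integrable \<phi>)
    fix y
    have "(1 + \<bar>x - y\<bar>)^4 \<le> ((1 + \<bar>r\<bar>) * (1 + \<bar>x + r - y\<bar>))^4"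
      using one_plus_abs_add_le[of "-r" "x + r - y"] by (intro power_mono) auto
    then have "\<phi> y * (1 + \<bar>x - y\<bar>)^4 \<le> \<phi> y * ((1 + \<bar>r\<bar>)^4 * (1 + \<bar>x + r - y\<bar>)^4)"
      using \<phi>(2) by (intro mult_left_mono) (auto simp: power_mult_distrib)
    moreover have "1 + \<bar>x - y\<bar> \<noteq> 0" "1 + \<bar>x + r - y\<bar> \<noteq> 0" by linarith+
    ultimately show "\<phi> y / (1 + \<bar>x + r - y\<bar>)^4 \<le> (1 + \<bar>r\<bar>)^4 * (\<phi> y / (1 + \<bar>x - y\<bar>)^4)"
      by (simp add: divide_simps mult_ac)
  qed
  also have "\<dots> = (1 + \<bar>r\<bar>)^4 * kernel_average \<phi> x"
    unfolding kernel_average_def by (rule integral_mult_right_zero)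
  finally show ?thesis .
qed

lemma kernel_average_measurable[measurable]:
  assumes [measurable]: "\<phi> \<in> borel_measurable borel"
  shows "kernel_average \<phi> \<in> borel_measurable borel"
  unfolding kernel_average_def by measurable

lemma kernel_average_mono:
  assumes "integrable lborel \<phi>" "integrable lborel \<psi>" "\<And>x. \<phi> x \<le> \<psi> x"
  shows "kernel_average \<phi> x \<le> kernel_average \<psi> x"
  unfolding kernel_average_def using assms
  by (intro integral_mono kernel_average_integrable divide_right_mono) auto

text \<open>Jensen's inequality for the kernel, whose integral is \<open>J\<close>, bounds the square of the average
  by the average of the squares. The weight at \<open>x\<close> is at most the weight at \<open>y\<close> times the weight at
  \<open>x - y\<close>, and the kernel absorbs the square of the latter.\<close>

lemma kernel_average_weighted_L2:
  assumes \<phi>: "weighted_L2 \<phi>" "\<And>x. \<phi> x \<ge> (0::real)"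
  shows "weighted_L2 (kernel_average \<phi>)"
proof -
  note [measurable] = weighted_L2D(1)[OF \<phi>(1)]
  note i\<phi> = weighted_L2_integrable(1)[OF \<phi>(1)]
  define k where "k = (\<lambda>z::real. 1 / (1 + \<bar>z\<bar>)^4)"
  have k0: "k z > 0" for z by (simp add: k_def add_pos_nonneg)
  have [measurable]: "k \<in> borel_measurable borel" unfolding k_def by measurable
  have k2: "k z \<le> 1 / (1 + \<bar>z\<bar>)\<^sup>2" for z
    unfolding k_def by (intro divide_left_mono power_increasing) auto
  have ik: "integrable lborel k"
    by (rule Bochner_Integration.integrable_bound[OF integrable_inverse_weight_sq]) (use k2 k0 in \<open>auto simp: less_imp_le\<close>)
  have ikx: "integrable lborel (\<lambda>y. k (x - y))" "(LINT y|lborel. k (x - y)) = integral\<^sup>L lborel k" for x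
    using lborel_integrable_real_affine[OF ik, of "-1" x] lborel_integral_real_affine[of "-1" k x] by auto
  define J where "J = integral\<^sup>L lborel k"
  have J: "J > 0"
  proof -
    have "J \<ge> 0" unfolding J_def using k0 by (intro integral_nonneg_AE) (auto simp: less_imp_le)
    moreover have "J \<noteq> 0"
    proof
      assume "J = 0"
      then have "AE x in lborel. k x = 0"
        unfolding J_def using integral_nonneg_eq_0_iff_AE[OF ik] k0 by (auto simp: less_imp_le)
      then have "AE x in (lborel::real measure). False" by eventually_elim (use k0 in \<open>auto simp: less_le\<close>)
      then show False by (simp add: AE_iff_measurable[OF _ refl])
    qed
    ultimately show ?thesis by simp
  qed
  have i\<phi>2: "integrable lborel (\<lambda>x. (\<phi> x)\<^sup>2)"
  proof (rule Bochner_Integration.integrable_bound[OF weighted_L2D(2)[OF \<phi>(1)]])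
    have "\<bar>\<phi> x\<bar>\<^sup>2 \<le> ((1 + \<bar>x\<bar>) * \<bar>\<phi> x\<bar>)\<^sup>2" for x by (intro power_mono) (auto simp: algebra_simps)
    then show "AE x in lborel. norm ((\<phi> x)\<^sup>2) \<le> norm (((1 + \<bar>x\<bar>) * norm (\<phi> x))\<^sup>2)" by simp
  qed auto
  have ik2: "integrable lborel (\<lambda>y. k (x - y) * (\<phi> y)\<^sup>2)" for x
    using kernel_average_integrable[OF i\<phi>2, of x] by (simp add: k_def)
  have ik1: "integrable lborel (\<lambda>y. k (x - y) * \<phi> y)" for x
    using kernel_average_integrable[OF i\<phi>, of x] by (simp add: k_def)
  have ta: "kernel_average \<phi> x = (LINT y|lborel. k (x - y) * \<phi> y)" for x
    unfolding kernel_average_def k_def by simp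
  have CS: "(kernel_average \<phi> x)\<^sup>2 \<le> J * (LINT y|lborel. k (x - y) * (\<phi> y)\<^sup>2)" for x
  proof -
    (* c is the mean of \<phi> for the normalised kernel, and the variance is nonnegative *)
    define c where "c = kernel_average \<phi> x / J"
    have "0 \<le> (LINT y|lborel. k (x - y) * (\<phi> y - c)\<^sup>2)"
      using k0 by (intro integral_nonneg_AE) (auto simp: less_imp_le)
    also have "\<dots> = (LINT y|lborel. k (x - y) * (\<phi> y)\<^sup>2 - 2 * c * (k (x - y) * \<phi> y) + c\<^sup>2 * k (x - y))"
      by (intro Bochner_Integration.integral_cong) (auto simp: power2_eq_square algebra_simps)
    also have "\<dots> = (LINT y|lborel. k (x - y) * (\<phi> y)\<^sup>2) - 2 * c * kernel_average \<phi> x + c\<^sup>2 * J"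
      using ik2 ik1 ikx by (simp add: ta J_def)
    also have "\<dots> = (LINT y|lborel. k (x - y) * (\<phi> y)\<^sup>2) - (kernel_average \<phi> x)\<^sup>2 / J"
      using J by (simp add: c_def power2_eq_square field_simps)
    finally show ?thesis using J by (simp add: field_simps)
  qed
  define J2 where "J2 = (\<integral>\<^sup>+z. ennreal (1 / (1 + \<bar>z::real\<bar>)\<^sup>2) \<partial>lborel)"
  have J2: "J2 < \<infinity>" unfolding J2_def using integrable_inverse_weight_sq by (simp add: integrable_iff_bounded)
  have inner: "(\<integral>\<^sup>+x. ennreal ((1 + \<bar>x\<bar>)\<^sup>2 * (k (x - y) * (\<phi> y)\<^sup>2)) \<partial>lborel) \<le> ennreal (((1 + \<bar>y\<bar>) * norm (\<phi> y))\<^sup>2) * J2" for y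
  proof -
    have "(\<integral>\<^sup>+x. ennreal ((1 + \<bar>x\<bar>)\<^sup>2 * (k (x - y) * (\<phi> y)\<^sup>2)) \<partial>lborel) \<le> (\<integral>\<^sup>+x. ennreal (((1 + \<bar>y\<bar>) * norm (\<phi> y))\<^sup>2) * ennreal (1 / (1 + \<bar>-y + 1 * x\<bar>)\<^sup>2) \<partial>lborel)"
    proof (intro nn_integral_mono)
      fix x
      have "(1 + \<bar>x\<bar>)\<^sup>2 \<le> ((1 + \<bar>x - y\<bar>) * (1 + \<bar>y\<bar>))\<^sup>2"
        using one_plus_abs_add_le[of "x - y" y] by (intro power_mono) auto
      then have "(1 + \<bar>x\<bar>)\<^sup>2 * (k (x - y) * (\<phi> y)\<^sup>2) \<le> ((1 + \<bar>x - y\<bar>) * (1 + \<bar>y\<bar>))\<^sup>2 * (k (x - y) * (\<phi> y)\<^sup>2)"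
        using k0[of "x - y"] by (intro mult_right_mono) auto
      also have "\<dots> = ((1 + \<bar>y\<bar>) * norm (\<phi> y))\<^sup>2 * (1 / (1 + \<bar>x - y\<bar>)\<^sup>2)"
      proof -
        define d where "d = 1 + \<bar>x - y\<bar>"
        have "d > 0" by (simp add: d_def)
        then have "(d * (1 + \<bar>y\<bar>))\<^sup>2 * ((1 / d^4) * (\<phi> y)\<^sup>2) = ((1 + \<bar>y\<bar>) * \<bar>\<phi> y\<bar>)\<^sup>2 * (1 / d\<^sup>2)"
          by (simp add: power_mult_distrib divide_simps power2_eq_square power4_eq_xxxx)
        then show ?thesis by (simp add: d_def k_def)
      qed
      finally show "ennreal ((1 + \<bar>x\<bar>)\<^sup>2 * (k (x - y) * (\<phi> y)\<^sup>2)) \<le> ennreal (((1 + \<bar>y\<bar>) * norm (\<phi> y))\<^sup>2) * ennreal (1 / (1 + \<bar>-y + 1 * x\<bar>)\<^sup>2)"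
        by (simp add: ennreal_mult[symmetric])
    qed
    also have "\<dots> = ennreal (((1 + \<bar>y\<bar>) * norm (\<phi> y))\<^sup>2) * (\<integral>\<^sup>+x. ennreal (1 / (1 + \<bar>-y + 1 * x\<bar>)\<^sup>2) \<partial>lborel)"
      by (intro nn_integral_cmult) measurable
    also have "(\<integral>\<^sup>+x. ennreal (1 / (1 + \<bar>-y + 1 * x\<bar>)\<^sup>2) \<partial>lborel) = J2"
      unfolding J2_def by (subst nn_integral_real_affine[where c=1 and t="-y"]) auto
    finally show ?thesis .
  qed
  have "(\<integral>\<^sup>+x. ennreal (((1 + \<bar>x\<bar>) * norm (kernel_average \<phi> x))\<^sup>2) \<partial>lborel)
      \<le> (\<integral>\<^sup>+x. ennreal J * (\<integral>\<^sup>+y. ennreal ((1 + \<bar>x\<bar>)\<^sup>2 * (k (x - y) * (\<phi> y)\<^sup>2)) \<partial>lborel) \<partial>lborel)"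
  proof (intro nn_integral_mono)
    fix x
    have "((1 + \<bar>x\<bar>) * norm (kernel_average \<phi> x))\<^sup>2 \<le> (1 + \<bar>x\<bar>)\<^sup>2 * (J * (LINT y|lborel. k (x - y) * (\<phi> y)\<^sup>2))"
      using CS[of x] by (simp add: power_mult_distrib mult_left_mono)
    also have "\<dots> = J * (LINT y|lborel. (1 + \<bar>x\<bar>)\<^sup>2 * (k (x - y) * (\<phi> y)\<^sup>2))" by simp
    finally have "ennreal (((1 + \<bar>x\<bar>) * norm (kernel_average \<phi> x))\<^sup>2) \<le> ennreal J * ennreal (LINT y|lborel. (1 + \<bar>x\<bar>)\<^sup>2 * (k (x - y) * (\<phi> y)\<^sup>2))"
      using J by (simp add: ennreal_mult'[symmetric] ennreal_leI del: integral_mult_right_zero)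
    also have "ennreal (LINT y|lborel. (1 + \<bar>x\<bar>)\<^sup>2 * (k (x - y) * (\<phi> y)\<^sup>2)) = (\<integral>\<^sup>+y. ennreal ((1 + \<bar>x\<bar>)\<^sup>2 * (k (x - y) * (\<phi> y)\<^sup>2)) \<partial>lborel)"
      using ik2[of x] k0 by (intro nn_integral_eq_integral[symmetric] integrable_mult_right) (auto simp: less_imp_le)
    finally show "ennreal (((1 + \<bar>x\<bar>) * norm (kernel_average \<phi> x))\<^sup>2) \<le> ennreal J * (\<integral>\<^sup>+y. ennreal ((1 + \<bar>x\<bar>)\<^sup>2 * (k (x - y) * (\<phi> y)\<^sup>2)) \<partial>lborel)" .
  qed
  also have "\<dots> = ennreal J * (\<integral>\<^sup>+x. \<integral>\<^sup>+y. ennreal ((1 + \<bar>x\<bar>)\<^sup>2 * (k (x - y) * (\<phi> y)\<^sup>2)) \<partial>lborel \<partial>lborel)"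
    by (intro nn_integral_cmult) measurable
  also have "(\<integral>\<^sup>+x. \<integral>\<^sup>+y. ennreal ((1 + \<bar>x\<bar>)\<^sup>2 * (k (x - y) * (\<phi> y)\<^sup>2)) \<partial>lborel \<partial>lborel) = (\<integral>\<^sup>+y. \<integral>\<^sup>+x. ennreal ((1 + \<bar>x\<bar>)\<^sup>2 * (k (x - y) * (\<phi> y)\<^sup>2)) \<partial>lborel \<partial>lborel)"
    by (rule lborel_pair.Fubini') measurable
  also have "ennreal J * \<dots> \<le> ennreal J * (\<integral>\<^sup>+y. ennreal (((1 + \<bar>y\<bar>) * norm (\<phi> y))\<^sup>2) * J2 \<partial>lborel)"
    by (intro mult_left_mono nn_integral_mono inner) simp
  also have "\<dots> = ennreal J * ((\<integral>\<^sup>+y. ennreal (((1 + \<bar>y\<bar>) * norm (\<phi> y))\<^sup>2) \<partial>lborel) * J2)"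
    by (subst nn_integral_multc) auto
  also have "\<dots> < \<infinity>"
    using weighted_L2D(2)[OF \<phi>(1)] J2 by (simp add: integrable_iff_bounded ennreal_mult_less_top)
  finally have "integrable lborel (\<lambda>x. ((1 + \<bar>x\<bar>) * norm (kernel_average \<phi> x))\<^sup>2)"
    by (intro integrableI_nonneg) auto
  then show ?thesis by (simp add: weighted_L2_def)
qed

section \<open>Oriented time integrals and a contracting majorant\<close>

abbreviation seg :: "real \<Rightarrow> real set" where "seg t \<equiv> {min 0 t..max 0 t}"

text \<open>The integral from \<open>0\<close> to \<open>t\<close>, negative orientation included. Written with a sign and an
  indicator so that measurability in parameters and estimates are uniform in the sign of \<open>t\<close>.\<close>

definition vint :: "(real \<Rightarrow> 'a::{banach, second_countable_topology}) \<Rightarrow> real \<Rightarrow> 'a" where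
  "vint g t = sgn t *\<^sub>R (LINT s|lborel. indicator (seg t) s *\<^sub>R g s)"

lemma seg_abs_le: "s \<in> seg t \<Longrightarrow> \<bar>s\<bar> \<le> \<bar>t\<bar>" "s \<in> seg t \<Longrightarrow> \<bar>t - s\<bar> \<le> \<bar>t\<bar>" "s \<in> seg t \<Longrightarrow> \<bar>2 * s - t\<bar> \<le> \<bar>t\<bar>"
  by (auto simp: min_def max_def split: if_splits)

lemma norm_vint_le:
  assumes h: "integrable lborel (\<lambda>s. indicator (seg t) s * h s)" and le: "\<And>s. s \<in> seg t \<Longrightarrow> norm (g s) \<le> h s"
  shows "norm (vint g t) \<le> (LINT s|lborel. indicator (seg t) s * h s)"
proof -
  have "norm (vint g t) \<le> norm (LINT s|lborel. indicator (seg t) s *\<^sub>R g s)"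
    by (simp add: vint_def sgn_if)
  also have "\<dots> \<le> (LINT s|lborel. norm (indicator (seg t) s *\<^sub>R g s))" by (rule integral_norm_bound)
  also have "\<dots> \<le> (LINT s|lborel. indicator (seg t) s * h s)"
  proof (rule integral_mono'[OF h])
    show "norm (indicator (seg t) s *\<^sub>R g s) \<le> indicator (seg t) s * h s" for s
      using le[of s] by (auto simp: indicator_def)
    show "0 \<le> indicator (seg t) s * h s" for s
      using order_trans[OF norm_ge_zero le[of s]] by (auto simp: indicator_def)
  qed
  finally show ?thesis .
qed

lemma vint_diff:
  assumes "integrable lborel (\<lambda>s. indicator (seg t) s *\<^sub>R f s)" "integrable lborel (\<lambda>s. indicator (seg t) s *\<^sub>R g s)"
  shows "vint (\<lambda>s. f s - g s) t = vint f t - vint g t"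
  unfolding vint_def by (simp only: scaleR_diff_right Bochner_Integration.integral_diff[OF assms])

lemma seg_integral_exp:
  assumes l: "l > 0"
  shows "integrable lborel (\<lambda>s. indicator (seg t) s * exp (l * \<bar>s\<bar>))"
    "(LINT s|lborel. indicator (seg t) s * exp (l * \<bar>s\<bar>)) \<le> exp (l * \<bar>t\<bar>) / l"
proof -
  have "set_integrable lborel (seg t) (\<lambda>s. exp (l * \<bar>s\<bar>))"
    by (rule continuous_imp_set_integrable) (intro continuous_intros)
  then show "integrable lborel (\<lambda>s. indicator (seg t) s * exp (l * \<bar>s\<bar>))" by (simp add: set_integrable_def)
  show "(LINT s|lborel. indicator (seg t) s * exp (l * \<bar>s\<bar>)) \<le> exp (l * \<bar>t\<bar>) / l"
  proof (cases "t \<ge> 0")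
    case True
    have "(LINT s|lborel. indicator (seg t) s * exp (l * \<bar>s\<bar>)) = (LINT s|lborel. exp (l * s) * indicator {0..t} s)"
      using True by (intro Bochner_Integration.integral_cong) (auto simp: indicator_def)
    also have "\<dots> = exp (l * t) / l - exp (l * 0) / l"
      using True l by (intro integral_FTC_Icc_real) (auto intro!: derivative_eq_intros)
    also have "\<dots> \<le> exp (l * \<bar>t\<bar>) / l" using True l by simp
    finally show ?thesis .
  next
    case False
    have "(LINT s|lborel. indicator (seg t) s * exp (l * \<bar>s\<bar>)) = (LINT s|lborel. exp (- l * s) * indicator {t..0} s)"
      using False by (intro Bochner_Integration.integral_cong) (auto simp: indicator_def)
    also have "\<dots> = - exp (- l * 0) / l - - exp (- l * t) / l"
      using False l by (intro integral_FTC_Icc_real) (auto intro!: derivative_eq_intros)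
    also have "\<dots> \<le> exp (l * \<bar>t\<bar>) / l" using False l by simp
    finally show ?thesis .
  qed
qed

text \<open>The speed of the component with index \<open>b\<close>.\<close>

definition dir :: "bool \<Rightarrow> real" where "dir b = (if b then 1 else -1)"

lemma dir_simps[simp]: "\<bar>dir b\<bar> = 1" "dir b \<noteq> 0" "dir (\<not> b) = - dir b" "dir b * dir b = 1" "\<bar>dir b * x\<bar> = \<bar>x\<bar>"
  by (auto simp: dir_def)

text \<open>A profile travelling in the direction opposite to the characteristic is traversed
  with relative speed two, so its integral along the characteristic is a spatial integral over an interval of
  length \<open>2 \<bar>t\<bar>\<close> around \<open>x\<close>, where the kernel is bounded below.\<close>

lemma seg_integral_crossing:
  fixes \<phi> :: "real \<Rightarrow> real"
  assumes \<phi>: "integrable lborel \<phi>" "\<And>x. \<phi> x \<ge> 0" and t: "\<bar>t\<bar> \<le> T"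
  shows "integrable lborel (\<lambda>s. indicator (seg t) s * \<phi> (x - dir b * t + 2 * dir b * s))"
    "(LINT s|lborel. indicator (seg t) s * \<phi> (x - dir b * t + 2 * dir b * s)) \<le> (1 + T)^4 / 2 * kernel_average \<phi> x"
proof -
  define y where "y = (\<lambda>s. x - dir b * t + 2 * dir b * s)"
  define h where "h = (\<lambda>z. \<phi> z / (1 + \<bar>x - z\<bar>)^4)"
  have ih: "integrable lborel h" unfolding h_def by (rule kernel_average_integrable[OF \<phi>(1)])
  have "integrable lborel (\<lambda>s. \<phi> (y s))"
    unfolding y_def by (rule lborel_integrable_real_affine[OF \<phi>(1)]) simp
  then show i: "integrable lborel (\<lambda>s. indicator (seg t) s * \<phi> (x - dir b * t + 2 * dir b * s))"
    using integrable_indicator_times[of "\<lambda>s. \<phi> (y s)" "seg t"] by (simp add: y_def)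
  have ihy: "integrable lborel (\<lambda>s. h (y s))" unfolding y_def by (rule lborel_integrable_real_affine[OF ih]) simp
  have "(LINT s|lborel. indicator (seg t) s * \<phi> (x - dir b * t + 2 * dir b * s)) \<le> (LINT s|lborel. (1 + T)^4 * h (y s))"
  proof (rule integral_mono[OF i])
    show "integrable lborel (\<lambda>s. (1 + T)^4 * h (y s))" using ihy by simp
    fix s
    have pos: "1 + \<bar>x - y s\<bar> > 0" by (simp add: add_pos_nonneg)
    show "indicator (seg t) s * \<phi> (x - dir b * t + 2 * dir b * s) \<le> (1 + T)^4 * h (y s)"
    proof (cases "s \<in> seg t")
      case True
      have "x - y s = dir b * (t - 2 * s)" by (simp add: y_def algebra_simps)
      then have "\<bar>x - y s\<bar> = \<bar>2 * s - t\<bar>" by (simp add: abs_minus_commute)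
      then have "\<bar>x - y s\<bar> \<le> T" using seg_abs_le(3)[OF True] t by linarith
      then have "(1 + \<bar>x - y s\<bar>)^4 \<le> (1 + T)^4" by (intro power_mono) auto
      then have "\<phi> (y s) * (1 + \<bar>x - y s\<bar>)^4 \<le> \<phi> (y s) * (1 + T)^4" using \<phi>(2) by (intro mult_left_mono) auto
      then have "\<phi> (y s) \<le> (1 + T)^4 * h (y s)" using pos by (simp add: h_def pos_le_divide_eq mult.commute)
      then show ?thesis using True by (simp add: y_def)
    next
      case False
      have "0 \<le> (1 + T)^4 * h (y s)" using \<phi>(2) by (simp add: h_def)
      then show ?thesis using False by simp
    qed
  qed
  also have "\<dots> = (1 + T)^4 / 2 * kernel_average \<phi> x"
  proof -
    have "kernel_average \<phi> x = 2 * (LINT s|lborel. h (y s))"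
      unfolding kernel_average_def h_def[symmetric] y_def
      by (subst lborel_integral_real_affine[of "2 * dir b" _ "x - dir b * t"]) (auto simp: abs_mult)
    then show ?thesis by simp
  qed
  finally show "(LINT s|lborel. indicator (seg t) s * \<phi> (x - dir b * t + 2 * dir b * s)) \<le> (1 + T)^4 / 2 * kernel_average \<phi> x" .
qed

definition majorant :: "real \<Rightarrow> real \<Rightarrow> (real \<Rightarrow> real) \<Rightarrow> bool \<Rightarrow> real \<Rightarrow> real \<Rightarrow> real" where
  "majorant l K \<phi> b t x = exp (l * \<bar>t\<bar>) * (\<phi> (x - dir b * t) + K * kernel_average \<phi> x)"

abbreviation majorant2 where
  "majorant2 l K \<phi> b t x \<equiv> majorant l K \<phi> b t x + majorant l K \<phi> (\<not> b) t x"

lemma majorant_measurable[measurable]: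
  assumes [measurable]: "\<phi> \<in> borel_measurable borel" "g \<in> borel_measurable M" "h \<in> borel_measurable M"
  shows "(\<lambda>x. majorant l K \<phi> b (g x) (h x)) \<in> borel_measurable M"
  unfolding majorant_def by measurable

text \<open>The three contributions to the integral of the majorants are treated differently: the component's own profile is
  constant along its characteristic and gains \<open>1 / l\<close> from the exponential, so does the
  average, and the crossing profile gains nothing but produces a multiple of the average that does not
  involve \<open>K\<close>. So \<open>K\<close> is taken large first, and then \<open>l\<close>.\<close>

lemma majorant_contraction:
  fixes \<phi> :: "real \<Rightarrow> real"
  assumes \<phi>: "integrable lborel \<phi>" "\<And>x. \<phi> x \<ge> 0" and T: "T \<ge> 0" and L: "L \<ge> 0"
  obtains l K where "l > 0" "K \<ge> 1"
    "\<And>b t x. \<bar>t\<bar> \<le> T \<Longrightarrow> integrable lborel (\<lambda>s. indicator (seg t) s *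
        majorant2 l K \<phi> b s (x - dir b * (t - s)))"
    "\<And>b t x. \<bar>t\<bar> \<le> T \<Longrightarrow> L * (LINT s|lborel. indicator (seg t) s *
        majorant2 l K \<phi> b s (x - dir b * (t - s)))
        \<le> majorant l K \<phi> b t x / 2"
proof -
  define E where "E = (1 + T)^4"
  have E: "E \<ge> 1" unfolding E_def using T by (intro one_le_power) auto
  have LE: "L \<le> L * E" "0 \<le> L * E" using E L mult_left_mono[OF E L] by auto
  (* 2 L E makes the crossing contribution at most a quarter of K; l then controls the remaining terms *)
  define K where "K = 2 * (L * E) + 1"
  define l where "l = 8 * (L * E) + 1"
  have l: "l > 0" and K: "K \<ge> 1" using LE by (auto simp: l_def K_def)
  have [measurable]: "\<phi> \<in> borel_measurable borel" using \<phi>(1) by auto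
  have k0: "kernel_average \<phi> x \<ge> 0" for x by (rule kernel_average_nonneg[OF \<phi>(2)])
  let ?M = "\<lambda>b t x s. indicator (seg t) s *
        majorant2 l K \<phi> b s (x - dir b * (t - s))"
  let ?H = "\<lambda>b t x s. (indicator (seg t) s * exp (l * \<bar>s\<bar>)) * (\<phi> (x - dir b * t) + 2 * K * E * kernel_average \<phi> x)
      + exp (l * \<bar>t\<bar>) * (indicator (seg t) s * \<phi> (x - dir b * t + 2 * dir b * s))"
  have bound: "0 \<le> ?M b t x s \<and> ?M b t x s \<le> ?H b t x s" if t: "\<bar>t\<bar> \<le> T" for b t x s
  proof (cases "s \<in> seg t")
    case True
    define y where "y = x - dir b * (t - s)"
    have y1: "y - dir b * s = x - dir b * t" "y - dir (\<not> b) * s = x - dir b * t + 2 * dir b * s"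
      by (auto simp: y_def algebra_simps)
    have "kernel_average \<phi> y \<le> (1 + \<bar>- dir b * (t - s)\<bar>)^4 * kernel_average \<phi> x"
      using kernel_average_shift[OF \<phi>, of x "- dir b * (t - s)"] by (simp add: y_def)
    also have "\<dots> \<le> E * kernel_average \<phi> x"
      unfolding E_def using seg_abs_le(2)[OF True] t
      by (intro mult_right_mono k0 power_mono) (auto simp: abs_mult)
    finally have ty: "kernel_average \<phi> y \<le> E * kernel_average \<phi> x" .
    have Kt: "K * kernel_average \<phi> y \<le> K * (E * kernel_average \<phi> x)" using ty K by (intro mult_left_mono) auto
    have m0: "0 \<le> majorant l K \<phi> c s y" for c unfolding majorant_def using K k0 \<phi>(2) by simp
    have "majorant2 l K \<phi> b s y
       = exp (l * \<bar>s\<bar>) * (\<phi> (x - dir b * t) + 2 * (K * kernel_average \<phi> y)) + exp (l * \<bar>s\<bar>) * \<phi> (x - dir b * t + 2 * dir b * s)"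
      unfolding majorant_def y1 by (simp add: algebra_simps)
    also have "\<dots> \<le> exp (l * \<bar>s\<bar>) * (\<phi> (x - dir b * t) + 2 * (K * (E * kernel_average \<phi> x))) + exp (l * \<bar>t\<bar>) * \<phi> (x - dir b * t + 2 * dir b * s)"
      using ty K seg_abs_le(1)[OF True] l \<phi>(2) by (intro add_mono mult_left_mono mult_right_mono) auto
    finally show ?thesis using True m0[of b] m0[of "\<not> b"] by (simp add: y_def[symmetric] mult.assoc)
  next
    case False
    then show ?thesis by simp
  qed
  have iH: "integrable lborel (?H b t x)" if t: "\<bar>t\<bar> \<le> T" for b t x
    by (intro Bochner_Integration.integrable_add integrable_mult_left integrable_mult_right seg_integral_exp l
        seg_integral_crossing[OF \<phi> t])
  have iM: "integrable lborel (?M b t x)" if t: "\<bar>t\<bar> \<le> T" for b t x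
  proof (rule Bochner_Integration.integrable_bound[OF iH[OF t, where b=b and x=x]])
    show "AE s in lborel. norm (?M b t x s) \<le> norm (?H b t x s)"
    proof (rule AE_I2)
      fix s show "norm (?M b t x s) \<le> norm (?H b t x s)"
        using bound[OF t, where b=b and x=x and s=s] by (simp only: real_norm_def abs_of_nonneg) (meson abs_ge_self order_trans)
    qed
  qed measurable
  have "L * integral\<^sup>L lborel (?M b t x) \<le> majorant l K \<phi> b t x / 2" if t: "\<bar>t\<bar> \<le> T" for b t x
  proof -
    define p where "p = \<phi> (x - dir b * t)"
    define k where "k = kernel_average \<phi> x"
    define e where "e = exp (l * \<bar>t\<bar>)"
    have pos: "p \<ge> 0" "k \<ge> 0" "e > 0" using \<phi>(2) k0 by (auto simp: p_def k_def e_def)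
    have "integral\<^sup>L lborel (?M b t x) \<le> integral\<^sup>L lborel (?H b t x)"
      using bound[OF t] by (intro integral_mono iM iH t) auto
    also have "\<dots> = (LINT s|lborel. indicator (seg t) s * exp (l * \<bar>s\<bar>)) * (p + 2 * K * E * k)
       + e * (LINT s|lborel. indicator (seg t) s * \<phi> (x - dir b * t + 2 * dir b * s))"
      unfolding p_def k_def e_def
      by (subst Bochner_Integration.integral_add)
        (auto intro!: integrable_mult_left integrable_mult_right seg_integral_exp l seg_integral_crossing[OF \<phi> t]
          simp only: integral_mult_left_zero integral_mult_right_zero)
    also have "\<dots> \<le> (e / l) * (p + 2 * K * E * k) + e * (E / 2 * k)"
      unfolding e_def E_def k_def using pos K E seg_integral_exp(2)[OF l, of t] seg_integral_crossing(2)[OF \<phi> t, of x b]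
      by (intro add_mono mult_right_mono mult_left_mono) (auto simp: E_def p_def k_def)
    finally have "L * integral\<^sup>L lborel (?M b t x) \<le> L * ((e / l) * (p + 2 * K * E * k) + e * (E / 2 * k))"
      using L by (intro mult_left_mono) auto
    also have "\<dots> = e * ((L / l) * p + (2 * (L * E / l) * K + L * E / 2) * k)"
      using l by (simp add: field_simps)
    also have "\<dots> \<le> e * ((1 / 2) * p + (K / 2) * k)"
    proof (intro mult_left_mono add_mono mult_right_mono)
      show "L / l \<le> 1 / 2" using LE l by (simp add: l_def field_simps)
      have "L * E / l \<le> 1 / 8" using LE l by (simp add: l_def field_simps)
      then have "2 * (L * E / l) \<le> 2 * (1 / 8)" by linarith
      then have "2 * (L * E / l) * K \<le> 2 * (1 / 8) * K" by (rule mult_right_mono) (use K in auto)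
      moreover have "L * E / 2 \<le> K / 4" by (simp add: K_def)
      ultimately show "2 * (L * E / l) * K + L * E / 2 \<le> K / 2" by linarith
    qed (use pos in auto)
    also have "\<dots> = majorant l K \<phi> b t x / 2" by (simp add: majorant_def e_def p_def k_def field_simps)
    finally show ?thesis .
  qed
  with l K iM show ?thesis using that by blast
qed

section \<open>Picard iteration along characteristics\<close>

text \<open>The solution formula for the transport equation with data \<open>U0\<close> and right-hand side \<open>N\<close>.\<close>

definition duhamel :: "(bool \<Rightarrow> real \<Rightarrow> complex) \<Rightarrow> (bool \<Rightarrow> real \<Rightarrow> real \<Rightarrow> complex) \<Rightarrow> bool \<Rightarrow> real \<Rightarrow> real \<Rightarrow> complex" where
  "duhamel U0 N b t x = U0 b (x - dir b * t) + vint (\<lambda>s. N b s (x - dir b * (t - s))) t"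

definition plane_measurable :: "(real \<Rightarrow> real \<Rightarrow> complex) \<Rightarrow> bool" where
  "plane_measurable F \<longleftrightarrow> (\<lambda>p. F (fst p) (snd p)) \<in> borel_measurable (borel \<Otimes>\<^sub>M borel)"

lemma plane_measurable_compose:
  assumes "plane_measurable F" "g \<in> borel_measurable M" "h \<in> borel_measurable M"
  shows "(\<lambda>x. F (g x) (h x)) \<in> borel_measurable M"
proof -
  have "(\<lambda>x. (g x, h x)) \<in> measurable M (borel \<Otimes>\<^sub>M borel)" using assms by simp
  from measurable_compose[OF this assms(1)[unfolded plane_measurable_def]] show ?thesis by simp
qed

lemma duhamel_plane_measurable:
  assumes U0: "U0 b \<in> borel_measurable borel" and N: "plane_measurable (N b)"
  shows "plane_measurable (duhamel U0 N b)"
proof -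
  have m1: "(\<lambda>p. U0 b (snd p - dir b * fst p)) \<in> borel_measurable (borel \<Otimes>\<^sub>M borel)"
    by (rule measurable_compose[OF _ U0]) measurable
  have [measurable]: "(\<lambda>q::(real \<times> real) \<times> real. N b (snd q) (snd (fst q) - dir b * (fst (fst q) - snd q))) \<in> borel_measurable ((borel \<Otimes>\<^sub>M borel) \<Otimes>\<^sub>M lborel)"
    by (rule plane_measurable_compose[OF N]) measurable
  have "(\<lambda>(p::real \<times> real, s). indicator (seg (fst p)) s *\<^sub>R N b s (snd p - dir b * (fst p - s))) =
        (\<lambda>q. (if min 0 (fst (fst q)) \<le> snd q \<and> snd q \<le> max 0 (fst (fst q)) then N b (snd q) (snd (fst q) - dir b * (fst (fst q) - snd q)) else 0))"
    by (auto simp: fun_eq_iff indicator_def)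
  moreover have "\<dots> \<in> borel_measurable ((borel \<Otimes>\<^sub>M borel) \<Otimes>\<^sub>M lborel)"
    by measurable
  ultimately have "(\<lambda>(p::real \<times> real, s). indicator (seg (fst p)) s *\<^sub>R N b s (snd p - dir b * (fst p - s))) \<in> borel_measurable ((borel \<Otimes>\<^sub>M borel) \<Otimes>\<^sub>M lborel)"
    by simp
  from lborel.borel_measurable_lebesgue_integral[OF this]
  have "(\<lambda>p::real \<times> real. LINT s|lborel. indicator (seg (fst p)) s *\<^sub>R N b s (snd p - dir b * (fst p - s))) \<in> borel_measurable (borel \<Otimes>\<^sub>M borel)" .
  moreover have "(\<lambda>p::real \<times> real. sgn (fst p)) \<in> borel_measurable (borel \<Otimes>\<^sub>M borel)" by measurable
  ultimately have "(\<lambda>p::real \<times> real. vint (\<lambda>s. N b s (snd p - dir b * (fst p - s))) (fst p)) \<in> borel_measurable (borel \<Otimes>\<^sub>M borel)"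
    unfolding vint_def by (intro borel_measurable_scaleR)
  then show ?thesis unfolding plane_measurable_def duhamel_def using m1 by (intro borel_measurable_add)
qed

lemma geometric_limit:
  fixes a :: "nat \<Rightarrow> complex"
  assumes "\<And>n. norm (a (Suc n) - a n) \<le> C * (1/2)^n"
  shows "a \<longlonglongrightarrow> lim a" "norm (a n - lim a) \<le> 2 * C * (1/2)^n"
proof -
  have C: "C \<ge> 0" using order_trans[OF norm_ge_zero assms[of 0]] by simp
  have s: "summable (\<lambda>n. C * (1/2::real)^n)" by (intro summable_mult summable_geometric) simp
  have "summable (\<lambda>n. a (Suc n) - a n)"
    by (rule summable_comparison_test'[OF s, of 0]) (use assms in auto)
  then have "convergent (\<lambda>n. \<Sum>i<n. a (Suc i) - a i)" by (simp add: summable_iff_convergent)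
  then have "convergent (\<lambda>n. a n - a 0)" by (simp add: sum_lessThan_telescope)
  then have "convergent a" using convergent_diff_const_right_iff by blast
  then show l: "a \<longlonglongrightarrow> lim a" by (simp add: convergent_LIMSEQ_iff)
  have part: "norm (a (n + m) - a n) \<le> 2 * C * (1/2)^n - 2 * C * (1/2)^(n + m)" for m
  proof (induction m)
    case 0 show ?case by simp
  next
    case (Suc m)
    have "norm (a (n + Suc m) - a n) \<le> norm (a (Suc (n + m)) - a (n + m)) + norm (a (n + m) - a n)"
      using norm_triangle_ineq[of "a (Suc (n + m)) - a (n + m)" "a (n + m) - a n"] by simp
    also have "\<dots> \<le> C * (1/2)^(n + m) + (2 * C * (1/2)^n - 2 * C * (1/2)^(n + m))"
      by (intro add_mono assms Suc)
    finally show ?case by simp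
  qed
  have "(\<lambda>m. a (m + n)) \<longlonglongrightarrow> lim a" by (rule LIMSEQ_ignore_initial_segment[OF l])
  then have "(\<lambda>m. norm (a (n + m) - a n)) \<longlonglongrightarrow> norm (lim a - a n)" by (intro tendsto_intros) (simp add: add.commute)
  moreover have "norm (a (n + m) - a n) \<le> 2 * C * (1/2)^n" for m
    using part[of m] C by (smt (verit) mult_nonneg_nonneg zero_le_power divide_nonneg_nonneg)
  ultimately have "norm (lim a - a n) \<le> 2 * C * (1/2)^n" by (intro tendsto_upperbound) auto
  then show "norm (a n - lim a) \<le> 2 * C * (1/2)^n" by (simp add: norm_minus_commute)
qed

text \<open>A semilinear system of two transport equations with opposite speeds, with Lipschitz constants that
  are only locally uniform in time. The data are measurable and dominated by \<open>\<phi>\<close>; the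
  right-hand side at zero may contain profiles travelling in both directions.\<close>

locale transport_system =
  fixes f :: "bool \<Rightarrow> real \<Rightarrow> real \<Rightarrow> complex \<Rightarrow> complex \<Rightarrow> complex"
    and U0 :: "bool \<Rightarrow> real \<Rightarrow> complex" and \<phi> :: "real \<Rightarrow> real"
  assumes phi_int: "integrable lborel \<phi>" and phi_nonneg: "\<And>x. \<phi> x \<ge> 0"
    and data_measurable: "\<And>b. U0 b \<in> borel_measurable borel" and data_le: "\<And>b x. norm (U0 b x) \<le> \<phi> x"
    and f_measurable: "\<And>b U V. plane_measurable U \<Longrightarrow> plane_measurable V \<Longrightarrow> plane_measurable (\<lambda>t x. f b t x (U t x) (V t x))"
    and f_Lipschitz: "\<And>T. \<exists>L\<ge>0. \<forall>b t x a c a' c'. \<bar>t\<bar> \<le> T \<longrightarrow> norm (f b t x a c - f b t x a' c') \<le> L * (norm (a - a') + norm (c - c'))"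
    and f_forcing: "\<And>T. \<exists>L\<ge>0. \<forall>b t x. \<bar>t\<bar> \<le> T \<longrightarrow> norm (f b t x 0 0) \<le> L * (\<phi> (x - dir b * t) + \<phi> (x + dir b * t) + kernel_average \<phi> x)"
begin

definition source :: "(bool \<Rightarrow> real \<Rightarrow> real \<Rightarrow> complex) \<Rightarrow> bool \<Rightarrow> real \<Rightarrow> real \<Rightarrow> complex" where
  "source U b t x = f b t x (U b t x) (U (\<not> b) t x)"

fun iterate :: "nat \<Rightarrow> bool \<Rightarrow> real \<Rightarrow> real \<Rightarrow> complex" where
  "iterate 0 = (\<lambda>_ _ _. 0)"
| "iterate (Suc n) = duhamel U0 (source (iterate n))"

lemma source_measurable: "(\<And>b. plane_measurable (U b)) \<Longrightarrow> plane_measurable (source U b)"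
  unfolding source_def by (intro f_measurable)

lemma iterate_measurable: "plane_measurable (iterate n b)"
proof (induction n arbitrary: b)
  case 0
  then show ?case by (simp add: plane_measurable_def)
next
  case (Suc n)
  then show ?case by (auto intro!: duhamel_plane_measurable data_measurable source_measurable)
qed

abbreviation "char_majorant l K b t x s \<equiv> indicator (seg t) s *
        majorant2 l K \<phi> b s (x - dir b * (t - s))"

text \<open>For times up to \<open>T\<close> the constants make the Picard map halve distances measured by the
  majorant. They depend on \<open>T\<close>, whereas the iterates do not, so the limit is global.\<close>

definition contracts :: "real \<Rightarrow> real \<Rightarrow> real \<Rightarrow> real \<Rightarrow> bool" where
  "contracts T L l K \<longleftrightarrow> 0 \<le> L \<and> 0 < l \<and> 1 \<le> K \<and>
     (\<forall>b t x a c a' c'. \<bar>t\<bar> \<le> T \<longrightarrow> norm (f b t x a c - f b t x a' c') \<le> L * (norm (a - a') + norm (c - c'))) \<and>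
     (\<forall>b t x. \<bar>t\<bar> \<le> T \<longrightarrow> norm (f b t x 0 0) \<le> L * (\<phi> (x - dir b * t) + \<phi> (x + dir b * t) + kernel_average \<phi> x)) \<and>
     (\<forall>b t x. \<bar>t\<bar> \<le> T \<longrightarrow> integrable lborel (char_majorant l K b t x)) \<and>
     (\<forall>b t x. \<bar>t\<bar> \<le> T \<longrightarrow> L * integral\<^sup>L lborel (char_majorant l K b t x) \<le> majorant l K \<phi> b t x / 2)"

lemma contracts_exists:
  assumes "T \<ge> 0" obtains L l K where "contracts T L l K"
proof -
  obtain L1 where L1: "L1 \<ge> 0" "\<forall>b t x a c a' c'. \<bar>t\<bar> \<le> T \<longrightarrow> norm (f b t x a c - f b t x a' c') \<le> L1 * (norm (a - a') + norm (c - c'))"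
    using f_Lipschitz[of T] by blast
  obtain L2 where L2: "L2 \<ge> 0" "\<forall>b t x. \<bar>t\<bar> \<le> T \<longrightarrow> norm (f b t x 0 0) \<le> L2 * (\<phi> (x - dir b * t) + \<phi> (x + dir b * t) + kernel_average \<phi> x)"
    using f_forcing[of T] by blast
  define L where "L = max L1 L2"
  have L: "L \<ge> 0" "L1 \<le> L" "L2 \<le> L" using L1(1) by (auto simp: L_def)
  have F1: "norm (f b t x a c - f b t x a' c') \<le> L * (norm (a - a') + norm (c - c'))" if "\<bar>t\<bar> \<le> T" for b t x a c a' c'
    by (rule order_trans[OF L1(2)[rule_format, OF that] mult_right_mono[OF L(2)]]) auto
  have F2: "norm (f b t x 0 0) \<le> L * (\<phi> (x - dir b * t) + \<phi> (x + dir b * t) + kernel_average \<phi> x)" if "\<bar>t\<bar> \<le> T" for b t x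
    by (rule order_trans[OF L2(2)[rule_format, OF that] mult_right_mono[OF L(3)]])
      (auto intro!: add_nonneg_nonneg phi_nonneg kernel_average_nonneg)
  show ?thesis
  proof (rule majorant_contraction[OF phi_int phi_nonneg assms L(1)])
    fix l K :: real
    assume lK: "l > 0" "K \<ge> 1" "\<And>b t x. \<bar>t\<bar> \<le> T \<Longrightarrow> integrable lborel (char_majorant l K b t x)"
      "\<And>b t x. \<bar>t\<bar> \<le> T \<Longrightarrow> L * integral\<^sup>L lborel (char_majorant l K b t x) \<le> majorant l K \<phi> b t x / 2"
    have "contracts T L l K"
      unfolding contracts_def by (intro conjI allI impI; (rule lK L(1) F1 F2 | assumption)+)
    then show thesis by (rule that)
  qed
qed

lemma majorant_ge:
  assumes "contracts T L l K"
  shows "\<phi> (x - dir b * t) + kernel_average \<phi> x \<le> majorant l K \<phi> b t x" "majorant l K \<phi> b t x \<ge> 0"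
proof -
  have l: "l > 0" and K: "K \<ge> 1" using assms by (auto simp: contracts_def)
  have k: "kernel_average \<phi> x \<ge> 0" by (rule kernel_average_nonneg[OF phi_nonneg])
  have "\<phi> (x - dir b * t) + kernel_average \<phi> x \<le> 1 * (\<phi> (x - dir b * t) + K * kernel_average \<phi> x)"
    using mult_right_mono[OF K k] by simp
  also have "\<dots> \<le> majorant l K \<phi> b t x"
    unfolding majorant_def using l K k phi_nonneg by (intro mult_right_mono) auto
  finally show "\<phi> (x - dir b * t) + kernel_average \<phi> x \<le> majorant l K \<phi> b t x" .
  then show "majorant l K \<phi> b t x \<ge> 0" using k phi_nonneg[of "x - dir b * t"] by linarith
qed

lemma source_le:
  assumes c: "contracts T L l K" and t: "\<bar>t\<bar> \<le> T" and C: "\<And>b. norm (U b t x) \<le> C * majorant l K \<phi> b t x" "C \<ge> 0"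
  shows "norm (source U b t x) \<le> (1 + C) * (L * (majorant2 l K \<phi> b t x))"
proof -
  define m where "m = majorant2 l K \<phi> b t x"
  have L: "L \<ge> 0" using c by (simp add: contracts_def)
  have k: "kernel_average \<phi> x \<ge> 0" by (rule kernel_average_nonneg[OF phi_nonneg])
  have "norm (f b t x (U b t x) (U (\<not> b) t x) - f b t x 0 0) \<le> L * (norm (U b t x - 0) + norm (U (\<not> b) t x - 0))"
    using c t unfolding contracts_def by blast
  also have "\<dots> \<le> L * (C * m)"
    unfolding m_def distrib_left[of C] using L C by (intro mult_left_mono add_mono) auto
  finally have 1: "norm (f b t x (U b t x) (U (\<not> b) t x) - f b t x 0 0) \<le> L * (C * m)" .
  have "norm (f b t x 0 0) \<le> L * (\<phi> (x - dir b * t) + \<phi> (x + dir b * t) + kernel_average \<phi> x)"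
    using c t unfolding contracts_def by blast
  also have "\<dots> \<le> L * m"
    unfolding m_def using majorant_ge(1)[OF c, of x b t] majorant_ge(1)[OF c, of x "\<not> b" t] k L
    by (intro mult_left_mono) auto
  finally have 2: "norm (f b t x 0 0) \<le> L * m" .
  have "norm (source U b t x) \<le> norm (f b t x (U b t x) (U (\<not> b) t x) - f b t x 0 0) + norm (f b t x 0 0)"
    unfolding source_def using norm_triangle_ineq[of "f b t x (U b t x) (U (\<not> b) t x) - f b t x 0 0" "f b t x 0 0"] by simp
  then show ?thesis using 1 2 unfolding m_def[symmetric] by (simp add: algebra_simps)
qed

lemma source_integrable:
  assumes c: "contracts T L l K" and t: "\<bar>t\<bar> \<le> T" and m: "\<And>b. plane_measurable (U b)"
    and C: "\<And>b s y. \<bar>s\<bar> \<le> T \<Longrightarrow> norm (U b s y) \<le> C * majorant l K \<phi> b s y" "C \<ge> 0"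
  shows "integrable lborel (\<lambda>s. indicator (seg t) s *\<^sub>R source U b s (x - dir b * (t - s)))"
proof -
  have L: "L \<ge> 0" using c by (simp add: contracts_def)
  have i: "integrable lborel (\<lambda>s. (1 + C) * L * char_majorant l K b t x s)"
    using c t unfolding contracts_def by (intro integrable_mult_right) blast
  have [measurable]: "(\<lambda>s. source U b s (x - dir b * (t - s))) \<in> borel_measurable lborel"
    by (rule plane_measurable_compose[OF source_measurable[OF m]]) measurable
  show ?thesis
  proof (rule Bochner_Integration.integrable_bound[OF i])
    have "norm (indicator (seg t) s *\<^sub>R source U b s (x - dir b * (t - s))) \<le> norm ((1 + C) * L * char_majorant l K b t x s)" for s
    proof (cases "s \<in> seg t")
      case True
      then have s: "\<bar>s\<bar> \<le> T" using seg_abs_le(1) t by fastforce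
      have "norm (source U b s (x - dir b * (t - s))) \<le> (1 + C) * (L * majorant2 l K \<phi> b s (x - dir b * (t - s)))"
        by (intro source_le[OF c s] C s)
      also have "\<dots> = (1 + C) * L * char_majorant l K b t x s" using True by simp
      finally have "norm (source U b s (x - dir b * (t - s))) \<le> norm ((1 + C) * L * char_majorant l K b t x s)" by (simp only: real_norm_def)
      then show ?thesis using True by simp
    qed simp
    then show "AE s in lborel. norm (indicator (seg t) s *\<^sub>R source U b s (x - dir b * (t - s))) \<le> norm ((1 + C) * L * char_majorant l K b t x s)" by simp
  qed measurable
qed

lemma duhamel_contracts:
  assumes c: "contracts T L l K" and t: "\<bar>t\<bar> \<le> T" and m: "\<And>b. plane_measurable (U b)" "\<And>b. plane_measurable (V b)"
    and C: "\<And>b s y. \<bar>s\<bar> \<le> T \<Longrightarrow> norm (U b s y) \<le> C * majorant l K \<phi> b s y"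
      "\<And>b s y. \<bar>s\<bar> \<le> T \<Longrightarrow> norm (V b s y) \<le> C * majorant l K \<phi> b s y" "C \<ge> 0"
    and e: "\<And>b s y. \<bar>s\<bar> \<le> T \<Longrightarrow> norm (U b s y - V b s y) \<le> e * majorant l K \<phi> b s y" "e \<ge> 0"
  shows "norm (duhamel U0 (source U) b t x - duhamel U0 (source V) b t x) \<le> (e / 2) * majorant l K \<phi> b t x"
proof -
  have L: "L \<ge> 0" using c by (simp add: contracts_def)
  have i: "integrable lborel (\<lambda>s. e * L * char_majorant l K b t x s)"
    using c t unfolding contracts_def by (intro integrable_mult_right) blast
  have i': "integrable lborel (\<lambda>s. indicator (seg t) s * (e * L * majorant2 l K \<phi> b s (x - dir b * (t - s))))"
    using i by (simp only: mult_ac)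
  have eq: "duhamel U0 (source U) b t x - duhamel U0 (source V) b t x =
     vint (\<lambda>s. source U b s (x - dir b * (t - s)) - source V b s (x - dir b * (t - s))) t"
    unfolding duhamel_def
    by (subst vint_diff) (use source_integrable[OF c t m(1) C(1,3)] source_integrable[OF c t m(2) C(2,3)] in auto)
  have "norm (duhamel U0 (source U) b t x - duhamel U0 (source V) b t x) \<le> (LINT s|lborel. indicator (seg t) s * (e * L * majorant2 l K \<phi> b s (x - dir b * (t - s))))"
    unfolding eq
  proof (rule norm_vint_le[OF i'])
    fix s assume "s \<in> seg t"
    then have s: "\<bar>s\<bar> \<le> T" using seg_abs_le(1) t by fastforce
    define y where "y = x - dir b * (t - s)"
    have "norm (source U b s y - source V b s y) \<le> L * (norm (U b s y - V b s y) + norm (U (\<not> b) s y - V (\<not> b) s y))"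
      unfolding source_def using c s unfolding contracts_def by blast
    also have "\<dots> \<le> L * (e * majorant l K \<phi> b s y + e * majorant l K \<phi> (\<not> b) s y)"
      using L by (intro mult_left_mono add_mono e s)
    also have "\<dots> = e * L * (majorant2 l K \<phi> b s y)" by (simp add: algebra_simps)
    finally show "norm (source U b s (x - dir b * (t - s)) - source V b s (x - dir b * (t - s)))
      \<le> e * L * majorant2 l K \<phi> b s (x - dir b * (t - s))"
      by (simp only: y_def)
  qed
  also have "\<dots> = e * (L * integral\<^sup>L lborel (char_majorant l K b t x))"
    by (simp only: mult.assoc mult.left_commute[of "indicator _ _"] integral_mult_right_zero)
  also have "\<dots> \<le> e * (majorant l K \<phi> b t x / 2)"
    using c t e(2) unfolding contracts_def by (intro mult_left_mono) blast+
  finally show ?thesis by simp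
qed

lemma duhamel_0_le:
  assumes c: "contracts T L l K" and t: "\<bar>t\<bar> \<le> T"
  shows "norm (duhamel U0 (source (\<lambda>_ _ _. 0)) b t x) \<le> 2 * majorant l K \<phi> b t x"
proof -
  have i: "integrable lborel (\<lambda>s. L * char_majorant l K b t x s)"
    using c t unfolding contracts_def by (intro integrable_mult_right) blast
  have i': "integrable lborel (\<lambda>s. indicator (seg t) s * (L * majorant2 l K \<phi> b s (x - dir b * (t - s))))"
    using i by (simp only: mult_ac)
  have "norm (vint (\<lambda>s. source (\<lambda>_ _ _. 0) b s (x - dir b * (t - s))) t)
     \<le> (LINT s|lborel. indicator (seg t) s * (L * majorant2 l K \<phi> b s (x - dir b * (t - s))))"
  proof (rule norm_vint_le[OF i'])
    fix s assume "s \<in> seg t"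
    then have s: "\<bar>s\<bar> \<le> T" using seg_abs_le(1) t by fastforce
    show "norm (source (\<lambda>_ _ _. 0) b s (x - dir b * (t - s))) \<le> L * majorant2 l K \<phi> b s (x - dir b * (t - s))"
      using source_le[OF c s, where U="\<lambda>_ _ _. 0" and C=0 and b=b and x="x - dir b * (t - s)"] by simp
  qed
  also have "\<dots> = L * integral\<^sup>L lborel (char_majorant l K b t x)"
    by (simp only: mult.left_commute[of "indicator _ _"] integral_mult_right_zero)
  also have "\<dots> \<le> majorant l K \<phi> b t x / 2" using c t unfolding contracts_def by blast
  finally have 1: "norm (vint (\<lambda>s. source (\<lambda>_ _ _. 0) b s (x - dir b * (t - s))) t) \<le> majorant l K \<phi> b t x / 2" .
  have 2: "norm (U0 b (x - dir b * t)) \<le> majorant l K \<phi> b t x"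
    using data_le[of b "x - dir b * t"] majorant_ge(1)[OF c, of x b t] kernel_average_nonneg[of \<phi> x, OF phi_nonneg] by linarith
  show ?thesis
    unfolding duhamel_def using norm_triangle_ineq[of "U0 b (x - dir b * t)" "vint (\<lambda>s. source (\<lambda>_ _ _. 0) b s (x - dir b * (t - s))) t"]
      1 2 majorant_ge(2)[OF c, where b=b and t=t and x=x] by linarith
qed

lemma iterate_converges:
  assumes c: "contracts T L l K"
  shows "\<bar>t\<bar> \<le> T \<Longrightarrow> norm (iterate (Suc n) b t x - iterate n b t x) \<le> 2 * majorant l K \<phi> b t x * (1/2)^n"
    and "\<bar>t\<bar> \<le> T \<Longrightarrow> norm (iterate n b t x) \<le> 4 * majorant l K \<phi> b t x"
proof -
  have "(\<forall>b t x. \<bar>t\<bar> \<le> T \<longrightarrow> norm (iterate (Suc n) b t x - iterate n b t x) \<le> 2 * (1/2)^n * majorant l K \<phi> b t x) \<and>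
     (\<forall>b t x. \<bar>t\<bar> \<le> T \<longrightarrow> norm (iterate n b t x) \<le> (4 - 4 * (1/2)^n) * majorant l K \<phi> b t x)" for n
  proof (induction n)
    case 0
    show ?case using duhamel_0_le[OF c] by simp
  next
    case (Suc n)
    have B: "norm (iterate (Suc n) b t x) \<le> (4 - 4 * (1/2)^Suc n) * majorant l K \<phi> b t x" if t: "\<bar>t\<bar> \<le> T" for b t x
    proof -
      have "norm (iterate (Suc n) b t x) \<le> norm (iterate (Suc n) b t x - iterate n b t x) + norm (iterate n b t x)"
        using norm_triangle_ineq[of "iterate (Suc n) b t x - iterate n b t x" "iterate n b t x"] by simp
      also have "\<dots> \<le> 2 * (1/2)^n * majorant l K \<phi> b t x + (4 - 4 * (1/2)^n) * majorant l K \<phi> b t x"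
        using Suc t by (intro add_mono) blast+
      also have "\<dots> = (4 - 4 * (1/2)^Suc n) * majorant l K \<phi> b t x" by (simp add: algebra_simps)
      finally show ?thesis .
    qed
    have le4: "(4 - 4 * (1/2)^k) * majorant l K \<phi> b s y \<le> 4 * majorant l K \<phi> b s y" for k :: nat and b s y
      by (intro mult_right_mono majorant_ge(2)[OF c]) auto
    have D: "norm (duhamel U0 (source (iterate (Suc n))) b t x - duhamel U0 (source (iterate n)) b t x) \<le> (2 * (1/2)^n / 2) * majorant l K \<phi> b t x" if t: "\<bar>t\<bar> \<le> T" for b t x
    proof (rule duhamel_contracts[OF c t iterate_measurable iterate_measurable, where C=4])
      show "norm (iterate (Suc n) b s y) \<le> 4 * majorant l K \<phi> b s y" if "\<bar>s\<bar> \<le> T" for b s y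
        by (rule order_trans[OF B[OF that] le4])
      show "norm (iterate n b s y) \<le> 4 * majorant l K \<phi> b s y" if "\<bar>s\<bar> \<le> T" for b s y
        using Suc that order_trans[OF _ le4] by blast
      show "norm (iterate (Suc n) b s y - iterate n b s y) \<le> 2 * (1/2)^n * majorant l K \<phi> b s y" if "\<bar>s\<bar> \<le> T" for b s y
        using Suc that by blast
    qed auto
    have D': "norm (iterate (Suc (Suc n)) b t x - iterate (Suc n) b t x) \<le> 2 * (1/2)^Suc n * majorant l K \<phi> b t x" if t: "\<bar>t\<bar> \<le> T" for b t x
      using D[OF t, of b x] by (simp only: iterate.simps) simp
    show ?case using B D' by blast
  qed
  note I = this
  show "norm (iterate (Suc n) b t x - iterate n b t x) \<le> 2 * majorant l K \<phi> b t x * (1/2)^n" if "\<bar>t\<bar> \<le> T"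
    using I[of n] that by (simp only: mult_ac) 
  have "(4 - 4 * (1/2)^n) * majorant l K \<phi> b t x \<le> 4 * majorant l K \<phi> b t x"
    by (intro mult_right_mono majorant_ge(2)[OF c]) auto
  then show "norm (iterate n b t x) \<le> 4 * majorant l K \<phi> b t x" if "\<bar>t\<bar> \<le> T"
    using I[of n] that by (meson order_trans)
qed

definition solution :: "bool \<Rightarrow> real \<Rightarrow> real \<Rightarrow> complex" where
  "solution b t x = lim (\<lambda>n. iterate n b t x)"

lemma iterate_LIMSEQ: "(\<lambda>n. iterate n b t x) \<longlonglongrightarrow> solution b t x"
proof -
  obtain L l K where c: "contracts \<bar>t\<bar> L l K" using contracts_exists[of "\<bar>t\<bar>"] by auto
  show ?thesis unfolding solution_def
    by (rule geometric_limit(1)) (rule iterate_converges(1)[OF c order_refl])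
qed

lemma solution_measurable: "plane_measurable (solution b)"
  unfolding plane_measurable_def
  by (rule borel_measurable_LIMSEQ_metric[OF iterate_measurable[unfolded plane_measurable_def]]) (rule iterate_LIMSEQ)

lemma iterate_solution_dist:
  assumes c: "contracts T L l K" and t: "\<bar>t\<bar> \<le> T"
  shows "norm (iterate n b t x - solution b t x) \<le> (4 * (1/2)^n) * majorant l K \<phi> b t x"
  unfolding solution_def using geometric_limit(2)[of "\<lambda>n. iterate n b t x" "2 * majorant l K \<phi> b t x" n, OF iterate_converges(1)[OF c t]] by (simp add: mult_ac)

lemma solution_le_majorant:
  assumes c: "contracts T L l K" and t: "\<bar>t\<bar> \<le> T"
  shows "norm (solution b t x) \<le> 4 * majorant l K \<phi> b t x"
  using iterate_solution_dist[OF c t, where n=0 and b=b and x=x] by simp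

text \<open>Both sides are limits of the iterates, the right one because the Picard map contracts.\<close>

lemma solution_eq: "solution b t x = duhamel U0 (source solution) b t x"
proof -
  obtain L l K where c: "contracts \<bar>t\<bar> L l K" using contracts_exists[of "\<bar>t\<bar>"] by auto
  have d: "norm (iterate (Suc n) b t x - duhamel U0 (source solution) b t x) \<le> (4 * (1/2)^n / 2) * majorant l K \<phi> b t x" for n
    unfolding iterate.simps
    by (rule duhamel_contracts[OF c order_refl iterate_measurable solution_measurable, where C=4])
       (auto intro: iterate_converges(2)[OF c] solution_le_majorant[OF c] iterate_solution_dist[OF c])
  have "(\<lambda>n. (4 * (1/2)^n / 2) * majorant l K \<phi> b t x) \<longlonglongrightarrow> (4 * 0 / 2) * majorant l K \<phi> b t x"
    by (intro tendsto_intros LIMSEQ_power_zero) auto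
  then have "(\<lambda>n. (4 * (1/2)^n / 2) * majorant l K \<phi> b t x) \<longlonglongrightarrow> 0" by simp
  then have "(\<lambda>n. iterate (Suc n) b t x - duhamel U0 (source solution) b t x) \<longlonglongrightarrow> 0"
    by (rule Lim_null_comparison[rotated]) (use d in auto)
  then have "(\<lambda>n. iterate (Suc n) b t x) \<longlonglongrightarrow> duhamel U0 (source solution) b t x" by (simp add: LIM_zero_iff)
  moreover have "(\<lambda>n. iterate (Suc n) b t x) \<longlonglongrightarrow> solution b t x" by (rule LIMSEQ_Suc[OF iterate_LIMSEQ])
  ultimately show ?thesis using LIMSEQ_unique by blast
qed

lemma solution_bound:
  "\<exists>C\<ge>0. \<forall>b t x. \<bar>t\<bar> \<le> T \<longrightarrow> norm (solution b t x) \<le> C * (\<phi> (x - dir b * t) + kernel_average \<phi> x)"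
proof (cases "T \<ge> 0")
  case True
  obtain L l K where c: "contracts T L l K" using contracts_exists[OF True] by auto
  then have l: "l > 0" "K \<ge> 1" by (auto simp: contracts_def)
  have k: "kernel_average \<phi> x \<ge> 0" for x by (rule kernel_average_nonneg[OF phi_nonneg])
  show ?thesis
  proof (intro exI[of _ "4 * (exp (l * T) * K)"] conjI allI impI)
    fix b t x assume t: "\<bar>t\<bar> \<le> T"
    have "majorant l K \<phi> b t x \<le> exp (l * T) * (K * (\<phi> (x - dir b * t) + kernel_average \<phi> x))"
      unfolding majorant_def distrib_left[of K] using t l k[of x] phi_nonneg[of "x - dir b * t"]
        mult_right_mono[OF l(2) phi_nonneg[of "x - dir b * t"]]
      by (intro mult_mono add_mono) auto
    then show "norm (solution b t x) \<le> 4 * (exp (l * T) * K) * (\<phi> (x - dir b * t) + kernel_average \<phi> x)"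
      using solution_le_majorant[OF c t, where b=b and x=x] by simp
  qed (use l in auto)
next
  case False
  then show ?thesis by (intro exI[of _ 0]) auto
qed

end

section \<open>Antiderivatives along characteristics\<close>

lemma prim_translate: "prim (\<lambda>y. g (y + a)) x = prim g (x + a)"
proof -
  have "prim g (x + a) = (LINT y|lborel. indicator {..x + a} (a + 1 * y) *\<^sub>R g (a + 1 * y))"
    unfolding prim_def by (subst lborel_integral_real_affine[of 1 _ a]) auto
  also have "\<dots> = prim (\<lambda>y. g (y + a)) x"
    unfolding prim_def by (intro Bochner_Integration.integral_cong) (auto simp: indicator_def add.commute)
  finally show ?thesis by simp
qed

lemma prim_scaleR: "prim (\<lambda>y. r *\<^sub>R g y) x = r *\<^sub>R prim g x"
  unfolding prim_def scaleR_left_commute[of _ r] by (rule integral_scaleR_right)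

text \<open>Fubini's theorem for a spatial integral of a time integral along characteristics. The spatial
  half-line moves with the characteristic.\<close>

lemma prim_vint_swap:
  assumes N: "plane_measurable N" and i: "\<And>s. s \<in> seg t \<Longrightarrow> integrable lborel (N s)"
    and A: "\<And>s. s \<in> seg t \<Longrightarrow> (LINT y|lborel. norm (N s y)) \<le> A"
  shows "prim (\<lambda>y. vint (\<lambda>s. N s (y - c * (t - s))) t) x = vint (\<lambda>s. prim (N s) (x - c * (t - s))) t"
    "integrable lborel (\<lambda>s. indicator (seg t) s *\<^sub>R prim (N s) (x - c * (t - s)))"
    "integrable lborel (\<lambda>y. vint (\<lambda>s. N s (y - c * (t - s))) t)"
proof -
  have [measurable]: "(\<lambda>q::real \<times> real. N (fst q) (snd q - c * (t - fst q))) \<in> borel_measurable (lborel \<Otimes>\<^sub>M lborel)"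
    by (rule plane_measurable_compose[OF N]) measurable
  have [measurable]: "(\<lambda>y. N s (y - c * (t - s))) \<in> borel_measurable borel" for s
    by (rule plane_measurable_compose[OF N]) measurable
  define F where "F = (\<lambda>X (s, y). indicator (seg t) s *\<^sub>R (indicator X y *\<^sub>R N s (y - c * (t - s))))"
  have tr: "integrable lborel (\<lambda>y. N s (y - c * (t - s)))" "(LINT y|lborel. norm (N s (y - c * (t - s)))) = (LINT y|lborel. norm (N s y))"
    if "s \<in> seg t" for s
    using integrable_translate[OF i[OF that], of "- (c * (t - s))"] integrable_translate[OF integrable_norm[OF i[OF that]], of "- (c * (t - s))"] by simp_all
  have Fi: "integrable (lborel \<Otimes>\<^sub>M lborel) (F X)" if X[measurable]: "X \<in> sets borel" for X
  proof (rule lborel_pair.Fubini_integrable)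
    have "F X = (\<lambda>q. indicator (seg t) (fst q) *\<^sub>R (indicator X (snd q) *\<^sub>R N (fst q) (snd q - c * (t - fst q))))"
      by (auto simp: F_def)
    then show Fm[measurable]: "F X \<in> borel_measurable (lborel \<Otimes>\<^sub>M lborel)" by simp
    have "integrable lborel (\<lambda>s. indicator (seg t) s *\<^sub>R \<bar>A\<bar>)"
      by (intro integrable_scaleR_left integrable_real_indicator) auto
    then show "integrable lborel (\<lambda>s. LINT y|lborel. norm (F X (s, y)))"
    proof (rule Bochner_Integration.integrable_bound)
      show "(\<lambda>s. LINT y|lborel. norm (F X (s, y))) \<in> borel_measurable lborel" by measurable
      show "AE s in lborel. norm (LINT y|lborel. norm (F X (s, y))) \<le> norm (indicator (seg t) s *\<^sub>R \<bar>A\<bar>)"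
      proof (rule AE_I2)
        fix s
        show "norm (LINT y|lborel. norm (F X (s, y))) \<le> norm (indicator (seg t) s *\<^sub>R \<bar>A\<bar>)"
        proof (cases "s \<in> seg t")
          case True
          have "(LINT y|lborel. norm (F X (s, y))) \<le> (LINT y|lborel. norm (N s (y - c * (t - s))))"
            by (rule integral_mono') (use tr(1)[OF True] in \<open>auto simp: F_def indicator_def\<close>)
          also have "\<dots> \<le> A" using tr(2)[OF True] A[OF True] by simp
          finally have "(LINT y|lborel. norm (F X (s, y))) \<le> \<bar>A\<bar>" by simp
          moreover have "(LINT y|lborel. norm (F X (s, y))) \<ge> 0" by (intro integral_nonneg_AE) auto
          ultimately show ?thesis using True by simp
        next
          case False
          then show ?thesis by (simp add: F_def)
        qed
      qed
    qed
    show "AE s in lborel. integrable lborel (\<lambda>y. F X (s, y))"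
    proof (rule AE_I2)
      fix s show "integrable lborel (\<lambda>y. F X (s, y))"
        using tr(1)[of s] by (cases "s \<in> seg t") (auto simp: F_def intro!: integrable_indicator_times X)
    qed
  qed
  note Fx = Fi[of "{..x}", simplified]
  have pN: "(LINT y|lborel. F {..x} (s, y)) = indicator (seg t) s *\<^sub>R prim (N s) (x - c * (t - s))" for s
  proof -
    have "(LINT y|lborel. F {..x} (s, y)) = indicator (seg t) s *\<^sub>R prim (\<lambda>y. N s (y + - (c * (t - s)))) x"
      by (simp only: F_def prim_def prod.case integral_scaleR_right diff_conv_add_uminus)
    then show ?thesis unfolding prim_translate by simp
  qed
  have pV: "(LINT s|lborel. F X (s, y)) = indicator X y *\<^sub>R (LINT s|lborel. indicator (seg t) s *\<^sub>R N s (y - c * (t - s)))" for y X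
    unfolding F_def prod.case by (simp only: scaleR_left_commute[of "indicator (seg t) _"] integral_scaleR_right)
  have "(LINT y|lborel. LINT s|lborel. F {..x} (s, y)) = (LINT s|lborel. LINT y|lborel. F {..x} (s, y))"
    using lborel_pair.Fubini_integral[of "\<lambda>s y. F {..x} (s, y)"] Fx by (simp add: case_prod_beta')
  then have "(LINT y|lborel. indicator {..x} y *\<^sub>R (LINT s|lborel. indicator (seg t) s *\<^sub>R N s (y - c * (t - s))))
       = (LINT s|lborel. indicator (seg t) s *\<^sub>R prim (N s) (x - c * (t - s)))" unfolding pN pV .
  then have sw: "prim (\<lambda>y. LINT s|lborel. indicator (seg t) s *\<^sub>R N s (y - c * (t - s))) x
       = (LINT s|lborel. indicator (seg t) s *\<^sub>R prim (N s) (x - c * (t - s)))" by (subst prim_def)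
  show "prim (\<lambda>y. vint (\<lambda>s. N s (y - c * (t - s))) t) x = vint (\<lambda>s. prim (N s) (x - c * (t - s))) t"
    unfolding vint_def prim_scaleR sw ..
  show "integrable lborel (\<lambda>s. indicator (seg t) s *\<^sub>R prim (N s) (x - c * (t - s)))"
    using lborel_pair.integrable_fst'[OF Fx] unfolding pN .
  have "integrable lborel (\<lambda>y. LINT s|lborel. F UNIV (s, y))"
    using lborel_pair.integrable_snd[of "\<lambda>s y. F UNIV (s, y)"] Fi[of UNIV] by (simp add: case_prod_beta')
  then show "integrable lborel (\<lambda>y. vint (\<lambda>s. N s (y - c * (t - s))) t)"
    unfolding pV vint_def by (intro integrable_scaleR_right) simp
qed

lemma seg_integral_exp_const:
  assumes "l > 0"
  shows "integrable lborel (\<lambda>s. indicator (seg t) s * (a * exp (l * \<bar>s\<bar>)))"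
    "a \<ge> 0 \<Longrightarrow> (LINT s|lborel. indicator (seg t) s * (a * exp (l * \<bar>s\<bar>))) \<le> a / l * exp (l * \<bar>t\<bar>)"
proof -
  have "integrable lborel (\<lambda>s. a * (indicator (seg t) s * exp (l * \<bar>s\<bar>)))"
    by (intro integrable_mult_right seg_integral_exp assms)
  then show "integrable lborel (\<lambda>s. indicator (seg t) s * (a * exp (l * \<bar>s\<bar>)))" by (simp only: mult_ac)
  assume "a \<ge> 0"
  then have "a * (LINT s|lborel. indicator (seg t) s * exp (l * \<bar>s\<bar>)) \<le> a * (exp (l * \<bar>t\<bar>) / l)"
    by (intro mult_left_mono seg_integral_exp assms)
  then show "(LINT s|lborel. indicator (seg t) s * (a * exp (l * \<bar>s\<bar>))) \<le> a / l * exp (l * \<bar>t\<bar>)"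
    by (simp only: mult.left_commute[of "indicator _ _"] integral_mult_right_zero) simp
qed

text \<open>Gronwall's inequality in a form that involves no measurability of suprema: a bound that can
  always be halved is zero.\<close>

lemma exp_contraction_imp_0:
  fixes d :: "bool \<Rightarrow> real \<Rightarrow> real \<Rightarrow> real"
  assumes B: "\<And>b t x. \<bar>t\<bar> \<le> T \<Longrightarrow> d b t x \<le> B" and B0: "B \<ge> 0" and l: "l \<ge> 0"
    and step: "\<And>S. S \<ge> 0 \<Longrightarrow> (\<And>b t x. \<bar>t\<bar> \<le> T \<Longrightarrow> d b t x \<le> S * exp (l * \<bar>t\<bar>)) \<Longrightarrow>
       (\<And>b t x. \<bar>t\<bar> \<le> T \<Longrightarrow> d b t x \<le> S / 2 * exp (l * \<bar>t\<bar>))"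
  shows "\<bar>t\<bar> \<le> T \<Longrightarrow> d b t x \<le> 0"
proof -
  have I: "\<forall>b t x. \<bar>t\<bar> \<le> T \<longrightarrow> d b t x \<le> (B / 2^n) * exp (l * \<bar>t\<bar>)" for n
  proof (induction n)
    case 0
    have "B * 1 \<le> B * exp (l * \<bar>t\<bar>)" for t using B0 l by (intro mult_left_mono) auto
    then show ?case using order_trans[OF B] by simp
  next
    case (Suc n)
    have "d b t x \<le> (B / 2^n) / 2 * exp (l * \<bar>t\<bar>)" if "\<bar>t\<bar> \<le> T" for b t x
      by (rule step[OF _ _ that]) (use Suc B0 in auto)
    then show ?case by (simp add: mult.commute)
  qed
  assume t: "\<bar>t\<bar> \<le> T"
  have "(\<lambda>n. (B * (1/2)^n) * exp (l * \<bar>t\<bar>)) \<longlonglongrightarrow> (B * 0) * exp (l * \<bar>t\<bar>)"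
    by (intro tendsto_intros LIMSEQ_power_zero) auto
  moreover have "d b t x \<le> (B * (1/2)^n) * exp (l * \<bar>t\<bar>)" for n
    using I[of n, rule_format, OF t, of b x] by (simp add: power_one_over)
  ultimately show "d b t x \<le> 0" using LIMSEQ_le_const by fastforce
qed

lemma duhamel_difference_vanishes:
  fixes d :: "bool \<Rightarrow> real \<Rightarrow> real \<Rightarrow> complex"
  assumes B: "\<And>b t x. \<bar>t\<bar> \<le> T \<Longrightarrow> norm (d b t x) \<le> B" and B0: "B \<ge> 0" and L: "L \<ge> 0"
    and eq: "\<And>b t x. \<bar>t\<bar> \<le> T \<Longrightarrow> d b t x = vint (\<lambda>s. G b s (x - dir b * (t - s))) t"
    and step: "\<And>b s x q. \<bar>s\<bar> \<le> T \<Longrightarrow> q \<ge> 0 \<Longrightarrow> (\<And>b x. norm (d b s x) \<le> q) \<Longrightarrow> norm (G b s x) \<le> L * q"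
  shows "\<bar>t\<bar> \<le> T \<Longrightarrow> d b t x = 0"
proof -
  define l where "l = 2 * L + 1"
  have l: "l > 0" using L by (simp add: l_def)
  have "norm (d b t x) \<le> 0" if "\<bar>t\<bar> \<le> T" for b t x
  proof (rule exp_contraction_imp_0[where d="\<lambda>b t x. norm (d b t x)", OF B B0 less_imp_le[OF l] _ that])
    fix S b t x assume S: "S \<ge> (0::real)" and IH: "\<And>b t x. \<bar>t\<bar> \<le> T \<Longrightarrow> norm (d b t x) \<le> S * exp (l * \<bar>t\<bar>)" and t: "\<bar>t\<bar> \<le> T"
    have "norm (d b t x) \<le> (LINT s|lborel. indicator (seg t) s * (L * S * exp (l * \<bar>s\<bar>)))"
      unfolding eq[OF t]
    proof (rule norm_vint_le[OF seg_integral_exp_const(1)[OF l]])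
      fix s assume "s \<in> seg t"
      then have s: "\<bar>s\<bar> \<le> T" using seg_abs_le(1) t by fastforce
      show "norm (G b s (x - dir b * (t - s))) \<le> L * S * exp (l * \<bar>s\<bar>)"
        using step[OF s, of "S * exp (l * \<bar>s\<bar>)" b "x - dir b * (t - s)"] IH[OF s] S by (simp add: mult.assoc)
    qed
    also have "\<dots> \<le> L * S / l * exp (l * \<bar>t\<bar>)" using L S by (intro seg_integral_exp_const(2)[OF l]) auto
    also have "\<dots> \<le> S / 2 * exp (l * \<bar>t\<bar>)"
    proof (rule mult_right_mono)
      show "L * S / l \<le> S / 2" using S l by (simp add: l_def field_simps)
    qed simp
    finally show "norm (d b t x) \<le> S / 2 * exp (l * \<bar>t\<bar>)" .
  qed
  then show "\<bar>t\<bar> \<le> T \<Longrightarrow> d b t x = 0" by simp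
qed

text \<open>The difference \<open>e\<close> between \<open>U\<close> and the antiderivative of \<open>P\<close> satisfies a homogeneous
  inequality. Here \<open>M\<close> and \<open>M'\<close> are the right-hand sides \<open>N\<close> and \<open>N'\<close> evaluated at the antiderivative
  in place of \<open>U\<close>, for which the chain rule \<open>M = prim M'\<close> is known. The same lemma serves
  for the first derivative of the nonlinear equation and for that of the linearised one.\<close>

lemma antiderivative_propagates:
  fixes U P :: "bool \<Rightarrow> real \<Rightarrow> real \<Rightarrow> complex" and \<kappa> :: "bool \<Rightarrow> real \<Rightarrow> real \<Rightarrow> real"
  defines "e \<equiv> (\<lambda>b t x. U b t x - prim (P b t) x)"
  assumes U: "\<And>b t x. \<bar>t\<bar> \<le> T \<Longrightarrow> U b t x = duhamel U0 N b t x"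
    and P: "\<And>b t x. \<bar>t\<bar> \<le> T \<Longrightarrow> P b t x = duhamel P0 N' b t x"
    and data: "\<And>b. integrable lborel (P0 b)" "\<And>b. U0 b = prim (P0 b)"
    and Pint: "\<And>b t. \<bar>t\<bar> \<le> T \<Longrightarrow> integrable lborel (P b t)"
    and Nint: "\<And>b t x. \<bar>t\<bar> \<le> T \<Longrightarrow> integrable lborel (\<lambda>s. indicator (seg t) s *\<^sub>R N b s (x - dir b * (t - s)))"
    and N'm: "\<And>b. plane_measurable (N' b)" and N'int: "\<And>b t. \<bar>t\<bar> \<le> T \<Longrightarrow> integrable lborel (N' b t)"
    and N'A: "\<And>b t. \<bar>t\<bar> \<le> T \<Longrightarrow> (LINT y|lborel. norm (N' b t y)) \<le> A"
    and Mint: "\<And>b t. \<bar>t\<bar> \<le> T \<Longrightarrow> integrable lborel (M' b t)" and M: "\<And>b t x. \<bar>t\<bar> \<le> T \<Longrightarrow> M b t x = prim (M' b t) x"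
    and L: "L \<ge> 0" and B: "\<And>b t x. \<bar>t\<bar> \<le> T \<Longrightarrow> norm (e b t x) \<le> B" "B \<ge> 0"
    and close: "\<And>b t x. \<bar>t\<bar> \<le> T \<Longrightarrow> norm (N b t x - M b t x) \<le> L * (norm (e b t x) + norm (e (\<not> b) t x))"
    and close': "\<And>b t x. \<bar>t\<bar> \<le> T \<Longrightarrow> norm (N' b t x - M' b t x) \<le> \<kappa> b t x * (norm (e b t x) + norm (e (\<not> b) t x))"
    and \<kappa>: "\<And>b t. \<bar>t\<bar> \<le> T \<Longrightarrow> integrable lborel (\<kappa> b t)" "\<And>b t. \<bar>t\<bar> \<le> T \<Longrightarrow> integral\<^sup>L lborel (\<kappa> b t) \<le> L" "\<And>b t x. \<kappa> b t x \<ge> 0"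
    and t: "\<bar>t\<bar> \<le> T"
  shows "U b t x = prim (P b t) x"
proof -
  have "e b t x = 0"
  proof (rule duhamel_difference_vanishes[where T=T and G="\<lambda>b s x. N b s x - prim (N' b s) x" and L="4 * L" and d=e, OF B _ _ _ t])
    fix b t x assume t: "\<bar>t\<bar> \<le> T"
    have s: "\<bar>s\<bar> \<le> T" if "s \<in> seg t" for s using seg_abs_le(1)[OF that] t by linarith
    note F = prim_vint_swap[OF N'm[of b], where c="dir b" and A=A and t=t, OF N'int[OF s] N'A[OF s]]
    have i0: "integrable lborel (\<lambda>y. P0 b (y - dir b * t))"
      using integrable_translate(1)[OF data(1)[of b], of "- (dir b * t)"] by simp
    have p0: "prim (\<lambda>y. P0 b (y - dir b * t)) x = prim (P0 b) (x - dir b * t)"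
      using prim_translate[of "P0 b" "- (dir b * t)" x] by simp
    have "P b t = (\<lambda>y. P0 b (y - dir b * t) + vint (\<lambda>s. N' b s (y - dir b * (t - s))) t)"
      using P[OF t] by (auto simp: duhamel_def)
    then have "prim (P b t) x = prim (\<lambda>y. P0 b (y - dir b * t) + vint (\<lambda>s. N' b s (y - dir b * (t - s))) t) x" by simp
    also have "\<dots> = U0 b (x - dir b * t) + vint (\<lambda>s. prim (N' b s) (x - dir b * (t - s))) t"
      by (simp only: prim_add[OF i0 F(3)] F(1) p0 data(2))
    finally have "e b t x = vint (\<lambda>s. N b s (x - dir b * (t - s))) t - vint (\<lambda>s. prim (N' b s) (x - dir b * (t - s))) t"
      using U[OF t, of b x] by (simp add: e_def duhamel_def)
    also have "\<dots> = vint (\<lambda>s. N b s (x - dir b * (t - s)) - prim (N' b s) (x - dir b * (t - s))) t"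
      by (rule vint_diff[symmetric, OF Nint[OF t] F(2)])
    finally show "e b t x = vint (\<lambda>s. N b s (x - dir b * (t - s)) - prim (N' b s) (x - dir b * (t - s))) t" .
  next
    fix b s x q assume s: "\<bar>s\<bar> \<le> T" and q: "(q::real) \<ge> 0" "\<And>b x. norm (e b s x) \<le> q"
    have 1: "norm (N b s x - M b s x) \<le> L * (2 * q)"
      using close[OF s, of b x] q(2)[of b x] q(2)[of "\<not> b" x] L by (smt (verit) mult_left_mono)
    have "prim (N' b s) x - M b s x = prim (\<lambda>y. N' b s y - M' b s y) x"
      using prim_diff[OF N'int[OF s] Mint[OF s]] M[OF s] by simp
    then have "norm (prim (N' b s) x - M b s x) \<le> (LINT y|lborel. norm (N' b s y - M' b s y))"
      using norm_prim_le[OF Bochner_Integration.integrable_diff[OF N'int[OF s] Mint[OF s]]] by simp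
    also have "\<dots> \<le> (LINT y|lborel. \<kappa> b s y * (2 * q))"
    proof (rule integral_mono)
      show "integrable lborel (\<lambda>y. norm (N' b s y - M' b s y))" using N'int[OF s] Mint[OF s] by auto
      show "integrable lborel (\<lambda>y. \<kappa> b s y * (2 * q))" using \<kappa>(1)[OF s] by simp
      fix y
      show "norm (N' b s y - M' b s y) \<le> \<kappa> b s y * (2 * q)"
        using close'[OF s, of b y] q(2)[of b y] q(2)[of "\<not> b" y] \<kappa>(3)[of b s y] by (smt (verit) mult_left_mono)
    qed
    also have "\<dots> = integral\<^sup>L lborel (\<kappa> b s) * (2 * q)" by (rule integral_mult_left_zero)
    also have "\<dots> \<le> L * (2 * q)" using \<kappa>(2)[OF s] q by (intro mult_right_mono) auto
    finally have 2: "norm (prim (N' b s) x - M b s x) \<le> L * (2 * q)" .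
    have "norm (N b s x - prim (N' b s) x) \<le> norm (N b s x - M b s x) + norm (prim (N' b s) x - M b s x)"
      using norm_triangle_ineq4[of "N b s x - M b s x" "prim (N' b s) x - M b s x"] by simp
    then show "norm (N b s x - prim (N' b s) x) \<le> 4 * L * q" using 1 2 by linarith
  qed (use L in auto)
  then show ?thesis by (simp add: e_def)
qed

section \<open>Calculus of oriented time integrals\<close>

lemma seg_integrable_imp_set_integrable:
  fixes g :: "real \<Rightarrow> complex"
  assumes "\<And>t. integrable lborel (\<lambda>s. indicator (seg t) s *\<^sub>R g s)"
  shows "set_integrable lborel {a..b} g"
proof -
  define m where "m = max \<bar>a\<bar> \<bar>b\<bar>"
  have "set_integrable lborel (seg m \<union> seg (- m)) g"
    by (rule set_integrable_Un) (use assms in \<open>auto simp: set_integrable_def\<close>)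
  then show ?thesis
    by (rule set_integrable_subset) (auto simp: m_def)
qed

lemma vint_eq_integral:
  fixes g :: "real \<Rightarrow> complex"
  assumes g: "\<And>a b. set_integrable lborel {a..b} g" and "a \<le> 0" "a \<le> t"
  shows "vint g t = integral {a..t} g - integral {a..0} g"
proof -
  have io: "g integrable_on {a..b}" for a b using set_borel_integral_eq_integral(1)[OF g] .
  have e: "(LINT s|lborel. indicator {a..b} s *\<^sub>R g s) = integral {a..b} g" for a b
    using set_borel_integral_eq_integral(2)[OF g] by (simp add: set_lebesgue_integral_def)
  show ?thesis
  proof (cases "t \<ge> 0")
    case True
    then have "integral {a..0} g + integral {0..t} g = integral {a..t} g"
      using assms by (intro Henstock_Kurzweil_Integration.integral_combine io) auto
    moreover have "vint g t = integral {0..t} g"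
      using True by (cases "t = 0") (auto simp: vint_def e)
    ultimately show ?thesis by (simp add: algebra_simps)
  next
    case False
    then have "integral {a..t} g + integral {t..0} g = integral {a..0} g"
      using assms by (intro Henstock_Kurzweil_Integration.integral_combine io) auto
    moreover have "vint g t = - integral {t..0} g" using False by (auto simp: vint_def e)
    ultimately show ?thesis by (simp add: algebra_simps)
  qed
qed

lemma vint_isCont:
  fixes g :: "real \<Rightarrow> complex"
  assumes g: "\<And>a b. set_integrable lborel {a..b} g"
  shows "isCont (vint g) t"
proof -
  define a where "a = min 0 t - 1"
  have "continuous_on {a..t + 1} (\<lambda>u. integral {a..u} g - integral {a..0} g)"
    by (intro continuous_intros indefinite_integral_continuous_1 set_borel_integral_eq_integral(1)[OF g])
  then have "continuous_on {a..t + 1} (vint g)"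
    by (rule continuous_on_eq) (use vint_eq_integral[OF g, of a] in \<open>auto simp: a_def\<close>)
  then have "continuous_on {a<..<t + 1} (vint g)" by (rule continuous_on_subset) auto
  then show ?thesis by (rule continuous_on_interior) (auto simp: a_def)
qed

lemma vint_has_vector_derivative:
  fixes g :: "real \<Rightarrow> complex"
  assumes g: "continuous_on UNIV g"
  shows "(vint g has_vector_derivative g t) (at t)"
proof -
  define a where "a = min 0 t - 1"
  have loc: "set_integrable lborel {a..b} g" for a b by (rule continuous_imp_set_integrable[OF g])
  have "((\<lambda>u. integral {a..u} g - integral {a..0} g) has_vector_derivative g t - 0) (at t within {a..t + 1})"
    by (intro has_vector_derivative_diff integral_has_vector_derivative continuous_on_subset[OF g] has_vector_derivative_const) (auto simp: a_def)
  then have "(vint g has_vector_derivative g t - 0) (at t within {a..t + 1})"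
    by (rule has_vector_derivative_transform[rotated 2]) (use vint_eq_integral[OF loc, of a] in \<open>auto simp: a_def\<close>)
  moreover have "at t within {a..t + 1} = at t" by (rule at_within_interior) (auto simp: a_def)
  ultimately show ?thesis by simp
qed

lemma vint_FTC:
  fixes y g :: "real \<Rightarrow> complex"
  assumes y: "\<And>t. (y has_vector_derivative g t) (at t)" and g: "continuous_on UNIV g"
  shows "y t = y 0 + vint g t"
proof -
  define a where "a = min 0 t"
  have loc: "set_integrable lborel {a..b} g" for a b by (rule continuous_imp_set_integrable[OF g])
  have *: "integral {a..b} g = y b - y a" if "a \<le> b" for b
    by (intro integral_unique fundamental_theorem_of_calculus that) (auto intro: y has_vector_derivative_at_within)
  show ?thesis using vint_eq_integral[OF loc, of a t] *[of t] *[of 0] by (simp add: a_def)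
qed

lemma vint_reflect: "vint (\<lambda>s. g (- s)) (- t) = - vint g t"
proof -
  have "(LINT s|lborel. indicator (seg t) s *\<^sub>R g s) = (LINT s|lborel. indicator (seg t) (0 + -1 * s) *\<^sub>R g (0 + -1 * s))"
    by (subst lborel_integral_real_affine[of "-1" _ 0]) auto
  also have "\<dots> = (LINT s|lborel. indicator (seg (- t)) s *\<^sub>R g (- s))"
    by (intro Bochner_Integration.integral_cong) (auto simp: indicator_def)
  finally show ?thesis by (simp add: vint_def)
qed

lemma integral_point_0:
  fixes g :: "real \<Rightarrow> 'a::{banach, second_countable_topology}"
  shows "(LINT r|lborel. indicator {a..a} r *\<^sub>R g r) = 0"
proof -
  have "(\<lambda>r. indicator {a..a} r *\<^sub>R g r) = (\<lambda>r. indicator {a} r *\<^sub>R g a)" by (auto simp: fun_eq_iff indicator_def)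
  then show ?thesis by simp
qed

lemma prim_vint:
  assumes "0 \<le> s" "s \<le> t"
  shows "prim (\<lambda>s. indicator {0..t} s *\<^sub>R g s) s = vint g s"
proof -
  have "prim (\<lambda>s. indicator {0..t} s *\<^sub>R g s) s = (LINT r|lborel. indicator {0..s} r *\<^sub>R g r)"
    unfolding prim_def by (intro Bochner_Integration.integral_cong) (use assms in \<open>auto simp: indicator_def\<close>)
  also have "\<dots> = vint g s"
  proof (cases "s = 0")
    case True
    show ?thesis using integral_point_0[of 0 g] True by (simp add: vint_def)
  qed (use assms in \<open>auto simp: vint_def\<close>)
  finally show ?thesis .
qed

text \<open>The fundamental theorem for \<open>\<bar>y\<bar>\<^sup>2\<close> where \<open>y = a + \<integral> g\<close> is only absolutely continuous. It
  comes from \<open>prim_mult\<close>, with negative times handled by reflection.\<close>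

lemma norm_sq_vint_le:
  fixes g :: "real \<Rightarrow> complex"
  assumes g: "integrable lborel (\<lambda>s. indicator (seg t) s *\<^sub>R g s)"
    and h: "integrable lborel (\<lambda>s. indicator (seg t) s * h s)"
    and le: "\<And>s. s \<in> seg t \<Longrightarrow> \<bar>2 * Re (cnj (a + vint g s) * g s)\<bar> \<le> h s"
  shows "(norm (a + vint g t))\<^sup>2 \<le> (norm a)\<^sup>2 + (LINT s|lborel. indicator (seg t) s * h s)"
proof -
  have pos: "(norm (a + vint g t))\<^sup>2 = (norm a)\<^sup>2 + vint (\<lambda>s. 2 * Re (cnj (a + vint g s) * g s)) t"
    if t: "t \<ge> 0" and g: "integrable lborel (\<lambda>s. indicator (seg t) s *\<^sub>R g s)" for a t and g :: "real \<Rightarrow> complex"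
  proof -
    define G where "G = (\<lambda>s. indicator {0..t} s *\<^sub>R g s)"
    have G: "integrable lborel G" unfolding G_def using g t by simp
    have cG: "integrable lborel (\<lambda>s. cnj (G s))" using G by simp
    have v: "prim G s = vint g s" if "0 \<le> s" "s \<le> t" for s unfolding G_def by (rule prim_vint[OF that])
    have "prim (\<lambda>s. cnj (G s)) = (\<lambda>s. cnj (prim G s))" by (auto simp: prim_cnj)
    note pc = this
    have iG: "integrable lborel (\<lambda>s. G s * cnj (prim G s) + prim G s * cnj (G s))"
      using integrable_mult_prim[OF G cG] integrable_mult_prim[OF cG G] unfolding pc by (intro Bochner_Integration.integrable_add) auto
    have "vint g t * cnj (vint g t) = prim G t * prim (\<lambda>s. cnj (G s)) t" using v[of t] t by (simp add: prim_cnj)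
    also have "\<dots> = prim (\<lambda>s. G s * prim (\<lambda>s. cnj (G s)) s + prim G s * cnj (G s)) t"
      by (rule prim_mult[OF G cG])
    also have "\<dots> = prim (\<lambda>s. G s * cnj (prim G s) + prim G s * cnj (G s)) t"
      by (simp only: pc)
    finally have 1: "vint g t * cnj (vint g t) = prim (\<lambda>s. G s * cnj (prim G s) + prim G s * cnj (G s)) t" .
    have "(a + vint g t) * cnj (a + vint g t) = a * cnj a + (cnj a * prim G t + a * prim (\<lambda>s. cnj (G s)) t + prim (\<lambda>s. G s * cnj (prim G s) + prim G s * cnj (G s)) t)"
      using 1 v[of t] t by (simp add: prim_cnj algebra_simps)
    also have "cnj a * prim G t + a * prim (\<lambda>s. cnj (G s)) t + prim (\<lambda>s. G s * cnj (prim G s) + prim G s * cnj (G s)) t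
       = prim (\<lambda>s. cnj a * G s + a * cnj (G s) + (G s * cnj (prim G s) + prim G s * cnj (G s))) t"
      using G cG iG by (simp add: prim_add prim_cmult)
    also have "\<dots> = (LINT s|lborel. of_real (indicator (seg t) s *\<^sub>R (2 * Re (cnj (a + vint g s) * g s))))"
      unfolding prim_def[of _ t]
    proof (intro Bochner_Integration.integral_cong refl)
      fix s
      have *: "cnj a * z + a * cnj z + (z * cnj w + w * cnj z) = of_real (2 * Re (cnj (a + w) * z))" for z w
        by (simp add: complex_eq_iff algebra_simps)
      show "indicat_real {..t} s *\<^sub>R (cnj a * G s + a * cnj (G s) + (G s * cnj (prim G s) + prim G s * cnj (G s))) = of_real (indicator (seg t) s *\<^sub>R (2 * Re (cnj (a + vint g s) * g s)))"
        using t v[of s] by (cases "0 \<le> s \<and> s \<le> t") (auto simp: * G_def indicator_def)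
    qed
    also have "\<dots> = of_real (vint (\<lambda>s. 2 * Re (cnj (a + vint g s) * g s)) t)"
    proof (cases "t = 0")
      case True
      have "(LINT s|lborel. complex_of_real (indicator {0..0} s *\<^sub>R r s)) = 0" for r :: "real \<Rightarrow> real"
        unfolding integral_complex_of_real integral_point_0 by simp
      then have "(LINT s|lborel. complex_of_real (indicator (seg t) s *\<^sub>R r s)) = 0" for r :: "real \<Rightarrow> real"
        unfolding True min.idem max.idem .
      moreover have "vint r t = 0" for r :: "real \<Rightarrow> real" using True by (simp add: vint_def)
      ultimately show ?thesis by (simp only: of_real_0)
    next
      case False
      then show ?thesis using t unfolding vint_def integral_complex_of_real by simp
    qed
    finally have "complex_of_real ((norm (a + vint g t))\<^sup>2) = of_real ((norm a)\<^sup>2 + vint (\<lambda>s. 2 * Re (cnj (a + vint g s) * g s)) t)"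
      by (simp only: complex_norm_square of_real_add of_real_power[symmetric])
    then show ?thesis by (simp only: of_real_eq_iff)
  qed
  have "(norm (a + vint g t))\<^sup>2 = (norm a)\<^sup>2 + vint (\<lambda>s. 2 * Re (cnj (a + vint g s) * g s)) t"
  proof (cases "t \<ge> 0")
    case True then show ?thesis using pos g by blast
  next
    case False
    define g' where "g' = (\<lambda>s. - g (- s))"
    have r: "vint g' s = vint g (- s)" for s
      using vint_reflect[of g "- s"] unfolding g'_def by (simp add: vint_def)
    have "integrable lborel (\<lambda>s. - (indicator (seg t) (0 + -1 * s) *\<^sub>R g (0 + -1 * s)))"
      using lborel_integrable_real_affine[OF g, of "-1" 0] by simp
    also have "(\<lambda>s. - (indicator (seg t) (0 + -1 * s) *\<^sub>R g (0 + -1 * s))) = (\<lambda>s. indicator (seg (- t)) s *\<^sub>R g' s)"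
      by (auto simp: fun_eq_iff g'_def indicator_def)
    finally have "(norm (a + vint g' (- t)))\<^sup>2 = (norm a)\<^sup>2 + vint (\<lambda>s. 2 * Re (cnj (a + vint g' s) * g' s)) (- t)"
      using False by (intro pos) auto
    also have "vint (\<lambda>s. 2 * Re (cnj (a + vint g' s) * g' s)) (- t) = vint (\<lambda>s. 2 * Re (cnj (a + vint g s) * g s)) t"
    proof -
      define q where "q = (\<lambda>s. 2 * Re (cnj (a + vint g s) * g s))"
      have "vint (\<lambda>s. 2 * Re (cnj (a + vint g' s) * g' s)) (- t) = vint (\<lambda>s. - q (- s)) (- t)"
        unfolding r by (simp add: g'_def q_def)
      also have "\<dots> = - vint (\<lambda>s. q (- s)) (- t)" by (simp add: vint_def)
      also have "\<dots> = vint q t" by (simp only: vint_reflect minus_minus)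
      finally show ?thesis by (simp only: q_def)
    qed
    finally show ?thesis by (simp add: r)
  qed
  also have "vint (\<lambda>s. 2 * Re (cnj (a + vint g s) * g s)) t \<le> norm (vint (\<lambda>s. 2 * Re (cnj (a + vint g s) * g s)) t)" by simp
  also have "\<dots> \<le> (LINT s|lborel. indicator (seg t) s * h s)"
    by (rule norm_vint_le[OF h]) (use le in auto)
  finally show ?thesis by simp
qed

section \<open>The Thirring nonlinearity and its spatial derivatives\<close>

text \<open>The right-hand side \<open>i (c + \<bar>c\<bar>\<^sup>2 a)\<close> of the transport equation for \<open>a\<close>. The square is written as
  \<open>c * cnj c\<close> so that only products, sums and conjugates occur, for which \<open>primitive\<close> has rules.\<close>

definition tm0 :: "complex \<Rightarrow> complex \<Rightarrow> complex" where
  "tm0 a c = \<i> * (c + c * cnj c * a)"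

text \<open>The derivative of \<open>tm0\<close> at \<open>(a, c)\<close> in the direction \<open>(p, q)\<close>.\<close>

definition tm1 :: "complex \<Rightarrow> complex \<Rightarrow> complex \<Rightarrow> complex \<Rightarrow> complex" where
  "tm1 a c p q = \<i> * (q + (q * cnj c + c * cnj q) * a + c * cnj c * p)"

text \<open>The second derivative of \<open>tm0\<close> at \<open>(a, c)\<close>, as a symmetric bilinear form in \<open>(p, q)\<close> and
  \<open>(p', q')\<close>.\<close>

definition tm2 :: "complex \<Rightarrow> complex \<Rightarrow> complex \<Rightarrow> complex \<Rightarrow> complex \<Rightarrow> complex \<Rightarrow> complex" where
  "tm2 a c p q p' q' = \<i> * ((q' * cnj q + q * cnj q') * a + (q' * cnj c + c * cnj q') * p + (q * cnj c + c * cnj q) * p')"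

abbreviation rhs0 where
  "rhs0 U b t x \<equiv> tm0 (U b t x) (U (\<not> b) t x)"

abbreviation rhs1 where
  "rhs1 U P b t x \<equiv> tm1 (U b t x) (U (\<not> b) t x) (P b t x) (P (\<not> b) t x)"

abbreviation rhs2 where
  "rhs2 U P Q b t x \<equiv> tm2 (U b t x) (U (\<not> b) t x) (P b t x) (P (\<not> b) t x) (Q b t x) (Q (\<not> b) t x)"

lemma norm_mult3_le:
  fixes a b c :: complex
  assumes "norm a \<le> A" "norm b \<le> B" "norm c \<le> C"
  shows "norm (a * b * c) \<le> A * B * C"
proof -
  have "0 \<le> A" "0 \<le> B" using order_trans[OF norm_ge_zero] assms by blast+
  then show ?thesis unfolding norm_mult by (intro mult_mono assms) auto
qed

lemma norm_tm0_diff: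
  assumes "norm a \<le> B" "norm c \<le> B" "norm a' \<le> B" "norm c' \<le> B"
  shows "norm (tm0 a c - tm0 a' c') \<le> (1 + 3 * B\<^sup>2) * (norm (a - a') + norm (c - c'))"
proof -
  have B: "B \<ge> 0" using assms(1) norm_ge_zero order_trans by blast
  have e: "tm0 a c - tm0 a' c' = \<i> * ((c - c') + ((c - c') * cnj c * a + c' * cnj (c - c') * a + c' * cnj c' * (a - a')))"
    by (simp add: tm0_def algebra_simps)
  have 1: "norm ((c - c') * cnj c * a) \<le> norm (c - c') * B * B" by (rule norm_mult3_le) (use assms in auto)
  have 2: "norm (c' * cnj (c - c') * a) \<le> B * norm (c - c') * B" by (rule norm_mult3_le) (use assms in \<open>auto simp flip: complex_cnj_diff\<close>)
  have 3: "norm (c' * cnj c' * (a - a')) \<le> B * B * norm (a - a')" by (rule norm_mult3_le) (use assms in auto)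
  have "norm (tm0 a c - tm0 a' c') \<le> norm (c - c') + (norm ((c - c') * cnj c * a) + norm (c' * cnj (c - c') * a) + norm (c' * cnj c' * (a - a')))"
    unfolding e norm_mult[of \<i>] norm_ii mult_1_left by (intro norm_triangle_le add_left_mono norm_triangle_mono order_refl)
  also have "\<dots> \<le> norm (c - c') + (norm (c - c') * B * B + B * norm (c - c') * B + B * B * norm (a - a'))"
    using 1 2 3 by linarith
  also have "\<dots> \<le> (1 + 3 * B\<^sup>2) * (norm (a - a') + norm (c - c'))"
    using B by (simp add: algebra_simps power2_eq_square add_increasing)
  finally show ?thesis .
qed

lemma tm1_linear: "tm1 a c p q - tm1 a c p' q' = tm1 a c (p - p') (q - q')"
  by (simp add: tm1_def algebra_simps)

lemma norm_tm1:
  assumes "norm a \<le> B" "norm c \<le> B"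
  shows "norm (tm1 a c p q) \<le> (1 + 3 * B\<^sup>2) * (norm p + norm q)"
proof -
  have B: "B \<ge> 0" using assms(1) norm_ge_zero order_trans by blast
  have e: "tm1 a c p q = \<i> * (q + (q * cnj c * a + c * cnj q * a + c * cnj c * p))" by (simp add: tm1_def algebra_simps)
  have 1: "norm (q * cnj c * a) \<le> norm q * B * B" by (rule norm_mult3_le) (use assms in auto)
  have 2: "norm (c * cnj q * a) \<le> B * norm q * B" by (rule norm_mult3_le) (use assms in auto)
  have 3: "norm (c * cnj c * p) \<le> B * B * norm p" by (rule norm_mult3_le) (use assms in auto)
  have "norm (tm1 a c p q) \<le> norm q + (norm (q * cnj c * a) + norm (c * cnj q * a) + norm (c * cnj c * p))"
    unfolding e norm_mult[of \<i>] norm_ii mult_1_left by (intro norm_triangle_le add_left_mono norm_triangle_mono order_refl)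
  also have "\<dots> \<le> norm q + (norm q * B * B + B * norm q * B + B * B * norm p)"
    using 1 2 3 by linarith
  also have "\<dots> \<le> (1 + 3 * B\<^sup>2) * (norm p + norm q)"
    using B by (simp add: algebra_simps power2_eq_square add_increasing)
  finally show ?thesis .
qed

lemma norm_tm1_diff:
  assumes "norm a \<le> B" "norm c \<le> B" "norm a' \<le> B" "norm c' \<le> B"
  shows "norm (tm1 a c p q - tm1 a' c' p q) \<le> (2 * B * (norm p + norm q)) * (norm (a - a') + norm (c - c'))"
proof -
  have B: "B \<ge> 0" using assms(1) norm_ge_zero order_trans by blast
  have e: "tm1 a c p q - tm1 a' c' p q = \<i> * ((q * cnj c * (a - a') + q * cnj (c - c') * a') +
      ((c * cnj q * (a - a') + (c - c') * cnj q * a') + (c * cnj (c - c') * p + (c - c') * cnj c' * p)))"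
    by (simp add: tm1_def algebra_simps)
  have 1: "norm (q * cnj c * (a - a')) \<le> norm q * B * norm (a - a')" by (rule norm_mult3_le) (use assms in auto)
  have 2: "norm (q * cnj (c - c') * a') \<le> norm q * norm (c - c') * B" by (rule norm_mult3_le) (use assms in \<open>auto simp flip: complex_cnj_diff\<close>)
  have 3: "norm (c * cnj q * (a - a')) \<le> B * norm q * norm (a - a')" by (rule norm_mult3_le) (use assms in auto)
  have 4: "norm ((c - c') * cnj q * a') \<le> norm (c - c') * norm q * B" by (rule norm_mult3_le) (use assms in auto)
  have 5: "norm (c * cnj (c - c') * p) \<le> B * norm (c - c') * norm p" by (rule norm_mult3_le) (use assms in \<open>auto simp flip: complex_cnj_diff\<close>)
  have 6: "norm ((c - c') * cnj c' * p) \<le> norm (c - c') * B * norm p" by (rule norm_mult3_le) (use assms in auto)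
  have "norm (tm1 a c p q - tm1 a' c' p q) \<le> (norm (q * cnj c * (a - a')) + norm (q * cnj (c - c') * a')) +
      ((norm (c * cnj q * (a - a')) + norm ((c - c') * cnj q * a')) + (norm (c * cnj (c - c') * p) + norm ((c - c') * cnj c' * p)))"
    unfolding e norm_mult[of \<i>] norm_ii mult_1_left by (intro norm_triangle_le add_mono norm_triangle_ineq)
  also have "\<dots> \<le> (norm q * B * norm (a - a') + norm q * norm (c - c') * B) +
      ((B * norm q * norm (a - a') + norm (c - c') * norm q * B) + (B * norm (c - c') * norm p + norm (c - c') * B * norm p))"
    by (intro add_mono 1 2 3 4 5 6)
  also have "\<dots> \<le> (2 * B * (norm p + norm q)) * (norm (a - a') + norm (c - c'))"
    using B by (simp add: algebra_simps add_increasing)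
  finally show ?thesis .
qed

lemma norm_tm2_le:
  assumes "norm a \<le> B" "norm c \<le> B"
  shows "norm (tm2 a c p q p' q') \<le> (2 * B * (norm p + norm q)) * (norm p' + norm q')"
proof -
  have B: "B \<ge> 0" using assms(1) norm_ge_zero order_trans by blast
  have e: "tm2 a c p q p' q' = \<i> * ((q' * cnj q * a + q * cnj q' * a) + ((q' * cnj c * p + c * cnj q' * p) + (q * cnj c * p' + c * cnj q * p')))"
    by (simp add: tm2_def algebra_simps)
  have 1: "norm (q' * cnj q * a) \<le> norm q' * norm q * B" by (rule norm_mult3_le) (use assms in auto)
  have 2: "norm (q * cnj q' * a) \<le> norm q * norm q' * B" by (rule norm_mult3_le) (use assms in auto)
  have 3: "norm (q' * cnj c * p) \<le> norm q' * B * norm p" by (rule norm_mult3_le) (use assms in auto)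
  have 4: "norm (c * cnj q' * p) \<le> B * norm q' * norm p" by (rule norm_mult3_le) (use assms in auto)
  have 5: "norm (q * cnj c * p') \<le> norm q * B * norm p'" by (rule norm_mult3_le) (use assms in auto)
  have 6: "norm (c * cnj q * p') \<le> B * norm q * norm p'" by (rule norm_mult3_le) (use assms in auto)
  have "norm (tm2 a c p q p' q') \<le> (norm (q' * cnj q * a) + norm (q * cnj q' * a)) + ((norm (q' * cnj c * p) + norm (c * cnj q' * p)) + (norm (q * cnj c * p') + norm (c * cnj q * p')))"
    unfolding e norm_mult[of \<i>] norm_ii mult_1_left by (intro norm_triangle_le add_mono norm_triangle_ineq)
  also have "\<dots> \<le> (norm q' * norm q * B + norm q * norm q' * B) + ((norm q' * B * norm p + B * norm q' * norm p) + (norm q * B * norm p' + B * norm q * norm p'))"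
    by (intro add_mono 1 2 3 4 5 6)
  also have "\<dots> \<le> (2 * B * (norm p + norm q)) * (norm p' + norm q')"
    using B by (simp add: algebra_simps add_increasing)
  finally show ?thesis .
qed

lemma tm2_linear: "tm2 a c p q p' q' - tm2 a c p q p'' q'' = tm2 a c p q (p' - p'') (q' - q'')"
  by (simp add: tm2_def algebra_simps)

lemma cnj_measurable[measurable (raw)]:
  assumes "f \<in> borel_measurable M" shows "(\<lambda>x. cnj (f x)) \<in> borel_measurable M"
  by (rule measurable_compose[OF assms]) (intro borel_measurable_continuous_onI continuous_intros)

lemma tm_measurable[measurable (raw)]:
  assumes [measurable]: "a \<in> borel_measurable M" "c \<in> borel_measurable M" "p \<in> borel_measurable M" "q \<in> borel_measurable M"
    "p' \<in> borel_measurable M" "q' \<in> borel_measurable M"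
  shows "(\<lambda>x. tm0 (a x) (c x)) \<in> borel_measurable M" "(\<lambda>x. tm1 (a x) (c x) (p x) (q x)) \<in> borel_measurable M"
    "(\<lambda>x. tm2 (a x) (c x) (p x) (q x) (p' x) (q' x)) \<in> borel_measurable M"
  unfolding tm0_def tm1_def tm2_def by measurable

text \<open>Absolute continuity with a given integrable derivative and limit zero at minus infinity. This relation is
  closed under the algebraic operations that make up the nonlinearity.\<close>

definition primitive :: "(real \<Rightarrow> complex) \<Rightarrow> (real \<Rightarrow> complex) \<Rightarrow> bool" where
  "primitive f g \<longleftrightarrow> integrable lborel g \<and> f = prim g"

lemma primitive_add: "primitive f g \<Longrightarrow> primitive f' g' \<Longrightarrow> primitive (\<lambda>x. f x + f' x) (\<lambda>x. g x + g' x)"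
  by (auto simp: primitive_def prim_add)

lemma primitive_cmult: "primitive f g \<Longrightarrow> primitive (\<lambda>x. c * f x) (\<lambda>x. c * g x)"
  by (auto simp: primitive_def prim_cmult)

lemma primitive_cnj: "primitive f g \<Longrightarrow> primitive (\<lambda>x. cnj (f x)) (\<lambda>x. cnj (g x))"
  by (auto simp: primitive_def prim_cnj)

lemma primitive_mult: "primitive f g \<Longrightarrow> primitive f' g' \<Longrightarrow> primitive (\<lambda>x. f x * f' x) (\<lambda>x. g x * f' x + f x * g' x)"
  by (auto simp: primitive_def prim_mult integrable_mult_prim)

lemma primitive_tm0:
  assumes "primitive a p" "primitive c q"
  shows "primitive (\<lambda>x. tm0 (a x) (c x)) (\<lambda>x. tm1 (a x) (c x) (p x) (q x))"
proof -
  have "(\<lambda>x. tm1 (a x) (c x) (p x) (q x)) = (\<lambda>x. \<i> * (q x + ((q x * cnj (c x) + c x * cnj (q x)) * a x + (c x * cnj (c x)) * p x)))"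
    by (simp add: tm1_def fun_eq_iff algebra_simps)
  then show ?thesis unfolding tm0_def
    by (simp only:) (intro primitive_cmult primitive_add primitive_mult primitive_cnj assms)
qed

lemma primitive_tm1:
  assumes "primitive a p" "primitive c q" "primitive p' w" "primitive q' z"
  shows "primitive (\<lambda>x. tm1 (a x) (c x) (p' x) (q' x)) (\<lambda>x. tm1 (a x) (c x) (w x) (z x) + tm2 (a x) (c x) (p x) (q x) (p' x) (q' x))"
proof -
  have "(\<lambda>x. tm1 (a x) (c x) (w x) (z x) + tm2 (a x) (c x) (p x) (q x) (p' x) (q' x)) =
     (\<lambda>x. \<i> * (z x + (((z x * cnj (c x) + q' x * cnj (q x)) + (q x * cnj (q' x) + c x * cnj (z x))) * a x + (q' x * cnj (c x) + c x * cnj (q' x)) * p x)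
        + ((q x * cnj (c x) + c x * cnj (q x)) * p' x + (c x * cnj (c x)) * w x)))"
    by (simp add: tm1_def tm2_def fun_eq_iff algebra_simps)
  then show ?thesis unfolding tm1_def[of "a _" "c _" "p' _" "q' _"]
    by (simp only:) (intro primitive_cmult primitive_add primitive_mult primitive_cnj assms)
qed

section \<open>Bounds transported along characteristics, and truncation\<close>

definition two_way :: "(real \<Rightarrow> real) \<Rightarrow> real \<Rightarrow> real \<Rightarrow> real" where
  "two_way \<phi> t x = \<phi> (x - t) + \<phi> (x + t) + kernel_average \<phi> x"

lemma two_way_dir: "two_way \<phi> t x = \<phi> (x - dir b * t) + \<phi> (x + dir b * t) + kernel_average \<phi> x"
  by (cases b) (auto simp: two_way_def dir_def)

lemma two_way_integrable:
  assumes \<phi>: "weighted_L2 \<phi>" "\<And>x. \<phi> x \<ge> (0::real)"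
  shows "integrable lborel (two_way \<phi> t)" "integral\<^sup>L lborel (two_way \<phi> t) = 2 * integral\<^sup>L lborel \<phi> + integral\<^sup>L lborel (kernel_average \<phi>)"
proof -
  note i = weighted_L2_integrable(1)[OF \<phi>(1)] weighted_L2_integrable(1)[OF kernel_average_weighted_L2[OF \<phi>]]
  note a = integrable_translate[OF i(1), of t] integrable_translate[OF i(1), of "-t"]
  show "integrable lborel (two_way \<phi> t)" unfolding two_way_def using i a by simp
  show "integral\<^sup>L lborel (two_way \<phi> t) = 2 * integral\<^sup>L lborel \<phi> + integral\<^sup>L lborel (kernel_average \<phi>)"
    unfolding two_way_def using i a by simp
qed

lemma two_way_dominated_integrable:
  fixes F :: "real \<Rightarrow> complex"
  assumes \<phi>: "weighted_L2 \<phi>" "\<And>x. \<phi> x \<ge> (0::real)" and F: "F \<in> borel_measurable borel"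
    and le: "\<And>x. norm (F x) \<le> C * two_way \<phi> t x"
  shows "integrable lborel F"
    "(LINT x|lborel. norm (F x)) \<le> C * (2 * integral\<^sup>L lborel \<phi> + integral\<^sup>L lborel (kernel_average \<phi>))"
proof -
  note i = two_way_integrable(1)[OF \<phi>, of t]
  have p: "norm (F x) \<le> norm (C * two_way \<phi> t x)" for x using order_trans[OF le abs_ge_self] by simp
  show iF: "integrable lborel F"
    by (rule Bochner_Integration.integrable_bound[OF integrable_mult_right[of C, OF i]]) (use F p in auto)
  have "(LINT x|lborel. norm (F x)) \<le> (LINT x|lborel. C * two_way \<phi> t x)"
    by (intro integral_mono integrable_norm iF integrable_mult_right i le)
  then show "(LINT x|lborel. norm (F x)) \<le> C * (2 * integral\<^sup>L lborel \<phi> + integral\<^sup>L lborel (kernel_average \<phi>))"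
    by (simp add: two_way_integrable(2)[OF \<phi>])
qed

definition transported_bound :: "(real \<Rightarrow> real) \<Rightarrow> (bool \<Rightarrow> real \<Rightarrow> real \<Rightarrow> complex) \<Rightarrow> bool" where
  "transported_bound \<phi> U \<longleftrightarrow> (\<forall>T. \<exists>C\<ge>0. \<forall>b t x. \<bar>t\<bar> \<le> T \<longrightarrow> norm (U b t x) \<le> C * (\<phi> (x - dir b * t) + kernel_average \<phi> x))"

definition locally_bounded :: "(bool \<Rightarrow> real \<Rightarrow> real \<Rightarrow> complex) \<Rightarrow> bool" where
  "locally_bounded U \<longleftrightarrow> (\<forall>T. \<exists>B\<ge>0. \<forall>b t x. \<bar>t\<bar> \<le> T \<longrightarrow> norm (U b t x) \<le> B)"

definition char_integrable :: "(bool \<Rightarrow> real \<Rightarrow> real \<Rightarrow> complex) \<Rightarrow> bool" where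
  "char_integrable N \<longleftrightarrow> (\<forall>b t x. integrable lborel (\<lambda>s. indicator (seg t) s *\<^sub>R N b s (x - dir b * (t - s))))"

lemma transported_bound_two_way:
  assumes "transported_bound \<phi> U" "\<And>x. \<phi> x \<ge> 0"
  shows "\<exists>C\<ge>0. \<forall>b t x. \<bar>t\<bar> \<le> T \<longrightarrow> norm (U b t x) \<le> C * two_way \<phi> t x"
proof -
  obtain C where C: "C \<ge> 0" "\<And>b t x. \<bar>t\<bar> \<le> T \<Longrightarrow> norm (U b t x) \<le> C * (\<phi> (x - dir b * t) + kernel_average \<phi> x)"
    using assms(1) unfolding transported_bound_def by blast
  have "C * (\<phi> (x - dir b * t) + kernel_average \<phi> x) \<le> C * two_way \<phi> t x" for b t x
    unfolding two_way_dir[of _ _ _ b] using C(1) assms(2) by (intro mult_left_mono) auto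
  then show ?thesis using C order_trans by blast
qed

lemma transported_bound_locally_bounded:
  assumes U: "transported_bound \<phi> U" and \<phi>: "integrable lborel \<phi>" "\<And>x. \<phi> x \<ge> 0" "\<And>x. \<phi> x \<le> B0"
  shows "locally_bounded U"
  unfolding locally_bounded_def
proof
  fix T
  obtain C where C: "C \<ge> 0" "\<And>b t x. \<bar>t\<bar> \<le> T \<Longrightarrow> norm (U b t x) \<le> C * (\<phi> (x - dir b * t) + kernel_average \<phi> x)"
    using U unfolding transported_bound_def by blast
  have "C * (\<phi> (x - dir b * t) + kernel_average \<phi> x) \<le> C * (B0 + integral\<^sup>L lborel \<phi>)" for b t x
    using C(1) \<phi>(3) kernel_average_le[OF \<phi>(1,2)] by (intro mult_left_mono add_mono) auto
  moreover have "0 \<le> B0 + integral\<^sup>L lborel \<phi>"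
    using order_trans[OF \<phi>(2,3)] \<phi>(2) by (intro add_nonneg_nonneg integral_nonneg_AE) auto
  ultimately show "\<exists>B\<ge>0. \<forall>b t x. \<bar>t\<bar> \<le> T \<longrightarrow> norm (U b t x) \<le> B"
    using C(1) order_trans[OF C(2)] by (intro exI[of _ "C * (B0 + integral\<^sup>L lborel \<phi>)"]) auto
qed

lemma (in transport_system) exists_solution:
  obtains U where "\<And>b. plane_measurable (U b)"
    "\<And>b t x. U b t x = duhamel U0 (\<lambda>b t x. f b t x (U b t x) (U (\<not> b) t x)) b t x"
    "transported_bound \<phi> U" "char_integrable (\<lambda>b t x. f b t x (U b t x) (U (\<not> b) t x))"
proof
  show "plane_measurable (solution b)" for b by (rule solution_measurable)
  show "solution b t x = duhamel U0 (\<lambda>b t x. f b t x (solution b t x) (solution (\<not> b) t x)) b t x" for b t x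
    using solution_eq unfolding source_def .
  show "transported_bound \<phi> solution" unfolding transported_bound_def using solution_bound by blast
  show "char_integrable (\<lambda>b t x. f b t x (solution b t x) (solution (\<not> b) t x))"
    unfolding char_integrable_def source_def[symmetric]
  proof (intro allI)
    fix b t x
    obtain L l K where c: "contracts \<bar>t\<bar> L l K" using contracts_exists[of "\<bar>t\<bar>"] by auto
    show "integrable lborel (\<lambda>s. indicator (seg t) s *\<^sub>R source solution b s (x - dir b * (t - s)))"
      by (rule source_integrable[OF c order_refl solution_measurable solution_le_majorant[OF c], simplified]) 
  qed
qed

text \<open>Truncation to the disc of radius \<open>R\<close> by a real factor, so that the phase is kept.\<close>

definition clip :: "real \<Rightarrow> complex \<Rightarrow> complex" where
  "clip R z = (R / max R (norm z)) *\<^sub>R z"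

lemma clip_bounds:
  assumes R: "R > 0"
  shows "norm (clip R z) \<le> R" "norm z \<le> R \<Longrightarrow> clip R z = z" "norm (clip R z - clip R w) \<le> 2 * norm (z - w)"
proof -
  show 1: "norm (clip R z) \<le> R" for z
    using R by (auto simp: clip_def max_def divide_simps)
  show "norm z \<le> R \<Longrightarrow> clip R z = z" using R by (simp add: clip_def max_def)
  define m where "m = max R (norm z)"
  define n where "n = max R (norm w)"
  have mn: "m > 0" "n > 0" "R \<le> m" "norm w \<le> n" using R by (auto simp: m_def n_def)
  have d: "\<bar>n - m\<bar> \<le> norm (z - w)"
    using norm_triangle_ineq3[of z w] norm_triangle_ineq3[of w z] norm_minus_commute[of z w] by (auto simp: m_def n_def max_def)
  have "R / m - R / n = R * (n - m) / (m * n)" using mn by (simp add: field_simps)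
  moreover have "clip R z - clip R w = (R / m) *\<^sub>R (z - w) + (R / m - R / n) *\<^sub>R w"
    unfolding clip_def m_def[symmetric] n_def[symmetric] by (simp only: scaleR_diff_right scaleR_left_diff_distrib) simp
  ultimately have "clip R z - clip R w = (R / m) *\<^sub>R (z - w) + (R * (n - m) / (m * n)) *\<^sub>R w" by simp
  then have "norm (clip R z - clip R w) \<le> norm ((R / m) *\<^sub>R (z - w)) + norm ((R * (n - m) / (m * n)) *\<^sub>R w)"
    using norm_triangle_ineq by metis
  also have "norm ((R / m) *\<^sub>R (z - w)) \<le> 1 * norm (z - w)"
  proof -
    have "(R / m) * norm (z - w) \<le> 1 * norm (z - w)" using mn R by (intro mult_right_mono) auto
    then show ?thesis using mn R by simp
  qed
  also have "norm ((R * (n - m) / (m * n)) *\<^sub>R w) = (R / m) * \<bar>n - m\<bar> * (norm w / n)"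
    using mn R by (simp add: abs_mult)
  also have "\<dots> \<le> 1 * norm (z - w) * 1"
    using mn R d by (intro mult_mono) (auto simp: divide_simps)
  finally show "norm (clip R z - clip R w) \<le> 2 * norm (z - w)" by simp
qed

lemma clip_measurable[measurable (raw)]:
  assumes [measurable]: "R \<in> borel_measurable M" "f \<in> borel_measurable M"
  shows "(\<lambda>x. clip (R x) (f x)) \<in> borel_measurable M"
  unfolding clip_def by measurable

definition clipped_tm0 :: "real \<Rightarrow> complex \<Rightarrow> complex \<Rightarrow> complex" where
  "clipped_tm0 R a c = \<i> * (c + clip R c * cnj (clip R c) * clip R a)"

lemma clipped_tm0_Lipschitz:
  assumes R: "R > 0" "R \<le> R1"
  shows "norm (clipped_tm0 R a c - clipped_tm0 R a' c') \<le> (5 + 6 * R1\<^sup>2) * (norm (a - a') + norm (c - c'))"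
proof -
  have e: "clipped_tm0 R a c - clipped_tm0 R a' c' = \<i> * ((c - c') - (clip R c - clip R c')) + (tm0 (clip R a) (clip R c) - tm0 (clip R a') (clip R c'))"
    by (simp add: clipped_tm0_def tm0_def algebra_simps)
  have "norm (clipped_tm0 R a c - clipped_tm0 R a' c') \<le> norm ((c - c') - (clip R c - clip R c')) + norm (tm0 (clip R a) (clip R c) - tm0 (clip R a') (clip R c'))"
    unfolding e by (rule order_trans[OF norm_triangle_ineq]) (simp add: norm_mult)
  also have "norm ((c - c') - (clip R c - clip R c')) \<le> 3 * norm (c - c')"
    using norm_triangle_ineq4[of "c - c'" "clip R c - clip R c'"] clip_bounds(3)[OF R(1), of c c'] by linarith
  also have "norm (tm0 (clip R a) (clip R c) - tm0 (clip R a') (clip R c')) \<le> (1 + 3 * R\<^sup>2) * (norm (clip R a - clip R a') + norm (clip R c - clip R c'))"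
    by (intro norm_tm0_diff clip_bounds R)
  also have "\<dots> \<le> (1 + 3 * R1\<^sup>2) * (2 * norm (a - a') + 2 * norm (c - c'))"
    using R by (intro mult_mono add_mono clip_bounds R mult_left_mono power_mono) auto
  finally have "norm (clipped_tm0 R a c - clipped_tm0 R a' c') \<le> 3 * norm (c - c') + (1 + 3 * R1\<^sup>2) * (2 * norm (a - a') + 2 * norm (c - c'))" by simp
  also have "\<dots> \<le> (5 + 6 * R1\<^sup>2) * (norm (a - a') + norm (c - c'))" by (simp add: algebra_simps)
  finally show ?thesis .
qed

text \<open>The truncated cubic term is still a real multiple of \<open>i a\<close>, hence orthogonal to \<open>a\<close>.\<close>

lemma clipped_tm0_Re:
  assumes "R > 0"
  shows "\<bar>2 * Re (cnj a * clipped_tm0 R a c)\<bar> \<le> 2 * (norm a * norm c)"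
proof -
  define r where "r = (norm (clip R c))\<^sup>2 * (R / max R (norm a))"
  have "clip R c * cnj (clip R c) * clip R a = of_real r * a"
    unfolding complex_norm_square[symmetric] r_def clip_def[of R a] by (simp add: scaleR_conv_of_real)
  then have "cnj a * clipped_tm0 R a c = \<i> * (cnj a * c) + \<i> * of_real r * (a * cnj a)"
    by (simp add: clipped_tm0_def algebra_simps)
  also have "\<dots> = \<i> * (cnj a * c) + \<i> * of_real (r * (norm a)\<^sup>2)" by (simp only: complex_norm_square of_real_mult mult.assoc)
  finally have "Re (cnj a * clipped_tm0 R a c) = Re (\<i> * (cnj a * c))" by simp
  moreover have "\<bar>Re (\<i> * (cnj a * c))\<bar> \<le> norm (\<i> * (cnj a * c))" by (rule abs_Re_le_cmod)
  ultimately show ?thesis by (simp add: norm_mult)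
qed

section \<open>The solution and its first two spatial derivatives\<close>

text \<open>The second derivatives of the initial data.\<close>

locale thirring_data =
  fixes w0 :: "bool \<Rightarrow> real \<Rightarrow> complex"
  assumes w0: "\<And>b. H2_density (w0 b)"
begin

definition p0 :: "bool \<Rightarrow> real \<Rightarrow> complex" where "p0 b = prim (w0 b)"
definition u0 :: "bool \<Rightarrow> real \<Rightarrow> complex" where "u0 b = prim (p0 b)"

text \<open>The first majorant is bounded and dominates the data of the solution and of its first derivative; the
  second one also dominates the possibly unbounded second derivatives.\<close>

definition \<phi>1 :: "real \<Rightarrow> real" where
  "\<phi>1 x = (norm (u0 True x) + norm (u0 False x)) + (norm (p0 True x) + norm (p0 False x))"
definition \<phi>2 :: "real \<Rightarrow> real" where
  "\<phi>2 x = \<phi>1 x + (norm (w0 True x) + norm (w0 False x))"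

lemma data_props:
  "integrable lborel (w0 b)" "integrable lborel (p0 b)" "weighted_L2 (w0 b)" "weighted_L2 (p0 b)" "weighted_L2 (u0 b)"
  "w0 b \<in> borel_measurable borel" "p0 b \<in> borel_measurable borel" "u0 b \<in> borel_measurable borel"
  using H2_densityD[OF w0[of b]] weighted_L2D(1) unfolding u0_def p0_def by auto

lemma weighted_L2_norm: "weighted_L2 f \<Longrightarrow> weighted_L2 (\<lambda>x. norm (f x))" for f :: "real \<Rightarrow> complex"
  by (rule weighted_L2_dominated(1)[of f _ 1]) (auto dest: weighted_L2D)

lemma \<phi>_props: "weighted_L2 \<phi>1" "weighted_L2 \<phi>2" "\<phi>1 x \<ge> 0" "\<phi>2 x \<ge> 0" "\<phi>1 x \<le> \<phi>2 x"
  "integrable lborel \<phi>1" "integrable lborel \<phi>2"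
proof -
  show w: "weighted_L2 \<phi>1" "weighted_L2 \<phi>2"
    unfolding \<phi>1_def \<phi>2_def by (intro weighted_L2_add weighted_L2_norm data_props)+
  show "\<phi>1 x \<ge> 0" "\<phi>2 x \<ge> 0" "\<phi>1 x \<le> \<phi>2 x" by (auto simp: \<phi>1_def \<phi>2_def)
  show "integrable lborel \<phi>1" "integrable lborel \<phi>2" using w weighted_L2_integrable(1) by blast+
qed

lemma data_le: "norm (u0 b x) \<le> \<phi>1 x" "norm (p0 b x) \<le> \<phi>1 x" "norm (w0 b x) \<le> \<phi>2 x"
  by (cases b; simp add: \<phi>1_def \<phi>2_def add_increasing add_increasing2)+

lemma \<phi>1_bounded: "\<exists>B. \<forall>x. \<phi>1 x \<le> B"
proof -
  have "norm (u0 b x) \<le> (LINT y|lborel. norm (p0 b y))" "norm (p0 b x) \<le> (LINT y|lborel. norm (w0 b y))" for b x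
    using norm_prim_le[OF data_props(2)] norm_prim_le[OF data_props(1)] by (auto simp: u0_def p0_def)
  then show ?thesis unfolding \<phi>1_def by (meson add_mono)
qed

lemma kernel_average_\<phi>_mono: "kernel_average \<phi>1 x \<le> kernel_average \<phi>2 x"
  by (intro kernel_average_mono \<phi>_props)

lemma two_way_\<phi>_mono: "two_way \<phi>1 t x \<le> two_way \<phi>2 t x"
  unfolding two_way_def by (intro add_mono kernel_average_\<phi>_mono \<phi>_props)

text \<open>The radius \<open>R t\<close> of the truncation exceeds the a priori bound \<open>2 M e\<^bsup>2\<bar>t\<bar>\<^esup>\<close>, where \<open>M\<close> bounds the data. The
  bound is obtained from \<open>norm_sq_vint_le\<close> along characteristics, where only \<open>2 \<bar>U\<bar> \<bar>V\<bar>\<close> remains.\<close>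

lemma bounded_solution_exists:
  obtains U where "\<And>b. plane_measurable (U b)"
    "\<And>b t x. U b t x = duhamel u0 (rhs0 U) b t x"
    "transported_bound \<phi>1 U" "char_integrable (rhs0 U)"
proof -
  obtain M where M: "\<And>x. \<phi>1 x \<le> M" using \<phi>1_bounded by blast
  have M0: "M \<ge> 0" using order_trans[OF \<phi>_props(3) M] .
  (* the summand 1 keeps the radius positive for zero data *)
  define R where "R = (\<lambda>t::real. 2 * M * exp (2 * \<bar>t\<bar>) + 1)"
  have R: "R t > 0" "\<bar>t\<bar> \<le> T \<Longrightarrow> R t \<le> R T" for t T
    using M0 by (auto simp: R_def add_nonneg_pos intro!: mult_left_mono)
  have [measurable]: "R \<in> borel_measurable borel" unfolding R_def by measurable
  interpret transport_system "\<lambda>b t x. clipped_tm0 (R t)" u0 \<phi>1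
  proof
    show "plane_measurable (\<lambda>t x. clipped_tm0 (R t) (U t x) (V t x))" if U: "plane_measurable U" and V: "plane_measurable V" for U V
    proof -
      note [measurable] = U[unfolded plane_measurable_def] V[unfolded plane_measurable_def]
      show ?thesis unfolding plane_measurable_def clipped_tm0_def by measurable
    qed
    show "\<exists>L\<ge>0. \<forall>b t x a c a' c'. \<bar>t\<bar> \<le> T \<longrightarrow> norm (clipped_tm0 (R t) a c - clipped_tm0 (R t) a' c') \<le> L * (norm (a - a') + norm (c - c'))" for T
      by (intro exI[of _ "5 + 6 * (R T)\<^sup>2"] conjI allI impI clipped_tm0_Lipschitz R) auto
    show "\<exists>L\<ge>0. \<forall>b t x. \<bar>t\<bar> \<le> T \<longrightarrow> norm (clipped_tm0 (R t) 0 0) \<le> L * (\<phi>1 (x - dir b * t) + \<phi>1 (x + dir b * t) + kernel_average \<phi>1 x)" for T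
      by (intro exI[of _ 0]) (simp add: clipped_tm0_def clip_def)
  qed (use \<phi>_props data_props data_le in auto)
  obtain U where U: "\<And>b. plane_measurable (U b)"
    "\<And>b t x. U b t x = duhamel u0 (\<lambda>b t x. clipped_tm0 (R t) (U b t x) (U (\<not> b) t x)) b t x"
    "transported_bound \<phi>1 U" "char_integrable (\<lambda>b t x. clipped_tm0 (R t) (U b t x) (U (\<not> b) t x))"
    by (rule exists_solution) (rule that)
  have bd: "locally_bounded U" by (rule transported_bound_locally_bounded[OF U(3) \<phi>_props(6,3) M])
  have apriori: "(norm (U b t x))\<^sup>2 - 2 * M\<^sup>2 * exp (4 * \<bar>t\<bar>) \<le> 0" for b t x
  proof -
    obtain B where B: "B \<ge> 0" "\<And>b s y. \<bar>s\<bar> \<le> \<bar>t\<bar> \<Longrightarrow> norm (U b s y) \<le> B"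
      using bd unfolding locally_bounded_def by metis
    show ?thesis
    proof (rule exp_contraction_imp_0[where T="\<bar>t\<bar>" and l=4 and B="B\<^sup>2" and d="\<lambda>b t x. (norm (U b t x))\<^sup>2 - 2 * M\<^sup>2 * exp (4 * \<bar>t\<bar>)"])
      fix b' t' x' assume "\<bar>t'\<bar> \<le> \<bar>t\<bar>"
      then have "(norm (U b' t' x'))\<^sup>2 \<le> B\<^sup>2" by (intro power_mono B) auto
      then show "(norm (U b' t' x'))\<^sup>2 - 2 * M\<^sup>2 * exp (4 * \<bar>t'\<bar>) \<le> B\<^sup>2"
        by (smt (verit) zero_le_power2 exp_ge_zero mult_nonneg_nonneg)
    next
      fix S b r x assume S: "S \<ge> (0::real)" and r: "\<bar>r\<bar> \<le> \<bar>t\<bar>"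
        and IH: "\<And>b t' x. \<bar>t'\<bar> \<le> \<bar>t\<bar> \<Longrightarrow> (norm (U b t' x))\<^sup>2 - 2 * M\<^sup>2 * exp (4 * \<bar>t'\<bar>) \<le> S * exp (4 * \<bar>t'\<bar>)"
      define y where "y = x - dir b * r"
      define g where "g = (\<lambda>s. clipped_tm0 (R s) (U b s (y + dir b * s)) (U (\<not> b) s (y + dir b * s)))"
      define q where "q = 2 * M\<^sup>2 + S"
      have q: "q \<ge> 0" using S by (simp add: q_def)
      have g: "(\<lambda>s. clipped_tm0 (R s) (U b s (x - dir b * (r - s))) (U (\<not> b) s (x - dir b * (r - s)))) = g"
        by (auto simp: g_def y_def algebra_simps)
      have gi: "integrable lborel (\<lambda>s. indicator (seg r) s *\<^sub>R g s)"
        using U(4) unfolding char_integrable_def g_def y_def by (simp add: algebra_simps)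
      have Ug: "U b s (y + dir b * s) = u0 b y + vint g s" for s
        using U(2)[of b s "y + dir b * s"] by (simp add: duhamel_def g_def algebra_simps)
      have "(norm (u0 b y + vint g r))\<^sup>2 \<le> (norm (u0 b y))\<^sup>2 + (LINT s|lborel. indicator (seg r) s * (2 * q * exp (4 * \<bar>s\<bar>)))"
      proof (rule norm_sq_vint_le[OF gi seg_integral_exp_const(1)])
        fix s assume "s \<in> seg r"
        then have s: "\<bar>s\<bar> \<le> \<bar>t\<bar>" using seg_abs_le(1) r by fastforce
        have sq: "(norm (U b' s y'))\<^sup>2 \<le> q * exp (4 * \<bar>s\<bar>)" for b' y'
          using IH[OF s, of b' y'] by (simp add: q_def algebra_simps)
        have "\<bar>2 * Re (cnj (u0 b y + vint g s) * g s)\<bar> \<le> 2 * (norm (U b s (y + dir b * s)) * norm (U (\<not> b) s (y + dir b * s)))"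
          unfolding Ug[symmetric] unfolding g_def by (rule clipped_tm0_Re[OF R(1)])
        also have "\<dots> \<le> (norm (U b s (y + dir b * s)))\<^sup>2 + (norm (U (\<not> b) s (y + dir b * s)))\<^sup>2"
          using sum_squares_bound[of "norm (U b s (y + dir b * s))" "norm (U (\<not> b) s (y + dir b * s))"] by simp
        also have "\<dots> \<le> q * exp (4 * \<bar>s\<bar>) + q * exp (4 * \<bar>s\<bar>)" by (intro add_mono sq)
        finally show "\<bar>2 * Re (cnj (u0 b y + vint g s) * g s)\<bar> \<le> 2 * q * exp (4 * \<bar>s\<bar>)" by simp
      qed simp
      also have "\<dots> \<le> M\<^sup>2 + 2 * q / 4 * exp (4 * \<bar>r\<bar>)"
        using order_trans[OF data_le(1) M] q by (intro add_mono power_mono seg_integral_exp_const(2)) auto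
      also have "\<dots> \<le> M\<^sup>2 * exp (4 * \<bar>r\<bar>) + 2 * q / 4 * exp (4 * \<bar>r\<bar>)"
        using mult_left_mono[of 1 "exp (4 * \<bar>r\<bar>)" "M\<^sup>2"] by simp
      finally have "(norm (u0 b y + vint g r))\<^sup>2 \<le> (2 * M\<^sup>2 + S / 2) * exp (4 * \<bar>r\<bar>)" by (simp add: q_def algebra_simps add_divide_distrib)
      moreover have "U b r x = u0 b y + vint g r" using Ug[of r] by (simp add: y_def)
      ultimately show "(norm (U b r x))\<^sup>2 - 2 * M\<^sup>2 * exp (4 * \<bar>r\<bar>) \<le> S / 2 * exp (4 * \<bar>r\<bar>)"
        by (simp add: algebra_simps)
    qed auto
  qed
  have small: "norm (U b t x) \<le> R t" for b t x
  proof -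
    have "(norm (U b t x))\<^sup>2 \<le> 2 * M\<^sup>2 * exp (4 * \<bar>t\<bar>)" using apriori[of b t x] by simp
    also have "\<dots> \<le> (2 * M * exp (2 * \<bar>t\<bar>))\<^sup>2" by (simp add: power_mult_distrib exp_double[symmetric])
    finally have "norm (U b t x) \<le> 2 * M * exp (2 * \<bar>t\<bar>)"
      by (rule power2_le_imp_le) (use M0 in auto)
    then show ?thesis by (simp add: R_def)
  qed
  have eq: "clipped_tm0 (R t) (U b t x) (U (\<not> b) t x) = rhs0 U b t x" for b t x
    by (simp add: clipped_tm0_def tm0_def clip_bounds(2)[OF R(1) small])
  show ?thesis using that[OF U(1) _ U(3)] U(2,4) unfolding eq by blast
qed

lemma linearised_solution_exists:
  assumes Um: "\<And>b. plane_measurable (U b)" and Ub: "locally_bounded U"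
  obtains P where "\<And>b. plane_measurable (P b)"
    "\<And>b t x. P b t x = duhamel p0 (rhs1 U P) b t x"
    "transported_bound \<phi>1 P" "char_integrable (rhs1 U P)"
proof -
  interpret transport_system "\<lambda>b t x. tm1 (U b t x) (U (\<not> b) t x)" p0 \<phi>1
  proof
    show "plane_measurable (\<lambda>t x. tm1 (U b t x) (U (\<not> b) t x) (F t x) (G t x))" if F: "plane_measurable F" and G: "plane_measurable G" for b F G
    proof -
      note [measurable] = F[unfolded plane_measurable_def] G[unfolded plane_measurable_def] Um[unfolded plane_measurable_def]
      show ?thesis unfolding plane_measurable_def by measurable
    qed
    show "\<exists>L\<ge>0. \<forall>b t x a c a' c'. \<bar>t\<bar> \<le> T \<longrightarrow> norm (tm1 (U b t x) (U (\<not> b) t x) a c - tm1 (U b t x) (U (\<not> b) t x) a' c') \<le> L * (norm (a - a') + norm (c - c'))" for T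
    proof -
      obtain B where B: "B \<ge> 0" "\<And>b t x. \<bar>t\<bar> \<le> T \<Longrightarrow> norm (U b t x) \<le> B" using Ub unfolding locally_bounded_def by metis
      show ?thesis
        unfolding tm1_linear by (intro exI[of _ "1 + 3 * B\<^sup>2"] conjI allI impI norm_tm1 B) auto
    qed
    show "\<exists>L\<ge>0. \<forall>b t x. \<bar>t\<bar> \<le> T \<longrightarrow> norm (tm1 (U b t x) (U (\<not> b) t x) 0 0) \<le> L * (\<phi>1 (x - dir b * t) + \<phi>1 (x + dir b * t) + kernel_average \<phi>1 x)" for T
      by (intro exI[of _ 0]) (simp add: tm1_def)
  qed (use \<phi>_props data_props data_le in auto)
  show ?thesis
  proof (rule exists_solution)
    fix P assume *: "\<And>b. plane_measurable (P b)"
      "\<And>b t x. P b t x = duhamel p0 (rhs1 U P) b t x"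
      "transported_bound \<phi>1 P" "char_integrable (rhs1 U P)"
    show thesis by (rule that[of P, OF *])
  qed
qed

text \<open>The quadratic expression in the first derivatives is an inhomogeneity: one factor is bounded, the
  other one is dominated by profiles travelling in both directions.\<close>

lemma second_derivative_solution_exists:
  assumes Um: "\<And>b. plane_measurable (U b)" and Ub: "locally_bounded U"
    and Pm: "\<And>b. plane_measurable (P b)" and Pb: "locally_bounded P" "transported_bound \<phi>1 P"
  obtains W where "\<And>b. plane_measurable (W b)"
    "\<And>b t x. W b t x = duhamel w0 (\<lambda>b t x. rhs1 U W b t x
        + rhs2 U P P b t x) b t x"
    "transported_bound \<phi>2 W"
    "char_integrable (\<lambda>b t x. rhs1 U W b t x
        + rhs2 U P P b t x)"
proof -
  interpret transport_system "\<lambda>b t x a c. tm1 (U b t x) (U (\<not> b) t x) a c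
        + rhs2 U P P b t x" w0 \<phi>2
  proof
    show "plane_measurable (\<lambda>t x. tm1 (U b t x) (U (\<not> b) t x) (F t x) (G t x)
        + rhs2 U P P b t x)" if F: "plane_measurable F" and G: "plane_measurable G" for b F G
    proof -
      note [measurable] = F[unfolded plane_measurable_def] G[unfolded plane_measurable_def] Um[unfolded plane_measurable_def] Pm[unfolded plane_measurable_def]
      show ?thesis unfolding plane_measurable_def by measurable
    qed
    fix T
    obtain B where B: "B \<ge> 0" "\<And>b t x. \<bar>t\<bar> \<le> T \<Longrightarrow> norm (U b t x) \<le> B" using Ub unfolding locally_bounded_def by metis
    obtain B1 where B1: "B1 \<ge> 0" "\<And>b t x. \<bar>t\<bar> \<le> T \<Longrightarrow> norm (P b t x) \<le> B1" using Pb(1) unfolding locally_bounded_def by metis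
    obtain C where C: "C \<ge> 0" "\<And>b t x. \<bar>t\<bar> \<le> T \<Longrightarrow> norm (P b t x) \<le> C * two_way \<phi>1 t x"
      using transported_bound_two_way[OF Pb(2) \<phi>_props(3)] by metis
    show "\<exists>L\<ge>0. \<forall>b t x a c a' c'. \<bar>t\<bar> \<le> T \<longrightarrow> norm (tm1 (U b t x) (U (\<not> b) t x) a c
        + rhs2 U P P b t x - (tm1 (U b t x) (U (\<not> b) t x) a' c'
        + rhs2 U P P b t x)) \<le> L * (norm (a - a') + norm (c - c'))"
      unfolding add_diff_cancel_right tm1_linear by (intro exI[of _ "1 + 3 * B\<^sup>2"] conjI allI impI norm_tm1 B) auto
    have F: "norm (rhs2 U P P b t x) \<le> (8 * B * B1 * C) * two_way \<phi>2 t x"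
      if t: "\<bar>t\<bar> \<le> T" for b t x
    proof -
      have "norm (rhs2 U P P b t x)
        \<le> (2 * B * (norm (P b t x) + norm (P (\<not> b) t x))) * (norm (P b t x) + norm (P (\<not> b) t x))"
        by (intro norm_tm2_le B t)
      also have "\<dots> \<le> (2 * B * (B1 + B1)) * (C * two_way \<phi>1 t x + C * two_way \<phi>1 t x)"
        using B(1) B1(1) by (intro mult_mono add_mono B1 C t mult_nonneg_nonneg add_nonneg_nonneg norm_ge_zero) auto
      also have "\<dots> = (8 * B * B1 * C) * two_way \<phi>1 t x" by simp
      also have "\<dots> \<le> (8 * B * B1 * C) * two_way \<phi>2 t x"
        using B(1) B1(1) C(1) by (intro mult_left_mono two_way_\<phi>_mono) auto
      finally show ?thesis .
    qed
    show "\<exists>L\<ge>0. \<forall>b t x. \<bar>t\<bar> \<le> T \<longrightarrow> norm (tm1 (U b t x) (U (\<not> b) t x) 0 0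
        + rhs2 U P P b t x) \<le> L * (\<phi>2 (x - dir b * t) + \<phi>2 (x + dir b * t) + kernel_average \<phi>2 x)"
    proof (intro exI[of _ "8 * B * B1 * C"] conjI allI impI)
      fix b t x assume "\<bar>t\<bar> \<le> T"
      then show "norm (tm1 (U b t x) (U (\<not> b) t x) 0 0
        + rhs2 U P P b t x) \<le> 8 * B * B1 * C * (\<phi>2 (x - dir b * t) + \<phi>2 (x + dir b * t) + kernel_average \<phi>2 x)"
        using F unfolding two_way_dir[of _ _ _ b] by (simp add: tm1_def)
    qed (use B B1 C in auto)
  qed (use \<phi>_props data_props data_le in auto)
  show ?thesis
  proof (rule exists_solution)
    fix W assume *: "\<And>b. plane_measurable (W b)"
      "\<And>b t x. W b t x = duhamel w0 (\<lambda>b t x. rhs1 U W b t x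
          + rhs2 U P P b t x) b t x"
      "transported_bound \<phi>2 W"
      "char_integrable (\<lambda>b t x. rhs1 U W b t x
          + rhs2 U P P b t x)"
    show thesis by (rule that[of W, OF *])
  qed
qed

end

lemma plane_measurable_slice:
  assumes "plane_measurable F" shows "F t \<in> borel_measurable borel"
  by (rule plane_measurable_compose[OF assms]) auto

lemma transported_bound_L1:
  assumes U: "transported_bound \<phi> U" and \<phi>: "weighted_L2 \<phi>" "\<And>x. \<phi> x \<ge> 0" and m: "\<And>b. plane_measurable (U b)"
  shows "integrable lborel (U b t)" "\<exists>A\<ge>0. \<forall>b t. \<bar>t\<bar> \<le> T \<longrightarrow> (LINT x|lborel. norm (U b t x)) \<le> A"
proof -
  have *: "\<exists>C\<ge>0. \<forall>b t x. \<bar>t\<bar> \<le> T \<longrightarrow> norm (U b t x) \<le> C * two_way \<phi> t x" for T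
    by (rule transported_bound_two_way[OF U \<phi>(2)])
  show "integrable lborel (U b t)"
  proof -
    obtain C where "\<forall>b s x. \<bar>s\<bar> \<le> \<bar>t\<bar> \<longrightarrow> norm (U b s x) \<le> C * two_way \<phi> s x" using *[of "\<bar>t\<bar>"] by blast
    then show ?thesis by (intro two_way_dominated_integrable(1)[OF \<phi> plane_measurable_slice[OF m], of b t C t]) auto
  qed
  obtain C where C: "C \<ge> 0" "\<And>b t x. \<bar>t\<bar> \<le> T \<Longrightarrow> norm (U b t x) \<le> C * two_way \<phi> t x" using *[of T] by blast
  have "(LINT x|lborel. norm (U b t x)) \<le> C * (2 * integral\<^sup>L lborel \<phi> + integral\<^sup>L lborel (kernel_average \<phi>))" if "\<bar>t\<bar> \<le> T" for b t
    by (rule two_way_dominated_integrable(2)[OF \<phi> plane_measurable_slice[OF m] C(2)[OF that]])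
  moreover have "0 \<le> C * (2 * integral\<^sup>L lborel \<phi> + integral\<^sup>L lborel (kernel_average \<phi>))"
    using C(1) \<phi>(2) by (intro mult_nonneg_nonneg add_nonneg_nonneg integral_nonneg_AE) (auto intro: kernel_average_nonneg)
  ultimately show "\<exists>A\<ge>0. \<forall>b t. \<bar>t\<bar> \<le> T \<longrightarrow> (LINT x|lborel. norm (U b t x)) \<le> A" by blast
qed

lemma sum_dominated_L1:
  fixes F f g :: "real \<Rightarrow> complex"
  assumes F: "F \<in> borel_measurable borel" and i: "integrable lborel f" "integrable lborel g"
    and le: "\<And>x. norm (F x) \<le> c * (norm (f x) + norm (g x))"
  shows "integrable lborel F" "(LINT x|lborel. norm (F x)) \<le> c * ((LINT x|lborel. norm (f x)) + (LINT x|lborel. norm (g x)))"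
proof -
  have j: "integrable lborel (\<lambda>x. c * (norm (f x) + norm (g x)))" using i by auto
  have p: "norm (F x) \<le> norm (c * (norm (f x) + norm (g x)))" for x using order_trans[OF le abs_ge_self] by simp
  show iF: "integrable lborel F" by (rule Bochner_Integration.integrable_bound[OF j]) (use F p in auto)
  have "(LINT x|lborel. norm (F x)) \<le> (LINT x|lborel. c * (norm (f x) + norm (g x)))"
    by (intro integral_mono integrable_norm iF j le)
  then show "(LINT x|lborel. norm (F x)) \<le> c * ((LINT x|lborel. norm (f x)) + (LINT x|lborel. norm (g x)))"
    using i by simp
qed

context thirring_data
begin

text \<open>The two applications of \<open>antiderivative_propagates\<close> identify the solutions of the linear
  systems with the derivatives of the solution of the nonlinear one.\<close>

lemma exists_solution_with_derivatives:
  obtains U P W where "\<And>b. plane_measurable (U b)" "\<And>b. plane_measurable (P b)" "\<And>b. plane_measurable (W b)"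
    "transported_bound \<phi>1 U" "transported_bound \<phi>1 P" "transported_bound \<phi>2 W"
    "\<And>b t x. U b t x = duhamel u0 (rhs0 U) b t x"
    "\<And>b t x. P b t x = duhamel p0 (rhs1 U P) b t x"
    "\<And>b t x. W b t x = duhamel w0 (\<lambda>b t x. rhs1 U W b t x
        + rhs2 U P P b t x) b t x"
    "char_integrable (rhs0 U)"
    "char_integrable (rhs1 U P)"
    "char_integrable (\<lambda>b t x. rhs1 U W b t x
        + rhs2 U P P b t x)"
    "\<And>b t. U b t = prim (P b t)" "\<And>b t. P b t = prim (W b t)"
proof -
  obtain M where M: "\<And>x. \<phi>1 x \<le> M" using \<phi>1_bounded by blast
  have lb: "locally_bounded F" if "transported_bound \<phi>1 F" for F
    by (rule transported_bound_locally_bounded[OF that \<phi>_props(6,3) M])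
  obtain U where U: "\<And>b. plane_measurable (U b)"
    "\<And>b t x. U b t x = duhamel u0 (rhs0 U) b t x"
    "transported_bound \<phi>1 U" "char_integrable (rhs0 U)"
    by (rule bounded_solution_exists) (rule that)
  obtain P where P: "\<And>b. plane_measurable (P b)"
    "\<And>b t x. P b t x = duhamel p0 (rhs1 U P) b t x"
    "transported_bound \<phi>1 P" "char_integrable (rhs1 U P)"
    by (rule linearised_solution_exists[OF U(1) lb[OF U(3)]]) (rule that)
  obtain W where W: "\<And>b. plane_measurable (W b)"
    "\<And>b t x. W b t x = duhamel w0 (\<lambda>b t x. rhs1 U W b t x
        + rhs2 U P P b t x) b t x"
    "transported_bound \<phi>2 W"
    "char_integrable (\<lambda>b t x. rhs1 U W b t x
        + rhs2 U P P b t x)"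
    by (rule second_derivative_solution_exists[OF U(1) lb[OF U(3)] P(1) lb[OF P(3)] P(3)]) (rule that)
  note m[measurable] = plane_measurable_slice[OF U(1)] plane_measurable_slice[OF P(1)] plane_measurable_slice[OF W(1)]
  have iP: "integrable lborel (P b t)" for b t by (rule transported_bound_L1(1)[OF P(3) \<phi>_props(1,3) P(1)])
  have iW: "integrable lborel (W b t)" for b t by (rule transported_bound_L1(1)[OF W(3) \<phi>_props(2,4) W(1)])
  have UP: "U b t x = prim (P b t) x" for b t x
  proof -
    define T where "T = \<bar>t\<bar>"
    obtain B0 where B0: "B0 \<ge> 0" "\<And>b t x. \<bar>t\<bar> \<le> T \<Longrightarrow> norm (U b t x) \<le> B0" using lb[OF U(3)] unfolding locally_bounded_def by metis
    obtain A where A: "A \<ge> 0" "\<And>b t. \<bar>t\<bar> \<le> T \<Longrightarrow> (LINT x|lborel. norm (P b t x)) \<le> A"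
      using transported_bound_L1(2)[OF P(3) \<phi>_props(1,3) P(1)] by metis
    define B where "B = B0 + A"
    have B: "B \<ge> 0" using A B0 by (simp add: B_def)
    have BU: "norm (U b t x) \<le> B" if "\<bar>t\<bar> \<le> T" for b t x using B0(2)[OF that, of b x] A(1) by (simp add: B_def)
    have BP: "norm (prim (P b t) x) \<le> B" if "\<bar>t\<bar> \<le> T" for b t x
      using norm_prim_le[OF iP, of b t x] A(2)[OF that, of b] B0(1) by (simp add: B_def)
    have pr: "primitive (prim (P b t)) (P b t)" for b t using iP by (simp add: primitive_def)
    note prt = primitive_tm0[OF pr pr, unfolded primitive_def]
    define L where "L = (1 + 3 * B\<^sup>2) + 4 * B * A"
    have L: "L \<ge> 0" "1 + 3 * B\<^sup>2 \<le> L" "4 * B * A \<le> L" using A B by (auto simp: L_def)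
    have D: "integrable lborel (\<lambda>y. rhs1 U P b t y)"
      "(LINT y|lborel. norm (rhs1 U P b t y)) \<le> (1 + 3 * B\<^sup>2) * (A + A)" if t: "\<bar>t\<bar> \<le> T" for b t
    proof -
      note d = sum_dominated_L1[where F="\<lambda>y. rhs1 U P b t y" and c="1 + 3 * B\<^sup>2", OF _ iP iP norm_tm1[OF BU[OF t] BU[OF t]]]
      show "integrable lborel (\<lambda>y. rhs1 U P b t y)" by (rule d(1)) measurable
      have "(LINT y|lborel. norm (rhs1 U P b t y)) \<le> (1 + 3 * B\<^sup>2) * ((LINT x|lborel. norm (P b t x)) + (LINT x|lborel. norm (P (\<not> b) t x)))"
        by (rule d(2)) measurable
      also have "\<dots> \<le> (1 + 3 * B\<^sup>2) * (A + A)" by (intro mult_left_mono add_mono A t) auto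
      finally show "(LINT y|lborel. norm (rhs1 U P b t y)) \<le> (1 + 3 * B\<^sup>2) * (A + A)" .
    qed
    show ?thesis
    proof (rule antiderivative_propagates[where T=T and ?P0.0=p0 and ?U0.0=u0 and L=L and B="B + B" and A="(1 + 3 * B\<^sup>2) * (A + A)"
          and N="\<lambda>b t x. rhs0 U b t x" and N'="\<lambda>b t x. rhs1 U P b t x"
          and M="\<lambda>b t x. tm0 (prim (P b t) x) (prim (P (\<not> b) t) x)" and M'="\<lambda>b t x. tm1 (prim (P b t) x) (prim (P (\<not> b) t) x) (P b t x) (P (\<not> b) t x)"
          and \<kappa>="\<lambda>b t x. 2 * B * (norm (P b t x) + norm (P (\<not> b) t x))" and U=U and P=P])
      show "\<bar>t\<bar> \<le> T" by (simp add: T_def)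
      fix b t x assume t: "\<bar>t\<bar> \<le> T"
      show "norm (U b t x - prim (P b t) x) \<le> B + B"
        by (rule order_trans[OF norm_triangle_ineq4]) (intro add_mono BU BP t)
      show "norm (rhs0 U b t x - tm0 (prim (P b t) x) (prim (P (\<not> b) t) x))
         \<le> L * (norm (U b t x - prim (P b t) x) + norm (U (\<not> b) t x - prim (P (\<not> b) t) x))"
        by (rule order_trans[OF norm_tm0_diff[OF BU[OF t] BU[OF t] BP[OF t] BP[OF t]] mult_right_mono[OF L(2)]]) auto
      show "norm (rhs1 U P b t x - tm1 (prim (P b t) x) (prim (P (\<not> b) t) x) (P b t x) (P (\<not> b) t x))
         \<le> 2 * B * (norm (P b t x) + norm (P (\<not> b) t x)) * (norm (U b t x - prim (P b t) x) + norm (U (\<not> b) t x - prim (P (\<not> b) t) x))"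
        by (rule norm_tm1_diff[OF BU[OF t] BU[OF t] BP[OF t] BP[OF t]])
    next
      fix b t assume t: "\<bar>t\<bar> \<le> T"
      have "(LINT x|lborel. 2 * B * (norm (P b t x) + norm (P (\<not> b) t x))) = 2 * B * ((LINT x|lborel. norm (P b t x)) + (LINT x|lborel. norm (P (\<not> b) t x)))"
        using iP by simp
      also have "\<dots> \<le> 2 * B * (A + A)" using B by (intro mult_left_mono add_mono A t) auto
      also have "2 * B * (A + A) = 4 * B * A" by simp
      also have "\<dots> \<le> L" by (rule L(3))
      finally show "(LINT x|lborel. 2 * B * (norm (P b t x) + norm (P (\<not> b) t x))) \<le> L" .
    next
      show "plane_measurable (\<lambda>t x. rhs1 U P b t x)" for b
        using U(1) P(1) unfolding plane_measurable_def by measurable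
      show "2 * B * (norm (P b t x) + norm (P (\<not> b) t x)) \<ge> 0" for b t x using B by simp
      show "integrable lborel (p0 b)" for b by (rule data_props)
      show "u0 b = prim (p0 b)" for b by (rule u0_def)
      show "0 \<le> L" by (rule L(1))
      show "0 \<le> B + B" using B by simp
    next
      fix b t x assume t: "\<bar>t\<bar> \<le> T"
      show "integrable lborel (\<lambda>x. 2 * B * (norm (P b t x) + norm (P (\<not> b) t x)))"
        using iP by (intro integrable_mult_right Bochner_Integration.integrable_add integrable_norm)
      show "U b t x = duhamel u0 (rhs0 U) b t x" by (rule U(2))
      show "P b t x = duhamel p0 (rhs1 U P) b t x" by (rule P(2))
      show "integrable lborel (P b t)" by (rule iP)
      show "integrable lborel (\<lambda>s. indicator (seg t) s *\<^sub>R rhs0 U b s (x - dir b * (t - s)))"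
        by (rule U(4)[unfolded char_integrable_def, rule_format])
      show "integrable lborel (\<lambda>y. rhs1 U P b t y)" by (rule D(1)[OF t])
      show "(LINT y|lborel. norm (rhs1 U P b t y)) \<le> (1 + 3 * B\<^sup>2) * (A + A)" by (rule D(2)[OF t])
      show "integrable lborel (\<lambda>x. tm1 (prim (P b t) x) (prim (P (\<not> b) t) x) (P b t x) (P (\<not> b) t x))"
        by (rule prt[THEN conjunct1])
      show "tm0 (prim (P b t) x) (prim (P (\<not> b) t) x) = prim (\<lambda>x. tm1 (prim (P b t) x) (prim (P (\<not> b) t) x) (P b t x) (P (\<not> b) t x)) x"
        by (rule fun_cong[OF prt[THEN conjunct2]])
    qed
  qed
  then have UP': "U b t = prim (P b t)" for b t by auto
  have PW: "P b t x = prim (W b t) x" for b t x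
  proof -
    define T where "T = \<bar>t\<bar>"
    obtain B0 where B0: "B0 \<ge> 0" "\<And>b t x. \<bar>t\<bar> \<le> T \<Longrightarrow> norm (U b t x) \<le> B0" using lb[OF U(3)] unfolding locally_bounded_def by metis
    obtain B1 where B1: "B1 \<ge> 0" "\<And>b t x. \<bar>t\<bar> \<le> T \<Longrightarrow> norm (P b t x) \<le> B1" using lb[OF P(3)] unfolding locally_bounded_def by metis
    obtain A0 where A0: "A0 \<ge> 0" "\<And>b t. \<bar>t\<bar> \<le> T \<Longrightarrow> (LINT x|lborel. norm (P b t x)) \<le> A0"
      using transported_bound_L1(2)[OF P(3) \<phi>_props(1,3) P(1)] by metis
    obtain A1 where A1: "A1 \<ge> 0" "\<And>b t. \<bar>t\<bar> \<le> T \<Longrightarrow> (LINT x|lborel. norm (W b t x)) \<le> A1"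
      using transported_bound_L1(2)[OF W(3) \<phi>_props(2,4) W(1)] by metis
    define A where "A = A0 + A1"
    have A: "A \<ge> 0" "\<And>b t. \<bar>t\<bar> \<le> T \<Longrightarrow> (LINT x|lborel. norm (P b t x)) \<le> A" "\<And>b t. \<bar>t\<bar> \<le> T \<Longrightarrow> (LINT x|lborel. norm (W b t x)) \<le> A"
      using A0 A1 by (auto simp: A_def add_increasing add_increasing2)
    define B where "B = B0 + B1 + A"
    have B: "B \<ge> 0" using A B0 B1 by (simp add: B_def)
    have BU: "norm (U b t x) \<le> B" if "\<bar>t\<bar> \<le> T" for b t x using B0(2)[OF that, of b x] A(1) B1(1) by (simp add: B_def)
    have BP: "norm (P b t x) \<le> B" if "\<bar>t\<bar> \<le> T" for b t x using B1(2)[OF that, of b x] A(1) B0(1) by (simp add: B_def)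
    have BW: "norm (prim (W b t) x) \<le> B" if "\<bar>t\<bar> \<le> T" for b t x
      using norm_prim_le[OF iW, of b t x] A(3)[OF that, of b] B0(1) B1(1) by (simp add: B_def)
    have pr: "primitive (U b t) (P b t)" "primitive (prim (W b t)) (W b t)" for b t using iP iW UP' by (simp_all add: primitive_def)
    note prt = primitive_tm1[OF pr(1) pr(1) pr(2) pr(2), unfolded primitive_def]
    define L where "L = (1 + 3 * B\<^sup>2) + 4 * B * A"
    have L: "L \<ge> 0" "1 + 3 * B\<^sup>2 \<le> L" "4 * B * A \<le> L" using A B by (auto simp: L_def)
    let ?N = "\<lambda>b t y. rhs1 U W b t y + rhs2 U P P b t y"
    define A' where "A' = (1 + 3 * B\<^sup>2) * (A + A) + (2 * B * (B + B)) * (A + A)"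
    have D: "integrable lborel (?N b t)" "(LINT y|lborel. norm (?N b t y)) \<le> A'" if t: "\<bar>t\<bar> \<le> T" for b t
    proof -
      note d = sum_dominated_L1[where F="\<lambda>y. rhs1 U W b t y" and c="1 + 3 * B\<^sup>2", OF _ iW iW norm_tm1[OF BU[OF t] BU[OF t]]]
      have le: "norm (rhs2 U P P b t y) \<le> (2 * B * (B + B)) * (norm (P b t y) + norm (P (\<not> b) t y))" for y
        by (rule order_trans[OF norm_tm2_le[OF BU[OF t] BU[OF t]]]) (use B in \<open>intro mult_right_mono mult_left_mono add_mono BP t; simp\<close>)
      note d' = sum_dominated_L1[where F="\<lambda>y. rhs2 U P P b t y", OF _ iP iP le]
      have i: "integrable lborel (\<lambda>y. rhs1 U W b t y)"
        "integrable lborel (\<lambda>y. rhs2 U P P b t y)"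
        by (rule d(1) d'(1), measurable)+
      then show "integrable lborel (?N b t)" by (rule Bochner_Integration.integrable_add)
      then have "(LINT y|lborel. norm (?N b t y)) \<le> (LINT y|lborel. norm (rhs1 U W b t y) + norm (rhs2 U P P b t y))"
        using i by (intro integral_mono integrable_norm Bochner_Integration.integrable_add norm_triangle_ineq)
      also have "\<dots> = (LINT y|lborel. norm (rhs1 U W b t y)) + (LINT y|lborel. norm (rhs2 U P P b t y))"
        using i by (intro Bochner_Integration.integral_add integrable_norm)
      also have "\<dots> \<le> (1 + 3 * B\<^sup>2) * ((LINT x|lborel. norm (W b t x)) + (LINT x|lborel. norm (W (\<not> b) t x)))
          + (2 * B * (B + B)) * ((LINT x|lborel. norm (P b t x)) + (LINT x|lborel. norm (P (\<not> b) t x)))"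
        by (intro add_mono d(2) d'(2)) measurable
      also have "\<dots> \<le> A'" unfolding A'_def using B by (intro add_mono mult_left_mono A t) auto
      finally show "(LINT y|lborel. norm (?N b t y)) \<le> A'" .
    qed
    show ?thesis
    proof (rule antiderivative_propagates[where T=T and ?P0.0=w0 and ?U0.0=p0 and L=L and B="B + B" and A=A'
          and N="\<lambda>b t x. rhs1 U P b t x" and N'="?N"
          and M="\<lambda>b t x. tm1 (U b t x) (U (\<not> b) t x) (prim (W b t) x) (prim (W (\<not> b) t) x)"
          and M'="\<lambda>b t x. rhs1 U W b t x + tm2 (U b t x) (U (\<not> b) t x) (P b t x) (P (\<not> b) t x) (prim (W b t) x) (prim (W (\<not> b) t) x)"
          and \<kappa>="\<lambda>b t x. 2 * B * (norm (P b t x) + norm (P (\<not> b) t x))" and U=P and P=W])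
      show "\<bar>t\<bar> \<le> T" by (simp add: T_def)
      fix b t x assume t: "\<bar>t\<bar> \<le> T"
      show "norm (P b t x - prim (W b t) x) \<le> B + B"
        by (rule order_trans[OF norm_triangle_ineq4]) (intro add_mono BP BW t)
      show "norm (rhs1 U P b t x - tm1 (U b t x) (U (\<not> b) t x) (prim (W b t) x) (prim (W (\<not> b) t) x))
         \<le> L * (norm (P b t x - prim (W b t) x) + norm (P (\<not> b) t x - prim (W (\<not> b) t) x))"
        unfolding tm1_linear by (rule order_trans[OF norm_tm1[OF BU[OF t] BU[OF t]] mult_right_mono[OF L(2)]]) auto
      show "norm (?N b t x - (rhs1 U W b t x + tm2 (U b t x) (U (\<not> b) t x) (P b t x) (P (\<not> b) t x) (prim (W b t) x) (prim (W (\<not> b) t) x)))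
         \<le> 2 * B * (norm (P b t x) + norm (P (\<not> b) t x)) * (norm (P b t x - prim (W b t) x) + norm (P (\<not> b) t x - prim (W (\<not> b) t) x))"
        unfolding add_diff_cancel_left tm2_linear by (rule norm_tm2_le[OF BU[OF t] BU[OF t]])
    next
      fix b t assume t: "\<bar>t\<bar> \<le> T"
      have "(LINT x|lborel. 2 * B * (norm (P b t x) + norm (P (\<not> b) t x))) = 2 * B * ((LINT x|lborel. norm (P b t x)) + (LINT x|lborel. norm (P (\<not> b) t x)))"
        using iP by simp
      also have "\<dots> \<le> 2 * B * (A + A)" using B by (intro mult_left_mono add_mono A t) auto
      also have "2 * B * (A + A) = 4 * B * A" by simp
      also have "\<dots> \<le> L" by (rule L(3))
      finally show "(LINT x|lborel. 2 * B * (norm (P b t x) + norm (P (\<not> b) t x))) \<le> L" .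
    next
      show "plane_measurable (?N b)" for b
        using U(1) P(1) W(1) unfolding plane_measurable_def by measurable
      show "2 * B * (norm (P b t x) + norm (P (\<not> b) t x)) \<ge> 0" for b t x using B by simp
      show "integrable lborel (w0 b)" for b by (rule data_props)
      show "p0 b = prim (w0 b)" for b by (rule p0_def)
      show "0 \<le> L" by (rule L(1))
      show "0 \<le> B + B" using B by simp
    next
      fix b t x assume t: "\<bar>t\<bar> \<le> T"
      show "integrable lborel (\<lambda>x. 2 * B * (norm (P b t x) + norm (P (\<not> b) t x)))"
        using iP by (intro integrable_mult_right Bochner_Integration.integrable_add integrable_norm)
      show "P b t x = duhamel p0 (rhs1 U P) b t x" by (rule P(2))
      show "W b t x = duhamel w0 ?N b t x" by (rule W(2))
      show "integrable lborel (W b t)" by (rule iW)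
      show "integrable lborel (\<lambda>s. indicator (seg t) s *\<^sub>R rhs1 U P b s (x - dir b * (t - s)))"
        by (rule P(4)[unfolded char_integrable_def, rule_format])
      show "integrable lborel (?N b t)" by (rule D(1)[OF t])
      show "(LINT y|lborel. norm (?N b t y)) \<le> A'" by (rule D(2)[OF t])
      show "integrable lborel (\<lambda>x. rhs1 U W b t x + tm2 (U b t x) (U (\<not> b) t x) (P b t x) (P (\<not> b) t x) (prim (W b t) x) (prim (W (\<not> b) t) x))"
        by (rule prt[THEN conjunct1])
      show "tm1 (U b t x) (U (\<not> b) t x) (prim (W b t) x) (prim (W (\<not> b) t) x) = prim (\<lambda>x. rhs1 U W b t x + tm2 (U b t x) (U (\<not> b) t x) (P b t x) (P (\<not> b) t x) (prim (W b t) x) (prim (W (\<not> b) t) x)) x"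
        by (rule fun_cong[OF prt[THEN conjunct2]])
    qed
  qed
  then have PW': "P b t = prim (W b t)" for b t by auto
  show ?thesis by (rule that[of U P W, OF U(1) P(1) W(1) U(3) P(3) W(3) U(2) P(2) W(2) U(4) P(4) W(4) UP' PW'])
qed

end

section \<open>Continuity in time\<close>

definition weighted_continuous :: "(real \<Rightarrow> real \<Rightarrow> complex) \<Rightarrow> bool" where
  "weighted_continuous F \<longleftrightarrow> (\<forall>t. ((\<lambda>s. weighted_sq (\<lambda>x. F s x - F t x)) \<longlongrightarrow> 0) (at t))"

lemma norm_I_density_diff:
  assumes "H2_density a" "H2_density b"
  shows "norm_I (\<lambda>x. prim (prim a) x - prim (prim b) x) =
    sqrt (weighted_sq (\<lambda>x. prim (prim a) x - prim (prim b) x)) + sqrt (weighted_sq (\<lambda>x. prim a x - prim b x)) + sqrt (weighted_sq (\<lambda>x. a x - b x))"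
  using H2_density_norm_I[OF H2_density_diff(1)[OF assms]] unfolding H2_density_diff(3)[OF assms] unfolding H2_density_diff(2)[OF assms] .

text \<open>Continuity in \<open>\<I>\<close> is continuity in weighted \<open>L\<^sup>2\<close> of the function and its two derivatives, since
  the three summands of the norm are nonnegative.\<close>

lemma C_time_I_iff:
  "u \<in> C_time_I \<longleftrightarrow> (\<exists>w. (\<forall>t. H2_density (w t) \<and> u t = prim (prim (w t))) \<and>
     weighted_continuous u \<and> weighted_continuous (\<lambda>t. prim (w t)) \<and> weighted_continuous w)"
proof
  assume u: "u \<in> C_time_I"
  have "\<exists>w. H2_density w \<and> u t = prim (prim w)" for t
  proof -
    have "u t \<in> space_I" "continuous_on UNIV (u t)" using u by (auto simp: C_time_I_def)
    then show ?thesis using space_I_continuous_density by metis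
  qed
  then obtain w where w: "\<And>t. H2_density (w t)" "\<And>t. u t = prim (prim (w t))" by metis
  have n: "norm_I (\<lambda>x. u s x - u t x) = sqrt (weighted_sq (\<lambda>x. u s x - u t x)) + sqrt (weighted_sq (\<lambda>x. prim (w s) x - prim (w t) x)) + sqrt (weighted_sq (\<lambda>x. w s x - w t x))" for s t
    unfolding w(2) by (rule norm_I_density_diff[OF w(1) w(1)])
  have "((\<lambda>s. norm_I (\<lambda>x. u s x - u t x)) \<longlongrightarrow> 0) (at t)" for t using u by (auto simp: C_time_I_def)
  note lim = this[unfolded n]
  have sq: "((\<lambda>s. weighted_sq (F s)) \<longlongrightarrow> 0) (at t)"
    if "\<And>s. sqrt (weighted_sq (F s)) \<le> sqrt (weighted_sq (\<lambda>x. u s x - u t x)) + sqrt (weighted_sq (\<lambda>x. prim (w s) x - prim (w t) x)) + sqrt (weighted_sq (\<lambda>x. w s x - w t x))" for F :: "real \<Rightarrow> real \<Rightarrow> complex" and t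
  proof -
    have "((\<lambda>s. sqrt (weighted_sq (F s))) \<longlongrightarrow> 0) (at t)"
      by (rule tendsto_sandwich[OF _ _ tendsto_const lim[of t]])
         (intro always_eventually allI real_sqrt_ge_zero weighted_sq_nonneg that)+
    then have "((\<lambda>s. (sqrt (weighted_sq (F s)))\<^sup>2) \<longlongrightarrow> 0\<^sup>2) (at t)" by (intro tendsto_intros)
    then show ?thesis by (simp add: weighted_sq_nonneg)
  qed
  have "weighted_continuous u \<and> weighted_continuous (\<lambda>t. prim (w t)) \<and> weighted_continuous w"
    unfolding weighted_continuous_def by (intro conjI allI sq) (auto simp: weighted_sq_nonneg)
  then show "\<exists>w. (\<forall>t. H2_density (w t) \<and> u t = prim (prim (w t))) \<and>
     weighted_continuous u \<and> weighted_continuous (\<lambda>t. prim (w t)) \<and> weighted_continuous w" using w by blast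
next
  assume "\<exists>w. (\<forall>t. H2_density (w t) \<and> u t = prim (prim (w t))) \<and>
     weighted_continuous u \<and> weighted_continuous (\<lambda>t. prim (w t)) \<and> weighted_continuous w"
  then obtain w where w: "\<And>t. H2_density (w t)" "\<And>t. u t = prim (prim (w t))"
    and c: "weighted_continuous u" "weighted_continuous (\<lambda>t. prim (w t))" "weighted_continuous w" by blast
  have n: "norm_I (\<lambda>x. u s x - u t x) = sqrt (weighted_sq (\<lambda>x. u s x - u t x)) + sqrt (weighted_sq (\<lambda>x. prim (w s) x - prim (w t) x)) + sqrt (weighted_sq (\<lambda>x. w s x - w t x))" for s t
    unfolding w(2) by (rule norm_I_density_diff[OF w(1) w(1)])
  have "((\<lambda>s. norm_I (\<lambda>x. u s x - u t x)) \<longlongrightarrow> sqrt 0 + sqrt 0 + sqrt 0) (at t)" for t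
    unfolding n using c unfolding weighted_continuous_def by (intro tendsto_intros) auto
  moreover have "u t \<in> space_I \<and> continuous_on UNIV (u t)" for t
    unfolding w(2) using H2_density_space_I[OF w(1)] continuous_prim[OF H2_densityD(2)[OF w(1)]] by blast
  ultimately show "u \<in> C_time_I" by (simp add: C_time_I_def)
qed

lemma weighted_continuous_L1:
  assumes p: "\<And>t. weighted_L2 (p t)" and c: "weighted_continuous p"
  shows "((\<lambda>s. LINT x|lborel. norm (p s x - p t x)) \<longlongrightarrow> 0) (at t)"
  by (rule weighted_L2_L1_tendsto_0) (use c weighted_L2_diff[OF p p] in \<open>auto simp: weighted_continuous_def\<close>)

lemma prim_diff_le_L1:
  assumes "integrable lborel f" "integrable lborel g"
  shows "norm (prim f x - prim g x) \<le> (LINT y|lborel. norm (f y - g y))"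
  using norm_prim_le[OF Bochner_Integration.integrable_diff[OF assms], of x] by (simp add: prim_diff[OF assms])

text \<open>Continuity of the derivative in \<open>L\<^sup>1\<close> makes the antiderivative continuous in time,
  uniformly in space.\<close>

lemma prim_jointly_continuous:
  assumes p: "\<And>t. weighted_L2 (p t)" and c: "weighted_continuous p"
  shows "isCont (\<lambda>q::real \<times> real. prim (p (fst q)) (snd q)) q0"
proof -
  obtain t x where q0: "q0 = (t, x)" by (cases q0)
  note i = weighted_L2_integrable(1)[OF p]
  define \<delta> where "\<delta> = (\<lambda>s. LINT x|lborel. norm (p s x - p t x))"
  have "isCont \<delta> t" using weighted_continuous_L1[OF p c, of t] by (simp add: isCont_def \<delta>_def)
  then have "isCont (\<lambda>q. \<delta> (fst q)) q0" by (intro isCont_o2[OF isCont_fst[OF continuous_ident]]) (simp add: q0)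
  moreover have "isCont (\<lambda>q. prim (p t) (snd q)) q0"
    by (rule isCont_o2[OF isCont_snd[OF continuous_ident]])
      (use continuous_prim[OF i, of UNIV t] in \<open>simp add: q0 continuous_on_eq_continuous_at\<close>)
  ultimately have "((\<lambda>q. \<delta> (fst q) + norm (prim (p t) (snd q) - prim (p t) x)) \<longlongrightarrow> \<delta> (fst q0) + norm (prim (p t) (snd q0) - prim (p t) x)) (at q0)"
    unfolding isCont_def by (intro tendsto_intros)
  then have l: "((\<lambda>q. \<delta> (fst q) + norm (prim (p t) (snd q) - prim (p t) x)) \<longlongrightarrow> 0) (at q0)"
    by (simp add: q0 \<delta>_def)
  have "((\<lambda>q. prim (p (fst q)) (snd q) - prim (p t) x) \<longlongrightarrow> 0) (at q0)"
  proof (rule Lim_null_comparison[OF _ l])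
    have "norm (prim (p (fst q)) (snd q) - prim (p t) x) \<le> \<delta> (fst q) + norm (prim (p t) (snd q) - prim (p t) x)" for q
    proof -
      have "norm (prim (p (fst q)) (snd q) - prim (p t) x) \<le> norm (prim (p (fst q)) (snd q) - prim (p t) (snd q)) + norm (prim (p t) (snd q) - prim (p t) x)"
        using norm_triangle_ineq[of "prim (p (fst q)) (snd q) - prim (p t) (snd q)" "prim (p t) (snd q) - prim (p t) x"] by simp
      then show ?thesis using prim_diff_le_L1[OF i i, of "fst q" "snd q" t] unfolding \<delta>_def by linarith
    qed
    then show "\<forall>\<^sub>F q in at q0. norm (prim (p (fst q)) (snd q) - prim (p t) x) \<le> \<delta> (fst q) + norm (prim (p t) (snd q) - prim (p t) x)"
      by (intro always_eventually) blast
  qed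
  then show ?thesis unfolding isCont_def by (simp add: LIM_zero_iff q0)
qed

lemma prim_bounded_on_times:
  assumes p: "\<And>t. weighted_L2 (p t)" and c: "weighted_continuous p"
  obtains B where "B \<ge> 0" "\<And>t x. \<bar>t\<bar> \<le> T \<Longrightarrow> norm (prim (p t) x) \<le> B"
proof -
  note i = weighted_L2_integrable(1)[OF p]
  define n where "n = (\<lambda>t. LINT x|lborel. norm (p t x))"
  have "isCont n t" for t
  proof -
    have "\<bar>n s - n t\<bar> \<le> (LINT x|lborel. norm (p s x - p t x))" for s
    proof -
      have "n s - n t = (LINT x|lborel. norm (p s x) - norm (p t x))" unfolding n_def using i by simp
      also have "\<bar>\<dots>\<bar> \<le> (LINT x|lborel. \<bar>norm (p s x) - norm (p t x)\<bar>)" by (rule integral_abs_bound)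
      also have "\<dots> \<le> (LINT x|lborel. norm (p s x - p t x))"
        using i by (intro integral_mono norm_triangle_ineq3) auto
      finally show ?thesis .
    qed
    then have "((\<lambda>s. n s - n t) \<longlongrightarrow> 0) (at t)"
      by (intro Lim_null_comparison[OF _ weighted_continuous_L1[OF p c]]) auto
    then show ?thesis by (simp add: isCont_def LIM_zero_iff)
  qed
  then have "compact (n ` {-T..T})" by (intro compact_continuous_image continuous_at_imp_continuous_on) auto
  then obtain B where B: "\<forall>t\<in>{-T..T}. norm (n t) \<le> B" by (auto dest!: compact_imp_bounded simp: bounded_iff)
  show ?thesis
  proof (rule that[of "\<bar>B\<bar>"])
    fix t x assume t: "\<bar>t\<bar> \<le> T"
    then have "\<bar>n t\<bar> \<le> B" using B by (simp add: abs_le_iff)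
    moreover have "norm (prim (p t) x) \<le> n t" unfolding n_def by (rule norm_prim_le[OF i])
    ultimately show "norm (prim (p t) x) \<le> \<bar>B\<bar>" by linarith
  qed simp
qed

text \<open>This replaces the chain rule for a function that is not known to be differentiable in both
  variables jointly. The mean value inequality in space is applied at the varying time \<open>s\<close>, and joint continuity of
  \<open>p\<close> compares \<open>p s y\<close> with \<open>p t x\<close>.\<close>

lemma characteristic_derivative_shift:
  fixes p :: "real \<Rightarrow> real \<Rightarrow> complex"
  assumes i: "\<And>t. integrable lborel (p t)" and pc: "\<And>q. isCont (\<lambda>q. p (fst q) (snd q)) q"
  shows "((\<lambda>s. prim (p s) (x + c * (s - t)) - prim (p s) x) has_vector_derivative c *\<^sub>R p t x) (at t)"
proof -
  have ps: "continuous_on UNIV (p s)" for s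
  proof -
    have "isCont (\<lambda>y. (\<lambda>q. p (fst q) (snd q)) (s, y)) y" for y
      by (intro isCont_o2[OF _ pc] continuous_intros)
    then show ?thesis by (simp add: continuous_at_imp_continuous_on)
  qed
  note d = prim_has_vector_derivative[OF i ps]
  show ?thesis
    unfolding has_vector_derivative_def has_derivative_at_alt
  proof (intro conjI allI impI)
    show "bounded_linear (\<lambda>h. h *\<^sub>R c *\<^sub>R p t x)" by (intro bounded_linear_intros)
    fix e :: real assume e: "e > 0"
    define \<eta> where "\<eta> = e / (3 * (\<bar>c\<bar> + 1))"
    have \<eta>: "\<eta> > 0" using e by (simp add: \<eta>_def add_nonneg_pos)
    have \<eta>e: "3 * \<eta> * \<bar>c\<bar> \<le> e" using e by (simp add: \<eta>_def field_simps)
    obtain r where r: "r > 0" "\<And>q. dist q (t, x) < r \<Longrightarrow> dist (p (fst q) (snd q)) (p t x) < \<eta>"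
      using pc[of "(t, x)"] \<eta> unfolding continuous_at_eps_delta by auto
    (* times closer than k to t keep the whole spatial segment in the r-neighbourhood of (t, x) *)
    define k where "k = r / (2 * (\<bar>c\<bar> + 1))"
    have k: "k > 0" using r by (simp add: k_def add_nonneg_pos)
    have near: "norm (p s y - p t x) \<le> \<eta>" if s: "\<bar>s - t\<bar> < k" and y: "\<bar>y - x\<bar> \<le> \<bar>c\<bar> * \<bar>s - t\<bar>" for s y
    proof -
      have "dist (s, y) (t, x) \<le> \<bar>s - t\<bar> + \<bar>y - x\<bar>"
        unfolding dist_prod_def using sqrt_sum_squares_le_sum_abs[of "s - t" "y - x"] by (simp add: dist_real_def)
      also have "\<dots> \<le> (\<bar>c\<bar> + 1) * \<bar>s - t\<bar>" using y by (simp add: algebra_simps)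
      also have "\<dots> \<le> (\<bar>c\<bar> + 1) * k" using s by (intro mult_left_mono) auto
      also have "\<dots> < r" using r by (simp add: k_def field_simps add_pos_nonneg)
      finally show ?thesis using r(2)[of "(s, y)"] by (simp add: dist_norm)
    qed
    show "\<exists>d>0. \<forall>s. norm (s - t) < d \<longrightarrow>
       norm (prim (p s) (x + c * (s - t)) - prim (p s) x - (prim (p t) (x + c * (t - t)) - prim (p t) x) - (s - t) *\<^sub>R c *\<^sub>R p t x) \<le> e * norm (s - t)"
    proof (intro exI[of _ k] conjI k allI impI)
      fix s assume s: "norm (s - t) < k"
      define h where "h = c * (s - t)"
      have seg: "\<bar>y - x\<bar> \<le> \<bar>c\<bar> * \<bar>s - t\<bar>" if "y \<in> closed_segment x (x + h)" for y
        using that by (auto simp: closed_segment_eq_real_ivl h_def abs_mult[symmetric] split: if_splits)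
      have 1: "norm (prim (p s) (x + h) - prim (p s) x - ((x + h) - x) *\<^sub>R p s x) \<le> norm ((x + h) - x) * (2 * \<eta>)"
      proof (rule vector_differentiable_bound_linearization[where S="closed_segment x (x + h)"])
        show "(prim (p s) has_vector_derivative p s y) (at y within closed_segment x (x + h))" for y
          by (rule has_vector_derivative_at_within[OF d])
        show "norm (p s y - p s x) \<le> 2 * \<eta>" if "y \<in> closed_segment x (x + h)" for y
        proof -
          have "norm (p s y - p t x) \<le> \<eta>" "norm (p s x - p t x) \<le> \<eta>" using near s seg[OF that] by auto
          then show ?thesis using norm_triangle_ineq4[of "p s y - p t x" "p s x - p t x"] by simp
        qed
      qed auto
      have 2: "norm (h *\<^sub>R (p s x - p t x)) \<le> \<bar>h\<bar> * \<eta>" using near[of s x] s by (simp add: mult_left_mono)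
      have "norm (prim (p s) (x + h) - prim (p s) x - h *\<^sub>R p t x) \<le> \<bar>h\<bar> * (2 * \<eta>) + \<bar>h\<bar> * \<eta>"
      proof -
        have e: "prim (p s) (x + h) - prim (p s) x - h *\<^sub>R p t x = (prim (p s) (x + h) - prim (p s) x - h *\<^sub>R p s x) + h *\<^sub>R (p s x - p t x)"
          by (simp add: scaleR_diff_right)
        show ?thesis unfolding e
          by (rule order_trans[OF norm_triangle_ineq add_mono]) (use 1 2 in simp_all)
      qed
      also have "\<dots> = (3 * \<eta> * \<bar>c\<bar>) * \<bar>s - t\<bar>" by (simp add: h_def abs_mult)
      also have "\<dots> \<le> e * \<bar>s - t\<bar>" using \<eta>e by (rule mult_right_mono) simp
      finally show "norm (prim (p s) (x + c * (s - t)) - prim (p s) x - (prim (p t) (x + c * (t - t)) - prim (p t) x) - (s - t) *\<^sub>R c *\<^sub>R p t x) \<le> e * norm (s - t)"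
        by (simp add: h_def mult.commute)
    qed
  qed
qed

text \<open>Along a characteristic the solution is the sum of a constant and an integral, hence continuous
  in time even where the data are not continuous in space.\<close>

lemma duhamel_weighted_continuous:
  assumes eq: "\<And>t x. F b t x = duhamel F0 N b t x" and m: "plane_measurable (F b)"
    and tb: "transported_bound \<phi> F" and \<phi>: "weighted_L2 \<phi>" "\<And>x. \<phi> x \<ge> 0" and ci: "char_integrable N"
  shows "weighted_continuous (F b)" "weighted_L2 (F b t)"
proof -
  note i\<phi> = weighted_L2_integrable(1)[OF \<phi>(1)]
  note wt = kernel_average_weighted_L2[OF \<phi>]
  have W: "weighted_L2 (\<lambda>y. C * (\<phi> (y + h) + K * kernel_average \<phi> y))" for C K h
    by (rule weighted_L2_dominated(1)[OF weighted_L2_add(1)[OF weighted_L2_translate(1)[OF \<phi>(1)] weighted_L2_dominated(1)[OF wt, of "\<lambda>y. K * kernel_average \<phi> y" "\<bar>K\<bar>"]], where C="\<bar>C\<bar>"])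
       (use weighted_L2D(1)[OF \<phi>(1)] weighted_L2D(1)[OF wt] in \<open>auto simp: abs_mult\<close>)
  show "weighted_L2 (F b t)"
  proof -
    obtain C where C: "C \<ge> 0" "\<And>b' s x. \<bar>s\<bar> \<le> \<bar>t\<bar> \<Longrightarrow> norm (F b' s x) \<le> C * (\<phi> (x - dir b' * s) + kernel_average \<phi> x)"
      using tb unfolding transported_bound_def by blast
    show ?thesis
      by (rule weighted_L2_dominated(1)[OF W[of C "- (dir b * t)" 1] plane_measurable_slice[OF m], of t 1])
         (use C(2)[OF order_refl, of b] in \<open>auto intro: order_trans[OF _ abs_ge_self]\<close>)
  qed
  show "weighted_continuous (F b)"
    unfolding weighted_continuous_def
  proof
    fix t :: real
    define T where "T = \<bar>t\<bar> + 1"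
    obtain C where C: "C \<ge> 0" "\<And>b' s x. \<bar>s\<bar> \<le> T \<Longrightarrow> norm (F b' s x) \<le> C * (\<phi> (x - dir b' * s) + kernel_average \<phi> x)"
      using tb unfolding transported_bound_def by blast
    show "((\<lambda>s. weighted_sq (\<lambda>x. F b s x - F b t x)) \<longlongrightarrow> 0) (at t)"
    proof (rule weighted_L2_continuous_along_characteristics[where T=T and c="dir b" and \<psi>="\<lambda>y. C * (\<phi> (y + 0) + (1 + T)^4 * kernel_average \<phi> y)"])
      show "F b s \<in> borel_measurable borel" for s by (rule plane_measurable_slice[OF m])
      show "weighted_L2 (\<lambda>y. C * (\<phi> (y + 0) + (1 + T)^4 * kernel_average \<phi> y))" by (rule W)
      show "norm (F b s (y + dir b * s)) \<le> C * (\<phi> (y + 0) + (1 + T)^4 * kernel_average \<phi> y)" if s: "\<bar>s\<bar> \<le> T" for s y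
      proof -
        have "kernel_average \<phi> (y + dir b * s) \<le> (1 + \<bar>dir b * s\<bar>)^4 * kernel_average \<phi> y"
          by (rule kernel_average_shift[OF i\<phi> \<phi>(2)])
        also have "\<dots> \<le> (1 + T)^4 * kernel_average \<phi> y"
          using s by (intro mult_right_mono power_mono kernel_average_nonneg \<phi>) auto
        finally have "C * (\<phi> y + kernel_average \<phi> (y + dir b * s)) \<le> C * (\<phi> y + (1 + T)^4 * kernel_average \<phi> y)"
          using C(1) by (intro mult_left_mono add_left_mono)
        then show ?thesis using C(2)[OF s, of b "y + dir b * s"] by simp
      qed
      show "isCont (\<lambda>s. F b s (y + dir b * s)) t" for y
      proof -
        define g where "g = (\<lambda>s. N b s (y + dir b * s))"
        have Fg: "F b s (y + dir b * s) = F0 b y + vint g s" for s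
          by (simp add: eq duhamel_def g_def algebra_simps)
        have "integrable lborel (\<lambda>s. indicator (seg t) s *\<^sub>R g s)" for t
          using ci[unfolded char_integrable_def, rule_format, of t b "y + dir b * t"] by (simp add: g_def algebra_simps)
        then have "isCont (vint g) t" by (intro vint_isCont seg_integrable_imp_set_integrable)
        then show ?thesis unfolding Fg by (intro continuous_intros)
      qed
    qed (auto simp: T_def)
  qed
qed

section \<open>Classical solutions, uniqueness, and the theorem\<close>

lemma C_time_I_regular:
  assumes "u \<in> C_time_I"
  obtains p where "\<And>t. integrable lborel (p t)" "\<And>t. u t = prim (p t)" "\<And>q. isCont (\<lambda>q. p (fst q) (snd q)) q"
    "\<And>q. isCont (\<lambda>q. u (fst q) (snd q)) q" "\<And>T. \<exists>B\<ge>0. \<forall>t x. \<bar>t\<bar> \<le> T \<longrightarrow> norm (u t x) \<le> B"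
proof -
  obtain w where w: "\<And>t. H2_density (w t)" "\<And>t. u t = prim (prim (w t))"
    and c: "weighted_continuous u" "weighted_continuous (\<lambda>t. prim (w t))" "weighted_continuous w"
    using assms unfolding C_time_I_iff by blast
  note D = H2_densityD[OF w(1)]
  show ?thesis
  proof (rule that[of "\<lambda>t. prim (w t)"])
    show "isCont (\<lambda>q. prim (w (fst q)) (snd q)) q" for q by (rule prim_jointly_continuous[OF D(3) c(3)])
    show "isCont (\<lambda>q. u (fst q) (snd q)) q" for q unfolding w(2) by (rule prim_jointly_continuous[OF D(4) c(2)])
    show "\<exists>B\<ge>0. \<forall>t x. \<bar>t\<bar> \<le> T \<longrightarrow> norm (u t x) \<le> B" for T
    proof -
      obtain B where B: "B \<ge> 0" "\<And>t x. \<bar>t\<bar> \<le> T \<Longrightarrow> norm (prim (prim (w t)) x) \<le> B"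
        using prim_bounded_on_times[OF D(4) c(2), of T] by metis
      then show ?thesis unfolding w(2) by blast
    qed
  qed (use D w in auto)
qed

lemma isCont_slice:
  assumes "\<And>q. isCont (\<lambda>q. F (fst q) (snd q)) q" "continuous_on UNIV g" "continuous_on UNIV h"
  shows "continuous_on UNIV (\<lambda>s::real. F (g s::real) (h s::real) :: complex)"
proof -
  have "isCont (\<lambda>s. (\<lambda>q. F (fst q) (snd q)) (g s, h s)) s" for s
    using assms(2,3) by (intro isCont_o2[OF _ assms(1)] continuous_Pair) (auto simp: continuous_on_eq_continuous_at)
  then show ?thesis by (simp add: continuous_at_imp_continuous_on)
qed

lemma time_derivative_iff_characteristic_derivative:
  assumes i: "\<And>t. integrable lborel (p t)" and u: "\<And>t. u t = prim (p t)" and pc: "\<And>q. isCont (\<lambda>q. p (fst q) (snd q)) q"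
  shows "((\<lambda>s. u s x) has_vector_derivative D) (at t) \<longleftrightarrow> ((\<lambda>s. u s (x + c * (s - t))) has_vector_derivative D + c *\<^sub>R p t x) (at t)"
proof -
  note sh = characteristic_derivative_shift[where p=p and c=c and t=t and x=x, OF i pc, folded u]
  show ?thesis
  proof
    assume "((\<lambda>s. u s x) has_vector_derivative D) (at t)"
    from has_vector_derivative_add[OF this sh] show "((\<lambda>s. u s (x + c * (s - t))) has_vector_derivative D + c *\<^sub>R p t x) (at t)" by simp
  next
    assume "((\<lambda>s. u s (x + c * (s - t))) has_vector_derivative D + c *\<^sub>R p t x) (at t)"
    from has_vector_derivative_diff[OF this sh] show "((\<lambda>s. u s x) has_vector_derivative D) (at t)" by simp
  qed
qed

text \<open>By \<open>time_derivative_iff_characteristic_derivative\<close> the combination of the time derivative and the spatial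
  derivative in the system is a derivative along the characteristic.\<close>

lemma massive_Thirring_iff:
  assumes i: "\<And>b t. integrable lborel (p b t)" and u: "\<And>b t. U b t = prim (p b t)" and pc: "\<And>b q. isCont (\<lambda>q. p b (fst q) (snd q)) q"
  shows "massive_Thirring (U True) (U False) \<longleftrightarrow>
    (\<forall>b t x. ((\<lambda>s. U b s (x + dir b * (s - t))) has_vector_derivative rhs0 U b t x) (at t))"
proof -
  have ps: "continuous_on UNIV (p b t)" for b t
    using isCont_slice[of "p b" "\<lambda>_. t" "\<lambda>x. x"] pc by (simp add: continuous_on_id)
  have dx: "(U b t has_vector_derivative p b t x) (at x)" for b t x
    unfolding u by (rule prim_has_vector_derivative[OF i ps])
  note ch = time_derivative_iff_characteristic_derivative[OF i u pc]
  (* the equation in the form given for the system, divided by i *)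
  have alg: "\<i> * (D + of_real (dir b) * q) + c + of_real ((norm c)\<^sup>2) * a = 0 \<longleftrightarrow> D + dir b *\<^sub>R q = tm0 a c" for D q c a b
  proof -
    have "\<i> * (D + of_real (dir b) * q) + c + of_real ((norm c)\<^sup>2) * a = \<i> * ((D + dir b *\<^sub>R q) - tm0 a c)"
      unfolding tm0_def complex_norm_square by (simp add: scaleR_conv_of_real algebra_simps)
    then show ?thesis by simp
  qed
  show ?thesis
  proof
    assume M: "massive_Thirring (U True) (U False)"
    show "\<forall>b t x. ((\<lambda>s. U b s (x + dir b * (s - t))) has_vector_derivative rhs0 U b t x) (at t)"
    proof (intro allI)
      fix b t x
      define D where "D = vector_derivative (\<lambda>s. U b s x) (at t)"
      have "(\<lambda>s. U b s x) differentiable (at t)" using M unfolding massive_Thirring_def by (cases b) auto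
      then have D: "((\<lambda>s. U b s x) has_vector_derivative D) (at t)" unfolding D_def by (simp add: vector_derivative_works)
      have "\<i> * (D + of_real (dir b) * p b t x) + U (\<not> b) t x + of_real ((norm (U (\<not> b) t x))\<^sup>2) * U b t x = 0"
        using M[unfolded massive_Thirring_def, rule_format, of x t]
          vector_derivative_at[OF dx[of True t x]] vector_derivative_at[OF dx[of False t x]]
        unfolding D_def by (cases b) (simp_all add: dir_def)
      then show "((\<lambda>s. U b s (x + dir b * (s - t))) has_vector_derivative rhs0 U b t x) (at t)"
        using D[unfolded ch[where c="dir b"]] unfolding alg by simp
    qed
  next
    assume C: "\<forall>b t x. ((\<lambda>s. U b s (x + dir b * (s - t))) has_vector_derivative rhs0 U b t x) (at t)"
    have D: "((\<lambda>s. U b s x) has_vector_derivative rhs0 U b t x - dir b *\<^sub>R p b t x) (at t)" for b t x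
      unfolding ch[where c="dir b"] using C by simp
    have e: "\<i> * ((rhs0 U b t x - dir b *\<^sub>R p b t x) + of_real (dir b) * p b t x) + U (\<not> b) t x + of_real ((norm (U (\<not> b) t x))\<^sup>2) * U b t x = 0" for b t x
      unfolding alg by simp
    show "massive_Thirring (U True) (U False)"
      unfolding massive_Thirring_def
      using e[of True] e[of False] D[THEN vector_derivative_at] dx[THEN vector_derivative_at]
        D[THEN differentiableI_vector] dx[THEN differentiableI_vector]
      by (simp add: dir_def)
  qed
qed

text \<open>Derivatives along characteristics are continuous in time because the solution is jointly
  continuous, so the fundamental theorem of calculus applies.\<close>

lemma solution_duhamel:
  assumes U: "\<And>b. U b \<in> C_time_I" and M: "massive_Thirring (U True) (U False)"
  shows "U b t x = duhamel (\<lambda>b. U b 0) (rhs0 U) b t x"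
    "char_integrable (rhs0 U)"
proof -
  have "\<exists>p. (\<forall>t. integrable lborel (p t)) \<and> (\<forall>t. U b t = prim (p t)) \<and> (\<forall>q. isCont (\<lambda>q. p (fst q) (snd q)) q)" for b
    using C_time_I_regular[OF U[of b]] by metis
  then obtain p where p: "\<And>b t. integrable lborel (p b t)" "\<And>b t. U b t = prim (p b t)" "\<And>b q. isCont (\<lambda>q. p b (fst q) (snd q)) q"
    by metis
  have uc: "isCont (\<lambda>q. U b (fst q) (snd q)) q" for b q using C_time_I_regular[OF U[of b]] by metis
  define g where "g = (\<lambda>b y s. rhs0 U b s (y + dir b * s))"
  have gc: "continuous_on UNIV (g b y)" for b y
    unfolding g_def tm0_def by (intro continuous_intros isCont_slice uc)
  have d: "((\<lambda>s. U b s (y + dir b * s)) has_vector_derivative g b y t) (at t)" for b y t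
    using M[unfolded massive_Thirring_iff[where U=U and p=p, OF p], rule_format, of b "y + dir b * t" t]
    by (simp add: g_def algebra_simps)
  have "U b t (y + dir b * t) = U b 0 (y + dir b * 0) + vint (g b y) t" for y
    by (rule vint_FTC[OF d gc])
  from this[of "x - dir b * t"] show "U b t x = duhamel (\<lambda>b. U b 0) (rhs0 U) b t x"
    by (simp add: duhamel_def g_def algebra_simps)
  show "char_integrable (rhs0 U)"
    unfolding char_integrable_def
  proof (intro allI)
    fix b t x
    have "integrable lborel (\<lambda>s. indicator (seg t) s *\<^sub>R g b (x - dir b * t) s)"
      using continuous_imp_set_integrable[OF gc] by (simp add: set_integrable_def)
    then show "integrable lborel (\<lambda>s. indicator (seg t) s *\<^sub>R rhs0 U b s (x - dir b * (t - s)))"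
      by (simp add: g_def algebra_simps)
  qed
qed

text \<open>Both solutions are bounded on bounded time intervals, where the nonlinearity is Lipschitz.\<close>

lemma massive_Thirring_unique:
  assumes U: "\<And>b. U b \<in> C_time_I" "massive_Thirring (U True) (U False)"
    and V: "\<And>b. V b \<in> C_time_I" "massive_Thirring (V True) (V False)"
    and init: "\<And>b. U b 0 = V b 0"
  shows "U b t x = V b t x"
proof -
  define T where "T = \<bar>t\<bar>"
  have bd: "\<exists>B\<ge>0. \<forall>t x. \<bar>t\<bar> \<le> T \<longrightarrow> norm (u t x) \<le> B" if "u \<in> C_time_I" for u
    using C_time_I_regular[OF that] by metis
  have "\<exists>B\<ge>0. \<forall>b t x. \<bar>t\<bar> \<le> T \<longrightarrow> norm (U b t x) \<le> B \<and> norm (V b t x) \<le> B"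
  proof -
    obtain B1 where 1: "B1 \<ge> 0" "\<And>t x. \<bar>t\<bar> \<le> T \<Longrightarrow> norm (U True t x) \<le> B1" using bd[OF U(1)] by blast
    obtain B2 where 2: "B2 \<ge> 0" "\<And>t x. \<bar>t\<bar> \<le> T \<Longrightarrow> norm (U False t x) \<le> B2" using bd[OF U(1)] by blast
    obtain B3 where 3: "B3 \<ge> 0" "\<And>t x. \<bar>t\<bar> \<le> T \<Longrightarrow> norm (V True t x) \<le> B3" using bd[OF V(1)] by blast
    obtain B4 where 4: "B4 \<ge> 0" "\<And>t x. \<bar>t\<bar> \<le> T \<Longrightarrow> norm (V False t x) \<le> B4" using bd[OF V(1)] by blast
    show ?thesis
    proof (intro exI[of _ "B1 + B2 + B3 + B4"] conjI allI impI)
      fix b t x assume t: "\<bar>t\<bar> \<le> T"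
      show "norm (U b t x) \<le> B1 + B2 + B3 + B4" "norm (V b t x) \<le> B1 + B2 + B3 + B4"
        using 1(1) 2(1) 3(1) 4(1) 1(2)[OF t, of x] 2(2)[OF t, of x] 3(2)[OF t, of x] 4(2)[OF t, of x] by (cases b; simp)+
    qed (use 1 2 3 4 in auto)
  qed
  then obtain B where B: "B \<ge> 0" "\<And>b t x. \<bar>t\<bar> \<le> T \<Longrightarrow> norm (U b t x) \<le> B" "\<And>b t x. \<bar>t\<bar> \<le> T \<Longrightarrow> norm (V b t x) \<le> B" by blast
  note DU = solution_duhamel[OF U] and DV = solution_duhamel[OF V]
  have "U b t x - V b t x = 0"
  proof (rule duhamel_difference_vanishes[where T=T and d="\<lambda>b t x. U b t x - V b t x" and B="B + B" and L="2 * (1 + 3 * B\<^sup>2)"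
        and G="\<lambda>b t x. rhs0 U b t x - rhs0 V b t x"])
    show "norm (U b t x - V b t x) \<le> B + B" if "\<bar>t\<bar> \<le> T" for b t x
      by (rule order_trans[OF norm_triangle_ineq4]) (intro add_mono B that)
    show "U b t x - V b t x = vint (\<lambda>s. rhs0 U b s (x - dir b * (t - s)) - rhs0 V b s (x - dir b * (t - s))) t" for b t x
    proof -
      have "U b t x - V b t x = vint (\<lambda>s. rhs0 U b s (x - dir b * (t - s))) t
         - vint (\<lambda>s. rhs0 V b s (x - dir b * (t - s))) t"
        using DU(1)[of b t x] DV(1)[of b t x] init[of b] by (simp add: duhamel_def)
      then show ?thesis
        by (simp only: vint_diff[OF DU(2)[unfolded char_integrable_def, rule_format] DV(2)[unfolded char_integrable_def, rule_format]])
    qed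
    show "norm (rhs0 U b s x - rhs0 V b s x) \<le> 2 * (1 + 3 * B\<^sup>2) * q"
      if s: "\<bar>s\<bar> \<le> T" and q: "q \<ge> 0" "\<And>b x. norm (U b s x - V b s x) \<le> q" for b s x q
    proof -
      have "norm (rhs0 U b s x - rhs0 V b s x) \<le> (1 + 3 * B\<^sup>2) * (norm (U b s x - V b s x) + norm (U (\<not> b) s x - V (\<not> b) s x))"
        by (intro norm_tm0_diff B s)
      also have "\<dots> \<le> (1 + 3 * B\<^sup>2) * (q + q)" by (intro mult_left_mono add_mono q) auto
      finally show ?thesis by (simp add: algebra_simps)
    qed
    show "\<bar>t\<bar> \<le> T" by (simp add: T_def)
  qed (use B in auto)
  then show ?thesis by simp
qed

lemma (in thirring_data) global_solution:
  obtains U where "\<And>b. U b \<in> C_time_I" "massive_Thirring (U True) (U False)" "\<And>b. U b 0 = u0 b"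
proof (rule exists_solution_with_derivatives)
  fix U P W
  assume m: "\<And>b. plane_measurable (U b)" "\<And>b. plane_measurable (P b)" "\<And>b. plane_measurable (W b)"
    and tb: "transported_bound \<phi>1 U" "transported_bound \<phi>1 P" "transported_bound \<phi>2 W"
    and eq: "\<And>b t x. U b t x = duhamel u0 (rhs0 U) b t x"
    "\<And>b t x. P b t x = duhamel p0 (rhs1 U P) b t x"
    "\<And>b t x. W b t x = duhamel w0 (\<lambda>b t x. rhs1 U W b t x
        + rhs2 U P P b t x) b t x"
    and ci: "char_integrable (rhs0 U)"
    "char_integrable (rhs1 U P)"
    "char_integrable (\<lambda>b t x. rhs1 U W b t x
        + rhs2 U P P b t x)"
    and UP: "\<And>b t. U b t = prim (P b t)" and PW: "\<And>b t. P b t = prim (W b t)"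
  note CU = duhamel_weighted_continuous[OF eq(1) m(1) tb(1) \<phi>_props(1,3) ci(1)]
  note CP = duhamel_weighted_continuous[OF eq(2) m(2) tb(2) \<phi>_props(1,3) ci(2)]
  note CW = duhamel_weighted_continuous[OF eq(3) m(3) tb(3) \<phi>_props(2,4) ci(3)]
  have H: "H2_density (W b t)" for b t
    unfolding H2_density_def PW[symmetric] UP[symmetric] by (intro conjI CU CP CW)
  have C: "U b \<in> C_time_I" for b
    unfolding C_time_I_iff
  proof (intro exI[of _ "W b"] conjI allI H)
    show "U b t = prim (prim (W b t))" for t unfolding PW[symmetric] by (rule UP)
    show "weighted_continuous (\<lambda>t. prim (W b t))" unfolding PW[symmetric] using CP(1)[of b] .
  qed (rule CU CW)+
  have iP: "integrable lborel (P b t)" for b t by (rule weighted_L2_integrable(1)[OF CP(2)])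
  have Pc: "isCont (\<lambda>q. P b (fst q) (snd q)) q" for b q
    unfolding PW by (rule prim_jointly_continuous[OF CW(2) CW(1)])
  have Uc: "isCont (\<lambda>q. U b (fst q) (snd q)) q" for b q
    unfolding UP by (rule prim_jointly_continuous[OF CP(2) CP(1)])
  have "massive_Thirring (U True) (U False)"
    unfolding massive_Thirring_iff[where U=U and p=P, OF iP UP Pc]
  proof (intro allI)
    fix b t x
    define g where "g = (\<lambda>s. rhs0 U b s (x + dir b * (s - t)))"
    have gc: "continuous_on UNIV g"
      unfolding g_def tm0_def by (intro continuous_intros isCont_slice Uc)
    have Ug: "U b s (x + dir b * (s - t)) = u0 b (x - dir b * t) + vint g s" for s
      using eq(1)[of b s "x + dir b * (s - t)"] by (simp add: duhamel_def g_def algebra_simps)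
    have "((\<lambda>s. u0 b (x - dir b * t) + vint g s) has_vector_derivative 0 + g t) (at t)"
      by (intro has_vector_derivative_add has_vector_derivative_const vint_has_vector_derivative gc)
    then show "((\<lambda>s. U b s (x + dir b * (s - t))) has_vector_derivative rhs0 U b t x) (at t)"
      unfolding Ug by (simp add: g_def)
  qed
  moreover have "U b 0 = u0 b" for b
  proof
    show "U b 0 x = u0 b x" for x using eq(1)[of b 0 x] by (simp add: duhamel_def vint_def)
  qed
  ultimately show thesis using that C by blast
qed

theorem theorem10p2:
  fixes u0 v0 :: "real \<Rightarrow> complex"
  assumes "u0 \<in> space_I" and "v0 \<in> space_I"
  shows "\<exists>!(u, v). u \<in> C_time_I \<and> v \<in> C_time_I \<and> massive_Thirring u v \<and>
           (AE x in lebesgue. u 0 x = u0 x) \<and> (AE x in lebesgue. v 0 x = v0 x)"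
proof -
  obtain wu where wu: "H2_density wu" "AE x in lebesgue. u0 x = prim (prim wu) x" using space_I_density[OF assms(1)] .
  obtain wv where wv: "H2_density wv" "AE x in lebesgue. v0 x = prim (prim wv) x" using space_I_density[OF assms(2)] .
  interpret D: thirring_data "\<lambda>b. if b then wu else wv"
    by standard (use wu wv in auto)
  obtain U where U: "\<And>b. U b \<in> C_time_I" "massive_Thirring (U True) (U False)" "\<And>b. U b 0 = D.u0 b"
    by (rule D.global_solution) (rule that)
  have U0: "U True 0 = prim (prim wu)" "U False 0 = prim (prim wv)"
    unfolding U(3) D.u0_def D.p0_def by simp_all
  have init: "AE x in lebesgue. U True 0 x = u0 x" "AE x in lebesgue. U False 0 x = v0 x"
    unfolding U0 using wu(2) wv(2) by (eventually_elim, simp)+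
  have cont: "continuous_on UNIV (u 0)" if "u \<in> C_time_I" for u :: "real \<Rightarrow> real \<Rightarrow> complex"
    using that by (simp add: C_time_I_def)
  have uniq: "u = U True \<and> v = U False"
    if u: "u \<in> C_time_I" and v: "v \<in> C_time_I" and M: "massive_Thirring u v"
      and i: "AE x in lebesgue. u 0 x = u0 x" "AE x in lebesgue. v 0 x = v0 x" for u v
  proof -
    define V where "V = (\<lambda>b. if b then u else v)"
    have "u 0 = U True 0"
      using i(1) init(1) by (intro continuous_AE_eq cont u U) (auto elim: eventually_elim2)
    moreover have "v 0 = U False 0"
      using i(2) init(2) by (intro continuous_AE_eq cont v U) (auto elim: eventually_elim2)
    ultimately have "V b 0 = U b 0" for b by (cases b) (simp_all add: V_def)
    then have "V b t x = U b t x" for b t x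
      by (intro massive_Thirring_unique[of V U] U) (use u v M in \<open>auto simp: V_def\<close>)
    from this[of True] this[of False] show ?thesis by (auto simp: V_def fun_eq_iff)
  qed
  show ?thesis
  proof (rule ex1I[of _ "(U True, U False)"])
    show "case (U True, U False) of (u, v) \<Rightarrow> u \<in> C_time_I \<and> v \<in> C_time_I \<and> massive_Thirring u v \<and>
           (AE x in lebesgue. u 0 x = u0 x) \<and> (AE x in lebesgue. v 0 x = v0 x)"
      using U init by simp
    fix uv assume "case uv of (u, v) \<Rightarrow> u \<in> C_time_I \<and> v \<in> C_time_I \<and> massive_Thirring u v \<and>
           (AE x in lebesgue. u 0 x = u0 x) \<and> (AE x in lebesgue. v 0 x = v0 x)"
    then show "uv = (U True, U False)" using uniq by (auto split: prod.splits)
  qed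
qed

end
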